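(* Let $n\ge1$, $m>0$, $\varepsilon>0$, and let $\mathcal S=\{S_t\}_{t>0}$ be an approximation of the identity in $\mathbb R^n$ of order $m$ with constant $\varepsilon$, such that $\mathcal S'=\{t\partial_tS_t\}_{t>0}$ satisfies the bounds of order $m$ with constant $\varepsilon$. Let $1<p_1,p_2<\infty$, $q>0$ and $0<\alpha<\min\{1,\varepsilon\}$ be such that $\frac1q=\frac1{p_1}+\frac1{p_2}-\frac{1-\alpha}{n}$. If $(w_1,w_2)$ satisfies the $A_{(p_1,p_2),q}$ condition and $w:=w_1^{q/p_1}w_2^{q/p_2}$, then there exists a constant $C$ such that for all Euclidean balls $B\subset\mathbb R^n$ and all admissible functions $f,g$, $$\|fg-S_{r(B)^m}(f)S_{r(B)^m}(g)\|_{L^q_w(B)}\le C\,r(B)^\alpha\sum_{l\ge0}2^{-l(\varepsilon-\alpha)}\Big[\|\nabla f\|_{L^{p_1}_{w_1}(2^{l+1}B)}\|g\|_{L^{p_2}_{w_2}(2^{l+1}B)}+\|f\|_{L^{p_1}_{w_1}(2^{l+1}B)}\|\nabla g\|_{L^{p_2}_{w_2}(2^{l+1}B)}\Big].$$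
   Context: For a ball $B$, $r(B)$ is its radius and $\lambda B$ is the concentric ball of radius $\lambda r(B)$. For a weight $w$ (nonnegative locally integrable function) and $p>0$, $\|h\|_{L^p_w(E)}=(\int_E|h|^pw\,dx)^{1/p}$. The pair of weights $(w_1,w_2)$ satisfies the $A_{(p_1,p_2),q}$ condition if, with $w=w_1^{q/p_1}w_2^{q/p_2}$, $$\sup_B\Big(\frac1{|B|}\int_Bw\,dx\Big)\prod_{j=1}^2\Big(\frac1{|B|}\int_Bw_j^{1-p_j'}\,dx\Big)^{q/p_j'}<\infty,$$ the supremum being over all Euclidean balls, $1/p_j+1/p_j'=1$. An approximation of the identity of order $m>0$ in $\mathbb R^n$ with constant $\varepsilon>0$ is a family $\{S_t\}_{t>0}$ of operators $S_tf(x)=\int_{\mathbb R^n}p_t(x,y)f(y)\,dy$ such that for each $t>0$: $\int_{\mathbb R^n}p_t(x,y)\,dy=1$ for all $x$, and $$|p_t(x,y)|\le t^{-n/m}\gamma\big(|x-y|/t^{1/m}\big),\qquad x,y\in\mathbb R^n,\qquad( * )$$ where $\gamma:[0,\infty)\to[0,\infty)$ is bounded, decreasing and $\lim_{r\to\infty}r^{2n+\varepsilon}\gamma(r)=0$. "$\mathcal S'=\{t\partial_tS_t\}_{t>0}$ satisfies the bounds of order $m$ with constant $\varepsilon$" means: $p_t(x,y)$ is differentiable in $t>0$ and the kernels $t\partial_tp_t(x,y)$ of $t\partial_tS_t$ satisfy $( * )$ with the same $m$ and some (possibly different) bounded decreasing $\gamma$ with $\lim_{r\to\infty}r^{2n+\varepsilon}\gamma(r)=0$.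 Admissible functions: $f,g\in C^1(\mathbb R^n)$ with $\int_{\mathbb R^n}(|f(y)|+|g(y)|)(1+|y|)^{-2n-\varepsilon}dy<\infty$, so that $S_tf,S_tg$ are given by absolutely convergent integrals. *)

theory Defs
  imports "HOL-Analysis.Analysis"
begin

text \<open>Real powers of extended nonnegative reals, with \<open>0\<close> to a negative power equal to
  \<open>\<infinity>\<close>.  The library's \<open>powr\<close> on the reals has \<open>0 powr a = 0\<close> for
  every \<open>a\<close>, which is the wrong convention for \<open>w\<^sub>j\<close> to the negative power
  \<open>1 - p\<^sub>j'\<close> where the weight vanishes.\<close>

definition ennpow :: "ennreal \<Rightarrow> real \<Rightarrow> ennreal" where
  "ennpow x a =
    (if a = 0 then 1
     else if (x = 0 \<and> a < 0) \<or> (x = \<infinity> \<and> a > 0) then \<infinity>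
     else ennreal (enn2real x powr a))"

definition conj_exp :: "real \<Rightarrow> real" where
  "conj_exp p = p / (p - 1)"

definition weight :: "('a::euclidean_space \<Rightarrow> real) \<Rightarrow> bool" where
  "weight w \<longleftrightarrow> (\<forall>x. 0 \<le> w x) \<and> (\<forall>K. compact K \<longrightarrow> w absolutely_integrable_on K)"

definition wnorm ::
  "real \<Rightarrow> ('a::euclidean_space \<Rightarrow> real) \<Rightarrow> 'a set \<Rightarrow> ('a \<Rightarrow> 'b::real_normed_vector) \<Rightarrow> ennreal" where
  "wnorm p w E h = ennpow (\<integral>\<^sup>+x\<in>E. ennreal (norm (h x) powr p * w x) \<partial>lebesgue) (1 / p)"

definition average :: "'a::euclidean_space set \<Rightarrow> ('a \<Rightarrow> ennreal) \<Rightarrow> ennreal" where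
  "average B h = (\<integral>\<^sup>+x\<in>B. h x \<partial>lebesgue) / emeasure lebesgue B"

definition product_weight ::
  "real \<Rightarrow> real \<Rightarrow> real \<Rightarrow> ('a \<Rightarrow> real) \<Rightarrow> ('a \<Rightarrow> real) \<Rightarrow> 'a \<Rightarrow> real" where
  "product_weight p1 p2 q w1 w2 x = w1 x powr (q / p1) * w2 x powr (q / p2)"

text \<open>The supremum is taken in \<^typ>\<open>ennreal\<close>, where \<open>0 * \<infinity> = 0\<close>.\<close>

definition A_condition ::
  "real \<Rightarrow> real \<Rightarrow> real \<Rightarrow> ('a::euclidean_space \<Rightarrow> real) \<Rightarrow> ('a \<Rightarrow> real) \<Rightarrow> bool" where
  "A_condition p1 p2 q w1 w2 \<longleftrightarrow>
    (SUP c. SUP r\<in>{0<..}.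
       average (ball c r) (\<lambda>x. ennreal (product_weight p1 p2 q w1 w2 x))
       * ennpow (average (ball c r) (\<lambda>x. ennpow (ennreal (w1 x)) (1 - conj_exp p1))) (q / conj_exp p1)
       * ennpow (average (ball c r) (\<lambda>x. ennpow (ennreal (w2 x)) (1 - conj_exp p2))) (q / conj_exp p2))
    < \<infinity>"

text \<open>The size condition on a family of kernels \<open>K t x y\<close>, \<open>t > 0\<close>; values at
  \<open>t \<le> 0\<close> play no role.\<close>

definition kernel_bounds ::
  "real \<Rightarrow> real \<Rightarrow> (real \<Rightarrow> real ^ 'n \<Rightarrow> real ^ 'n \<Rightarrow> complex) \<Rightarrow> bool" where
  "kernel_bounds m \<epsilon> K \<longleftrightarrow>
    (\<exists>\<gamma> :: real \<Rightarrow> real.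
       (\<forall>r\<ge>0. 0 \<le> \<gamma> r) \<and> bounded (\<gamma> ` {0..}) \<and> antimono_on {0..} \<gamma> \<and>
       ((\<lambda>r. r powr (2 * real CARD('n) + \<epsilon>) * \<gamma> r) \<longlongrightarrow> 0) at_top \<and>
       (\<forall>t>0. \<forall>x y. norm (K t x y)
          \<le> t powr (- (real CARD('n) / m)) * \<gamma> (norm (x - y) / t powr (1 / m))))"

text \<open>Measurability of \<open>p t x\<close> is implied by the integral being \<open>1\<close>: the Bochner
  integral of a function that is not integrable is \<open>0\<close>.\<close>

definition approx_identity ::
  "real \<Rightarrow> real \<Rightarrow> (real \<Rightarrow> real ^ 'n \<Rightarrow> real ^ 'n \<Rightarrow> complex) \<Rightarrow> bool" where
  "approx_identity m \<epsilon> p \<longleftrightarrow>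
    (\<forall>t>0. \<forall>x. (LINT y|lebesgue. p t x y) = 1) \<and> kernel_bounds m \<epsilon> p"

definition kernel_op ::
  "(real \<Rightarrow> real ^ 'n \<Rightarrow> real ^ 'n \<Rightarrow> complex) \<Rightarrow> real \<Rightarrow> (real ^ 'n \<Rightarrow> complex) \<Rightarrow> real ^ 'n \<Rightarrow> complex" where
  "kernel_op p t f x = (LINT y|lebesgue. p t x y * f y)"

definition derivative_bounds ::
  "real \<Rightarrow> real \<Rightarrow> (real \<Rightarrow> real ^ 'n \<Rightarrow> real ^ 'n \<Rightarrow> complex) \<Rightarrow> bool" where
  "derivative_bounds m \<epsilon> p \<longleftrightarrow>
    (\<forall>t>0. \<forall>x y. (\<lambda>s. p s x y) differentiable (at t)) \<and>
    kernel_bounds m \<epsilon> (\<lambda>t x y. t *\<^sub>R vector_derivative (\<lambda>s. p s x y) (at t))"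

definition gradient :: "(real ^ 'n \<Rightarrow> complex) \<Rightarrow> real ^ 'n \<Rightarrow> complex ^ 'n" where
  "gradient f x = (\<chi> i. frechet_derivative f (at x) (axis i 1))"

definition C1 :: "(real ^ 'n \<Rightarrow> complex) \<Rightarrow> bool" where
  "C1 f \<longleftrightarrow> (\<forall>x. f differentiable (at x)) \<and> continuous_on UNIV (gradient f)"

definition admissible ::
  "real \<Rightarrow> (real ^ 'n \<Rightarrow> complex) \<Rightarrow> (real ^ 'n \<Rightarrow> complex) \<Rightarrow> bool" where
  "admissible \<epsilon> f g \<longleftrightarrow> C1 f \<and> C1 g \<and>
    (\<integral>\<^sup>+y. ennreal ((norm (f y) + norm (g y)) * (1 + norm y) powr (- 2 * real CARD('n) - \<epsilon>)) \<partial>lebesgue)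
      < \<infinity>"

end

theory Submission
  imports Defs
begin

text \<open>Since the kernels have integral 1, \<open>f x * g x - S f x * S g x\<close> is the average of
  \<open>f x * g x - f y * g z\<close> against \<open>p x y * p x z\<close>.  Integrating the gradient along the segments
  from \<open>x\<close> to \<open>y\<close> and \<open>z\<close> bounds it by a bilinear potential of
  \<open>|\<nabla>f| |g| + |f| |\<nabla>g|\<close> whose kernel is, with \<open>\<rho> = max |x - y| |x - z|\<close>, of
  size \<open>\<rho> powr (1 - 2n)\<close> times \<open>(\<rho> / r) powr (- \<epsilon>)\<close> for \<open>\<rho> \<ge> r\<close> and
  \<open>(\<rho> / r) powr (- \<alpha> / 2)\<close> for \<open>\<rho> < r\<close>.  The kernel is cut dyadically in \<open>\<rho>\<close>.  At scales
  above \<open>r\<close> the pieces are bounded by constants on the ball, and Hoelder's inequality with the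
  \<open>A\<close> condition on the dilated balls suffices.  At a single scale \<open>R = 2 powr (- j) * r\<close> the
  \<open>A\<close> condition on balls of radius \<open>2 R\<close> gives the weighted bound with constant
  \<open>R powr (2n - 1 + \<alpha>)\<close>, because \<open>1 / q \<le> 1 / p1 + 1 / p2\<close>.  The homogeneous potential would
  have order \<open>1 - \<alpha>\<close> rather than \<open>1\<close>, so the scales sum geometrically.\<close>

subsection \<open>Powers of extended nonnegative reals\<close>

text \<open>The decay exponent \<open>2n + \<epsilon>\<close> belongs to the bilinear setting: of
  the two kernels only the one at the larger distance is kept, and this single factor has to be
  integrable over pairs \<open>(y, z)\<close>, a space of dimension \<open>2n\<close>. Both segments
  are run through with the same parameter \<open>s\<close>, so that the dilation by \<open>s\<close>
  can be undone in both variables at once. Undoing it costs \<open>s powr (- 2n)\<close>; keeping a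
  part \<theta> of the decay in excess of \<open>2n\<close> leaves
  \<open>s powr (\<theta> - 1)\<close>. Integrability at \<open>s = 0\<close> asks for \<theta> > 0,
  the sum over the small scales for \<theta> < \<alpha>, and \<alpha> / 2 serves both. Above
  \<open>r\<close> the full \<theta> = \<epsilon> is kept, which produces the factors
  \<open>2 powr (- l * (\<epsilon> - \<alpha>))\<close>. Since \<open>q\<close> may be below 1, the
  target space has neither a triangle inequality nor duality; part of the geometric decay in the
  scales is spent on replacing them. Since the weights may vanish, the dual weights may be infinite,
  and all estimates are made in \<open>ennreal\<close>, where the degenerate cases
  \<open>0 * \<infinity>\<close> need separate attention.\<close>

lemma ennpow_ennreal: "0 < a \<Longrightarrow> 0 \<le> x \<Longrightarrow> ennpow (ennreal x) a = ennreal (x powr a)"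
  by (simp add: ennpow_def)

lemma ennpow_top [simp]: "0 < a \<Longrightarrow> ennpow top a = top"
  by (simp add: ennpow_def)

lemma ennpow_zero [simp]: "0 < a \<Longrightarrow> ennpow 0 a = 0"
  by (simp add: ennpow_def)

lemma ennpow_mono: "0 < a \<Longrightarrow> x \<le> y \<Longrightarrow> ennpow x a \<le> ennpow y a"
  by (cases x; cases y) (auto simp: ennpow_ennreal top_unique intro!: ennreal_leI powr_mono2)

lemma ennpow_eq_0_iff: "0 < a \<Longrightarrow> ennpow x a = 0 \<longleftrightarrow> x = 0"
  by (cases x) (auto simp: ennpow_ennreal)

text \<open>A positive power fixes both 0 and infinity, so the convention
  \<open>0 * \<infinity> = 0\<close> agrees on the two sides; a negative power would break
  it.\<close>

lemma ennpow_mult: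
  assumes "0 < a"
  shows "ennpow (x * y) a = ennpow x a * ennpow y a"
proof (cases x)
  case [simp]: (real s)
  show ?thesis
  proof (cases y)
    case (real t)
    then show ?thesis
      using assms \<open>0 \<le> s\<close> by (simp add: ennpow_ennreal powr_mult flip: ennreal_mult)
  next
    case top
    then show ?thesis
      using assms \<open>0 \<le> s\<close> by (cases "s = 0") (auto simp: ennpow_ennreal ennreal_mult_top)
  qed
next
  case top
  then show ?thesis
    using assms
    by (cases "y = 0") (auto simp: ennreal_top_mult ennpow_eq_0_iff)
qed

lemma ennpow_ennpow: "0 < a \<Longrightarrow> 0 < b \<Longrightarrow> ennpow (ennpow x a) b = ennpow x (a * b)"
  by (cases x) (auto simp: ennpow_ennreal powr_powr)

lemma ennpow_one [simp]: "ennpow x 1 = x"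
  by (cases x) (auto simp: ennpow_ennreal ennpow_def)

text \<open>Comparing the sum with twice the maximum treats exponents below and above 1
  alike.\<close>

lemma ennpow_sum_le:
  assumes "0 < a"
  shows "ennpow (x + y) a \<le> ennreal (2 powr a) * (ennpow x a + ennpow y a)"
proof -
  have "x + y \<le> ennreal 2 * max x y"
    by (metis add_mono ennreal_numeral max.cobounded1 max.cobounded2 mult_2 zero_le_numeral)
  then have "ennpow (x + y) a \<le> ennpow (ennreal 2 * max x y) a"
    using assms ennpow_mono by blast
  also have "\<dots> = ennreal (2 powr a) * ennpow (max x y) a"
    using assms by (simp add: ennpow_mult ennpow_ennreal del: ennreal_numeral)
  also have "ennpow (max x y) a \<le> ennpow x a + ennpow y a"
    by (simp add: max_def add_increasing add_increasing2)
  finally show ?thesis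
    by (simp add: mult_left_mono)
qed

lemma ennpow_measurable [measurable]:
  assumes [measurable]: "f \<in> borel_measurable M"
  shows "(\<lambda>x. ennpow (f x) a) \<in> borel_measurable M"
  unfolding ennpow_def by measurable

lemma ennreal_le_suminf: "f j \<le> suminf f" for f :: "nat \<Rightarrow> ennreal"
  using sum_le_suminf[OF summableI, of "{j}" f] by simp

text \<open>Splitting the geometric weight as \<open>\<kappa> ^ j * \<kappa> ^ j\<close> replaces the missing triangle
  inequality for exponents below 1.\<close>

lemma ennpow_geometric_suminf_le:
  fixes v :: "nat \<Rightarrow> ennreal"
  assumes "0 < q" "0 < \<kappa>" "\<kappa> < 1"
  shows "ennpow (\<Sum>j. ennreal (\<kappa> ^ j) * (ennreal (\<kappa> ^ j) * v j)) q
    \<le> ennreal ((1 / (1 - \<kappa>)) powr q) * (\<Sum>j. ennreal ((\<kappa> powr q) ^ j) * ennpow (v j) q)"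
proof -
  define S where "S = (\<Sum>j. ennreal ((\<kappa> powr q) ^ j) * ennpow (v j) q)"
  \<comment> \<open>One term of the \<open>q\<close>-sum is at most the whole sum. This bounds
    \<open>\<kappa> ^ j * v j\<close> uniformly in \<open>j\<close>, and the other factor
    \<open>\<kappa> ^ j\<close> is left to sum the constants.\<close>
  have "ennreal (\<kappa> ^ j) * v j \<le> ennpow S (1 / q)" for j
  proof -
    have "ennpow (ennreal (\<kappa> ^ j) * v j) q = ennreal ((\<kappa> powr q) ^ j) * ennpow (v j) q"
      using assms by (simp add: ennpow_mult ennpow_ennreal powr_power powr_realpow[symmetric]
          powr_powr mult.commute)
    also have "\<dots> \<le> S"
      unfolding S_def
      by (rule ennreal_le_suminf)
    finally have "ennpow (ennpow (ennreal (\<kappa> ^ j) * v j) q) (1 / q) \<le> ennpow S (1 / q)"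
      using assms by (intro ennpow_mono) auto
    then show ?thesis
      using assms by (simp add: ennpow_ennpow)
  qed
  then have "(\<Sum>j. ennreal (\<kappa> ^ j) * (ennreal (\<kappa> ^ j) * v j)) \<le> (\<Sum>j. ennreal (\<kappa> ^ j) * ennpow S (1 / q))"
    by (intro suminf_le summableI mult_left_mono) auto
  also have "\<dots> = ennreal (1 / (1 - \<kappa>)) * ennpow S (1 / q)"
    using assms suminf_geometric[of \<kappa>] by (simp add: suminf_ennreal2 summable_geometric)
  finally have "ennpow (\<Sum>j. ennreal (\<kappa> ^ j) * (ennreal (\<kappa> ^ j) * v j)) q
      \<le> ennpow (ennreal (1 / (1 - \<kappa>)) * ennpow S (1 / q)) q"
    using assms by (intro ennpow_mono)
  also have "\<dots> = ennreal ((1 / (1 - \<kappa>)) powr q) * S"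
    using assms by (simp add: ennpow_mult ennpow_ennpow ennpow_ennreal)
  finally show ?thesis
    by (simp add: S_def)
qed

section \<open>Weighted Hoelder inequality with a dual weight that may be infinite\<close>

lemma ennpow_neg_pos: "a < 0 \<Longrightarrow> 0 \<le> x \<Longrightarrow> 0 < ennpow (ennreal x) a"
  by (auto simp: ennpow_def)

text \<open>Compare \<open>F\<close> with the level at which \<open>l * F powr p * w\<close> equals
  \<open>F\<close>. Above it the first summand alone suffices; below it \<open>F\<close> is at most
  \<open>(l * w) powr (1 - conj_exp p)\<close>, because
  \<open>1 - conj_exp p = - 1 / (p - 1)\<close>. Where \<open>w = 0\<close> the second summand is
  infinite. The parameter \<open>l\<close> stays free so that the two integrals can be balanced
  afterwards.\<close>

lemma Young_weighted:
  fixes F w l p :: real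
  assumes "1 < p" "0 \<le> F" "0 \<le> w" "0 < l"
  shows "ennreal F \<le> ennreal l * ennreal (F powr p * w)
    + ennreal (l powr (1 - conj_exp p)) * ennpow (ennreal w) (1 - conj_exp p)"
proof -
  have e: "1 - conj_exp p = - (1 / (p - 1))"
    using assms by (simp add: conj_exp_def field_simps)
  have neg: "1 - conj_exp p < 0"
    using assms by (simp add: e)
  show ?thesis
  proof (cases "w = 0")
    case True
    with neg assms show ?thesis
      by (simp add: ennpow_def ennreal_mult_top)
  next
    case False
    have "F \<le> l * (F powr p * w) + (l * w) powr (1 - conj_exp p)"
    proof (cases "1 \<le> l * (F powr (p - 1) * w)")
      case True
      have "F powr p = F powr (p - 1) * F" if "F \<noteq> 0"
        using that assms powr_add[of F "p - 1" 1] by simp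
      then have "l * (F powr p * w) = F * (l * (F powr (p - 1) * w))"
        by (cases "F = 0") auto
      also have "\<dots> \<ge> F * 1"
        using assms True by (intro mult_left_mono) auto
      finally show ?thesis
        by (smt (verit) powr_ge_zero)
    next
      case F: False
      have "F \<le> (l * w) powr (1 - conj_exp p)"
      proof (cases "F = 0")
        case False
        have "F powr (p - 1) \<le> inverse (l * w)"
          using F assms \<open>w \<noteq> 0\<close> by (simp add: field_simps)
        then have "(F powr (p - 1)) powr (1 / (p - 1)) \<le> inverse (l * w) powr (1 / (p - 1))"
          using assms by (intro powr_mono2) auto
        then show ?thesis
          using assms False \<open>w \<noteq> 0\<close> by (simp add: powr_powr e powr_minus powr_mult inverse_powr)
      qed auto
      moreover have "0 \<le> l * (F powr p * w)"
        using assms by auto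
      ultimately show ?thesis
        by linarith
    qed
    moreover have "ennpow (ennreal w) (1 - conj_exp p) = ennreal (w powr (1 - conj_exp p))"
      using neg False assms by (simp add: ennpow_def)
    ultimately show ?thesis
      using assms by (simp add: powr_mult flip: ennreal_mult ennreal_plus)
  qed
qed

lemma set_nn_integral_pos_null:
  assumes "(\<integral>\<^sup>+x\<in>E. h x \<partial>M) = 0" "\<And>x. 0 < h x"
    and "h \<in> borel_measurable M" "E \<in> sets M"
  shows "AE x in M. x \<notin> E"
proof -
  have "AE x in M. h x * indicator E x = 0"
    using assms by (subst nn_integral_0_iff_AE[symmetric]) auto
  then show ?thesis
    by eventually_elim (metis assms(2) indicator_simps(1) less_irrefl mult.right_neutral)
qed

text \<open>The factor 2 saves optimizing the constant in Young's inequality.\<close>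

lemma weighted_Holder:
  fixes F w :: "'a::euclidean_space \<Rightarrow> real"
  assumes p: "1 < p" and F: "\<And>x. 0 \<le> F x" and w: "\<And>x. 0 \<le> w x"
    and [measurable]: "F \<in> borel_measurable lebesgue" "w \<in> borel_measurable lebesgue" "E \<in> sets lebesgue"
    and fin: "(\<integral>\<^sup>+x\<in>E. ennpow (ennreal (w x)) (1 - conj_exp p) \<partial>lebesgue) < \<infinity>"
  shows "(\<integral>\<^sup>+x\<in>E. ennreal (F x) \<partial>lebesgue)
    \<le> 2 * ennpow (\<integral>\<^sup>+x\<in>E. ennreal (F x powr p * w x) \<partial>lebesgue) (1 / p)
      * ennpow (\<integral>\<^sup>+x\<in>E. ennpow (ennreal (w x)) (1 - conj_exp p) \<partial>lebesgue) (1 / conj_exp p)"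
    (is "?I \<le> 2 * ennpow ?N _ * ennpow ?S _")
proof -
  have p': "1 < conj_exp p" "1 - 1 / conj_exp p = 1 / p"
    using p by (auto simp: conj_exp_def field_simps)
  have *: "?I \<le> ennreal l * ?N + ennreal (l powr (1 - conj_exp p)) * ?S" if "0 < l" for l
  proof -
    have "?I \<le> (\<integral>\<^sup>+x. ennreal l * (ennreal (F x powr p * w x) * indicator E x)
      + ennreal (l powr (1 - conj_exp p)) * (ennpow (ennreal (w x)) (1 - conj_exp p) * indicator E x) \<partial>lebesgue)"
      using Young_weighted[OF p F w that]
      by (intro nn_integral_mono) (auto simp: indicator_def)
    also have "\<dots> = ennreal l * ?N + ennreal (l powr (1 - conj_exp p)) * ?S"
      by (simp add: nn_integral_add nn_integral_cmult)
    finally show ?thesis .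
  qed
  consider "?S = 0" | "?S \<noteq> 0" "?N = 0" | "?S \<noteq> 0" "?N = top" | "?S \<noteq> 0" "?N \<noteq> 0" "?N \<noteq> top"
    by blast
  then show ?thesis
  proof cases
    case 1
    \<comment> \<open>The dual power of the weight is strictly positive everywhere, so
      \<open>?S = 0\<close> leaves only a null set.\<close>
    have "AE x in lebesgue. x \<notin> E"
      by (rule set_nn_integral_pos_null[OF 1]) (use p' w in \<open>auto intro!: ennpow_neg_pos\<close>)
    then have "AE x in lebesgue. ennreal (F x) * indicator E x = 0"
      by eventually_elim auto
    then have "?I = 0"
      by (subst nn_integral_0_iff_AE) auto
    then show ?thesis
      by simp
  next
    case 2
    \<comment> \<open>Finiteness of \<open>?S\<close> excludes \<open>w x = 0\<close> almost
      everywhere on \<open>E\<close>, since the dual power is infinite there; hence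
      \<open>F powr p * w = 0\<close> forces \<open>F = 0\<close>. With the convention
      \<open>0 powr a = 0\<close> this conclusion would be false.\<close>
    have "AE x in lebesgue. ennpow (ennreal (w x)) (1 - conj_exp p) * indicator E x \<noteq> \<infinity>"
      by (rule nn_integral_noteq_infinite) (use fin in auto)
    moreover have "AE x in lebesgue. ennreal (F x powr p * w x) * indicator E x = 0"
      using 2 by (subst nn_integral_0_iff_AE[symmetric]) auto
    ultimately have "AE x in lebesgue. ennreal (F x) * indicator E x = 0"
    proof eventually_elim
      case (elim x)
      with p' F[of x] w[of x] show ?case
        by (cases "w x = 0")
          (auto simp: indicator_def ennpow_def mult_le_0_iff split: if_splits)
    qed
    then have "?I = 0"
      by (subst nn_integral_0_iff_AE) auto
    then show ?thesis
      by simp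
  next
    case 3
    then have "ennpow ?S (1 / conj_exp p) \<noteq> 0"
      using p' by (simp add: ennpow_eq_0_iff)
    with 3 show ?thesis
      using p by (simp add: ennreal_top_mult ennreal_mult_top)
  next
    case 4
    then obtain N where N: "?N = ennreal N" "0 < N"
      by (cases ?N) (auto simp: less_le)
    obtain S where S: "?S = ennreal S" "0 < S"
      using 4 fin by (cases ?S) (auto simp: less_le)
    \<comment> \<open>This is the solution of \<open>l * N = l powr (1 - conj_exp p) * S\<close>:
      the two summands become equal, and each of them is the product of the two roots.\<close>
    define l where "l = (S / N) powr (1 / conj_exp p)"
    have l: "0 < l"
      using N S by (simp add: l_def)
    have "l * N = S powr (1 / conj_exp p) * (N powr 1 / N powr (1 / conj_exp p))"
      using N S by (simp add: l_def powr_divide)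
    also have "\<dots> = S powr (1 / conj_exp p) * N powr (1 - 1 / conj_exp p)"
      by (simp only: powr_diff)
    finally have 1: "l * N = N powr (1 / p) * S powr (1 / conj_exp p)"
      using p'(2) by (simp add: mult.commute)
    have "l powr conj_exp p = S / N"
      using N S p' by (simp add: l_def powr_powr)
    then have "l powr (1 - conj_exp p) * S = l * N"
      using l N S by (simp add: powr_diff)
    with 1 *[OF l] show ?thesis
      using N S l p p' by (simp add: ennpow_ennreal ennreal_mult[symmetric] mult.assoc
        ennreal_plus[symmetric] del: ennreal_plus flip: mult_2)
  qed
qed

subsection \<open>Consequences of the \<open>A\<close> condition\<close>

lemma emeasure_ball_real:
  fixes c :: "'a::euclidean_space"
  assumes "0 < R"
  shows "emeasure lborel (ball c R) = ennreal (unit_ball_vol (real DIM('a)) * R ^ DIM('a))"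
  using assms by (simp add: emeasure_ball)

text \<open>Hoelder's inequality for both functions yields the dual integrals \<open>S1\<close> and
  \<open>S2\<close> to exactly the powers \<open>a1\<close> and \<open>a2\<close> that occur in the
  A condition, where they combine with the mass of the product weight. Passing from averages to
  integrals multiplies by the power \<open>1 + a1 + a2\<close> of the volume of the ball, which is
  the power of \<open>R\<close>.\<close>

lemma A_condition_ball_bound:
  fixes w1 w2 :: "'a::euclidean_space \<Rightarrow> real"
  assumes p: "1 < p1" "1 < p2" and q: "0 < q"
    and w: "\<And>x. 0 \<le> w1 x" "\<And>x. 0 \<le> w2 x"
    and [measurable]: "w1 \<in> borel_measurable lebesgue" "w2 \<in> borel_measurable lebesgue"
    and A: "A_condition p1 p2 q w1 w2"
  shows "\<exists>\<Theta>\<ge>0. \<forall>c R F1 F2. 0 < R \<longrightarrow> (\<forall>x. 0 \<le> F1 x) \<longrightarrow> (\<forall>x. 0 \<le> F2 x) \<longrightarrow>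
    F1 \<in> borel_measurable lebesgue \<longrightarrow> F2 \<in> borel_measurable lebesgue \<longrightarrow>
    (\<integral>\<^sup>+x\<in>ball c R. ennreal (product_weight p1 p2 q w1 w2 x) \<partial>lebesgue)
      * (ennpow (\<integral>\<^sup>+x\<in>ball c R. ennreal (F1 x) \<partial>lebesgue) q
        * ennpow (\<integral>\<^sup>+x\<in>ball c R. ennreal (F2 x) \<partial>lebesgue) q)
    \<le> ennreal (\<Theta> * R powr (real DIM('a) * (1 + q / conj_exp p1 + q / conj_exp p2)))
      * (ennpow (\<integral>\<^sup>+x\<in>ball c R. ennreal (F1 x powr p1 * w1 x) \<partial>lebesgue) (q / p1)
        * ennpow (\<integral>\<^sup>+x\<in>ball c R. ennreal (F2 x powr p2 * w2 x) \<partial>lebesgue) (q / p2))"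
proof -
  define a1 where "a1 = q / conj_exp p1"
  define a2 where "a2 = q / conj_exp p2"
  have p': "1 < conj_exp p1" "1 < conj_exp p2"
    using p by (auto simp: conj_exp_def field_simps)
  have a: "0 < a1" "0 < a2"
    using p' q by (auto simp: a1_def a2_def)
  define v where "v = unit_ball_vol (real DIM('a))"
  have v: "0 < v"
    by (simp add: v_def)
  define G where "G c R = average (ball c R) (\<lambda>x. ennreal (product_weight p1 p2 q w1 w2 x))
       * ennpow (average (ball c R) (\<lambda>x. ennpow (ennreal (w1 x)) (1 - conj_exp p1))) a1
       * ennpow (average (ball c R) (\<lambda>x. ennpow (ennreal (w2 x)) (1 - conj_exp p2))) a2" for c R
  define T where "T = (SUP c. SUP R\<in>{0<..}. G c R)"
  have "T < \<infinity>"
    using A by (simp add: T_def G_def A_condition_def a1_def a2_def)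
  then obtain \<Theta>0 where T: "T = ennreal \<Theta>0" "0 \<le> \<Theta>0"
    by (cases T) auto
  have G_le: "G c R \<le> ennreal \<Theta>0" if "0 < R" for c R
    unfolding T(1)[symmetric] T_def using that by (intro SUP_upper2[of c] SUP_upper) auto
  \<comment> \<open>\<open>\<Theta>0\<close> is the supremum in the A condition and \<open>v\<close>
    the volume of the unit ball; the last factor is the 2 of \<open>weighted_Holder\<close>, used
    for both functions and raised to the power \<open>q\<close>.\<close>
  define \<Theta> where "\<Theta> = \<Theta>0 * v powr (1 + a1 + a2) * 2 powr (2 * q)"
  show ?thesis
  proof (intro exI[of _ \<Theta>] conjI allI impI)
    show "0 \<le> \<Theta>"
      using T by (simp add: \<Theta>_def)
  next
    fix c :: 'a and R :: real and F1 F2 :: "'a \<Rightarrow> real"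
    assume R: "0 < R" and F: "\<forall>x. 0 \<le> F1 x" "\<forall>x. 0 \<le> F2 x"
      and [measurable]: "F1 \<in> borel_measurable lebesgue" "F2 \<in> borel_measurable lebesgue"
    define W where "W = (\<integral>\<^sup>+x\<in>ball c R. ennreal (product_weight p1 p2 q w1 w2 x) \<partial>lebesgue)"
    define S1 where "S1 = (\<integral>\<^sup>+x\<in>ball c R. ennpow (ennreal (w1 x)) (1 - conj_exp p1) \<partial>lebesgue)"
    define S2 where "S2 = (\<integral>\<^sup>+x\<in>ball c R. ennpow (ennreal (w2 x)) (1 - conj_exp p2) \<partial>lebesgue)"
    define I1 where "I1 = (\<integral>\<^sup>+x\<in>ball c R. ennreal (F1 x) \<partial>lebesgue)"
    define I2 where "I2 = (\<integral>\<^sup>+x\<in>ball c R. ennreal (F2 x) \<partial>lebesgue)"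
    define N1 where "N1 = (\<integral>\<^sup>+x\<in>ball c R. ennreal (F1 x powr p1 * w1 x) \<partial>lebesgue)"
    define N2 where "N2 = (\<integral>\<^sup>+x\<in>ball c R. ennreal (F2 x powr p2 * w2 x) \<partial>lebesgue)"
    define V where "V = v * R ^ DIM('a)"
    have V: "0 < V" "emeasure lebesgue (ball c R) = ennreal V"
      using R v emeasure_ball_real[OF R, of c] by (auto simp: V_def v_def)
    have div_eq: "y / ennreal V = y * ennreal (1 / V)" for y
      using V by (simp add: divide_ennreal_def inverse_ennreal divide_real_def)
    \<comment> \<open>Positive measure of the ball makes \<open>S1\<close> and \<open>S2\<close>
      nonzero, so that their finiteness can later be read off from a finite product.\<close>
    have not_AE: "\<not> (AE x in lebesgue. x \<notin> ball c R)"
    proof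
      assume "AE x in lebesgue. x \<notin> ball c R"
      then have "emeasure lebesgue (ball c R) = 0"
        by (subst (asm) AE_iff_measurable[of "ball c R"]) auto
      with V show False
        by auto
    qed
    have S_pos: "S1 \<noteq> 0" "S2 \<noteq> 0"
    proof -
      show "S1 \<noteq> 0"
        using not_AE set_nn_integral_pos_null[of lebesgue "\<lambda>x. ennpow (ennreal (w1 x)) (1 - conj_exp p1)" "ball c R"]
          ennpow_neg_pos w p' unfolding S1_def by fastforce
      show "S2 \<noteq> 0"
        using not_AE set_nn_integral_pos_null[of lebesgue "\<lambda>x. ennpow (ennreal (w2 x)) (1 - conj_exp p2)" "ball c R"]
          ennpow_neg_pos w p' unfolding S2_def by fastforce
    qed
    define V3 where "V3 = V powr (1 + a1 + a2)"
    have V3: "0 < V3" "V3 = v powr (1 + a1 + a2) * R powr (real DIM('a) * (1 + a1 + a2))"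
      using V v R by (simp_all add: V3_def V_def powr_mult powr_powr powr_realpow[symmetric])
    have "G c R = W * ennreal (1 / V) * (ennpow S1 a1 * ennreal ((1 / V) powr a1)) * (ennpow S2 a2 * ennreal ((1 / V) powr a2))"
      using V a by (simp add: G_def average_def W_def S1_def S2_def div_eq ennpow_mult ennpow_ennreal)
    also have "\<dots> = W * (ennpow S1 a1 * ennpow S2 a2) * (ennreal (1 / V) * ennreal ((1 / V) powr a1) * ennreal ((1 / V) powr a2))"
      by (simp only: mult_ac)
    also have "ennreal (1 / V) * ennreal ((1 / V) powr a1) * ennreal ((1 / V) powr a2) = ennreal (1 / V3)"
      using V by (simp add: V3_def powr_add powr_divide flip: ennreal_mult)
    finally have G_eq: "G c R = W * (ennpow S1 a1 * ennpow S2 a2) * ennreal (1 / V3)" .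
    have "W * (ennpow S1 a1 * ennpow S2 a2) = G c R * ennreal V3"
      using V3(1) unfolding G_eq mult.assoc by (simp flip: ennreal_mult)
    also have "\<dots> \<le> ennreal \<Theta>0 * ennreal V3"
      using G_le[OF R] by (rule mult_right_mono) simp
    finally have A_le: "W * (ennpow S1 a1 * ennpow S2 a2) \<le> ennreal (\<Theta>0 * V3)"
      using T V3(1) by (simp add: ennreal_mult)
    have "W * (ennpow I1 q * ennpow I2 q) \<le> ennreal (\<Theta>0 * V3) * ennreal (2 powr (2 * q)) * (ennpow N1 (q / p1) * ennpow N2 (q / p2))"
    proof (cases "W = 0")
      case False
      \<comment> \<open>No factor of \<open>W * (ennpow S1 a1 * ennpow S2 a2)\<close> vanishes here,
        so one infinite factor would make the product infinite. For \<open>W = 0\<close> this fails,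
        but then the left side is 0.\<close>
      have fin: "S1 < \<infinity>" "S2 < \<infinity>"
        using A_le False S_pos a
        by (auto simp: less_top[symmetric] ennreal_top_mult ennreal_mult_top ennpow_eq_0_iff top_unique)
      have "I1 \<le> 2 * ennpow N1 (1 / p1) * ennpow S1 (1 / conj_exp p1)"
        unfolding I1_def N1_def S1_def
        by (rule weighted_Holder) (use p w F fin in \<open>auto simp: S1_def\<close>)
      then have "ennpow I1 q \<le> ennpow (2 * ennpow N1 (1 / p1) * ennpow S1 (1 / conj_exp p1)) q"
        using q by (rule_tac ennpow_mono)
      also have "\<dots> = ennreal (2 powr q) * ennpow N1 (q / p1) * ennpow S1 a1"
        using q p p' ennpow_ennreal[of q 2] by (simp add: ennpow_mult ennpow_ennpow a1_def)
      finally have 1: "ennpow I1 q \<le> ennreal (2 powr q) * ennpow N1 (q / p1) * ennpow S1 a1" .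
      have "I2 \<le> 2 * ennpow N2 (1 / p2) * ennpow S2 (1 / conj_exp p2)"
        unfolding I2_def N2_def S2_def
        by (rule weighted_Holder) (use p w F fin in \<open>auto simp: S2_def\<close>)
      then have "ennpow I2 q \<le> ennpow (2 * ennpow N2 (1 / p2) * ennpow S2 (1 / conj_exp p2)) q"
        using q by (rule_tac ennpow_mono)
      also have "\<dots> = ennreal (2 powr q) * ennpow N2 (q / p2) * ennpow S2 a2"
        using q p p' ennpow_ennreal[of q 2] by (simp add: ennpow_mult ennpow_ennpow a2_def)
      finally have 2: "ennpow I2 q \<le> ennreal (2 powr q) * ennpow N2 (q / p2) * ennpow S2 a2" .
      have "W * (ennpow I1 q * ennpow I2 q) \<le> W *
          ((ennreal (2 powr q) * ennpow N1 (q / p1) * ennpow S1 a1) * (ennreal (2 powr q) * ennpow N2 (q / p2) * ennpow S2 a2))"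
        by (intro mult_left_mono mult_mono 1 2) auto
      also have "\<dots> = (W * (ennpow S1 a1 * ennpow S2 a2)) * ((ennreal (2 powr q) * ennreal (2 powr q)) * (ennpow N1 (q / p1) * ennpow N2 (q / p2)))"
        by (simp only: mult_ac)
      also have "ennreal (2 powr q) * ennreal (2 powr q) = ennreal (2 powr (2 * q))"
        by (simp add: powr_add[symmetric] flip: ennreal_mult)
      also have "(W * (ennpow S1 a1 * ennpow S2 a2)) * (ennreal (2 powr (2 * q)) * (ennpow N1 (q / p1) * ennpow N2 (q / p2)))
          \<le> ennreal (\<Theta>0 * V3) * (ennreal (2 powr (2 * q)) * (ennpow N1 (q / p1) * ennpow N2 (q / p2)))"
        using A_le by (rule mult_right_mono) simp
      finally show ?thesis
        by (simp only: mult.assoc)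
    qed simp
    also have "ennreal (\<Theta>0 * V3) * ennreal (2 powr (2 * q))
        = ennreal (\<Theta> * R powr (real DIM('a) * (1 + q / conj_exp p1 + q / conj_exp p2)))"
      using T V3(1) unfolding V3(2) \<Theta>_def by (simp add: a1_def a2_def mult_ac flip: ennreal_mult)
    finally show "(\<integral>\<^sup>+x\<in>ball c R. ennreal (product_weight p1 p2 q w1 w2 x) \<partial>lebesgue)
      * (ennpow (\<integral>\<^sup>+x\<in>ball c R. ennreal (F1 x) \<partial>lebesgue) q
        * ennpow (\<integral>\<^sup>+x\<in>ball c R. ennreal (F2 x) \<partial>lebesgue) q)
      \<le> ennreal (\<Theta> * R powr (real DIM('a) * (1 + q / conj_exp p1 + q / conj_exp p2)))
        * (ennpow (\<integral>\<^sup>+x\<in>ball c R. ennreal (F1 x powr p1 * w1 x) \<partial>lebesgue) (q / p1)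
          * ennpow (\<integral>\<^sup>+x\<in>ball c R. ennreal (F2 x powr p2 * w2 x) \<partial>lebesgue) (q / p2))"
      by (simp only: W_def I1_def I2_def N1_def N2_def)
  qed
qed

section \<open>Averaging over all balls of one radius\<close>

lemma indicator_ball_measurable [measurable]:
  "(\<lambda>z. indicator (ball (fst z) R) (snd z) :: ennreal) \<in> borel_measurable (borel \<Otimes>\<^sub>M (borel :: 'a::euclidean_space measure))"
proof -
  have "(\<lambda>z::'a \<times> 'a. indicator (ball (fst z) R) (snd z) :: ennreal) = indicator {z. dist (fst z) (snd z) < R}"
    by (auto simp: indicator_def fun_eq_iff)
  moreover have "{z::'a \<times> 'a. dist (fst z) (snd z) < R} \<in> sets (borel \<Otimes>\<^sub>M borel)"
    unfolding borel_prod by (intro borel_open open_Collect_less continuous_intros)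
  ultimately show ?thesis
    by simp
qed

lemma nn_integral_ball_measurable [measurable]:
  fixes F :: "'a::euclidean_space \<Rightarrow> ennreal"
  assumes [measurable]: "F \<in> borel_measurable borel"
  shows "(\<lambda>x. \<integral>\<^sup>+y\<in>ball x R. F y \<partial>lborel) \<in> borel_measurable borel"
proof -
  have "(\<lambda>z. F (snd z) * indicator (ball (fst z) R) (snd z)) \<in> borel_measurable (borel \<Otimes>\<^sub>M lborel)"
    by measurable
  from lborel.borel_measurable_nn_integral_fst[OF this] show ?thesis
    by simp
qed

text \<open>Tonelli for the symmetric condition \<open>dist u x < R\<close>: the centres of the
  balls containing \<open>x\<close> fill a ball about \<open>x\<close>. It serves both to introduce
  the averaging centre \<open>u\<close> and to add up the local integrals of \<open>H1\<close> and
  \<open>H2\<close>.\<close>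

lemma nn_integral_ball_average:
  fixes F :: "'a::euclidean_space \<Rightarrow> ennreal"
  assumes [measurable]: "F \<in> borel_measurable borel"
  shows "(\<integral>\<^sup>+u. (\<integral>\<^sup>+x\<in>ball u R. F x \<partial>lborel) \<partial>lborel)
    = emeasure lborel (ball (0::'a) R) * (\<integral>\<^sup>+x. F x \<partial>lborel)"
proof -
  have "(\<lambda>z. F (fst z) * indicator (ball (fst z) R) (snd z)) \<in> borel_measurable (lborel \<Otimes>\<^sub>M lborel)"
    by measurable
  moreover have "(\<lambda>z. F (fst z) * indicator (ball (fst z) R) (snd z)) = (\<lambda>z. F (fst z) * indicator (ball (snd z) R) (fst z))"
    by (auto simp: indicator_def fun_eq_iff dist_commute)
  ultimately have m: "(\<lambda>z. F (fst z) * indicator (ball (snd z) R) (fst z)) \<in> borel_measurable (lborel \<Otimes>\<^sub>M lborel)"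
    by simp
  have "(\<integral>\<^sup>+u. (\<integral>\<^sup>+x\<in>ball u R. F x \<partial>lborel) \<partial>lborel) = (\<integral>\<^sup>+x. (\<integral>\<^sup>+u. F x * indicator (ball u R) x \<partial>lborel) \<partial>lborel)"
    by (rule lborel_pair.Fubini') (use m in \<open>simp add: split_beta'\<close>)
  also have "\<dots> = (\<integral>\<^sup>+x. (\<integral>\<^sup>+u. F x * indicator (ball x R) u \<partial>lborel) \<partial>lborel)"
    by (intro nn_integral_cong) (auto simp: indicator_def dist_commute)
  also have "\<dots> = (\<integral>\<^sup>+x. F x * emeasure lborel (ball (0::'a) R) \<partial>lborel)"
  proof (cases "0 < R")
    case True
    then show ?thesis
      by (intro nn_integral_cong) (simp add: nn_integral_cmult_indicator emeasure_ball)
  qed (simp add: ball_empty)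
  finally show ?thesis
    by (simp add: nn_integral_multc mult.commute)
qed

text \<open>Averaging over the centre \<open>u\<close> of a ball containing \<open>x\<close> reduces the estimate to the
  one on balls; since \<open>a + b \<ge> 1\<close> the local quantities add up to the global ones.\<close>

lemma single_scale_bound:
  fixes W F1 F2 H1 H2 :: "'a::euclidean_space \<Rightarrow> ennreal"
  assumes [measurable]: "W \<in> borel_measurable borel" "F1 \<in> borel_measurable borel" "F2 \<in> borel_measurable borel"
      "H1 \<in> borel_measurable borel" "H2 \<in> borel_measurable borel"
    and pos: "0 < q" "0 < a" "0 < b" "1 \<le> a + b" "0 < R"
    and fin: "(\<integral>\<^sup>+x. H1 x \<partial>lborel) < \<infinity>" "(\<integral>\<^sup>+x. H2 x \<partial>lborel) < \<infinity>"
    and bound: "\<And>u. (\<integral>\<^sup>+x\<in>ball u (2 * R). W x \<partial>lborel)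
        * (ennpow (\<integral>\<^sup>+x\<in>ball u (2 * R). F1 x \<partial>lborel) q * ennpow (\<integral>\<^sup>+x\<in>ball u (2 * R). F2 x \<partial>lborel) q)
      \<le> K * (ennpow (\<integral>\<^sup>+x\<in>ball u (2 * R). H1 x \<partial>lborel) a * ennpow (\<integral>\<^sup>+x\<in>ball u (2 * R). H2 x \<partial>lborel) b)"
  shows "(\<integral>\<^sup>+x. W x * (ennpow (\<integral>\<^sup>+y\<in>ball x R. F1 y \<partial>lborel) q * ennpow (\<integral>\<^sup>+y\<in>ball x R. F2 y \<partial>lborel) q) \<partial>lborel)
    \<le> K * ennreal (2 * 2 ^ DIM('a)) * (ennpow (\<integral>\<^sup>+x. H1 x \<partial>lborel) a * ennpow (\<integral>\<^sup>+x. H2 x \<partial>lborel) b)"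
    (is "(\<integral>\<^sup>+x. ?Q x \<partial>lborel) \<le> _")
proof -
  define V where "V = unit_ball_vol (real DIM('a)) * R ^ DIM('a)"
  have V: "0 < V" "emeasure lborel (ball (0::'a) R) = ennreal V"
      "emeasure lborel (ball (0::'a) (2 * R)) = ennreal (2 ^ DIM('a) * V)"
    using pos by (auto simp: V_def emeasure_ball power_mult_distrib mult_ac)
  define N1 where "N1 u = (\<integral>\<^sup>+x\<in>ball u (2 * R). H1 x \<partial>lborel)" for u
  define N2 where "N2 u = (\<integral>\<^sup>+x\<in>ball u (2 * R). H2 x \<partial>lborel)" for u
  have [measurable]: "N1 \<in> borel_measurable borel" "N2 \<in> borel_measurable borel"
    unfolding N1_def N2_def by measurable
  obtain t1 where t1: "(\<integral>\<^sup>+x. H1 x \<partial>lborel) = ennreal t1" "0 \<le> t1"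
    using fin(1) by (cases "\<integral>\<^sup>+x. H1 x \<partial>lborel") auto
  obtain t2 where t2: "(\<integral>\<^sup>+x. H2 x \<partial>lborel) = ennreal t2" "0 \<le> t2"
    using fin(2) by (cases "\<integral>\<^sup>+x. H2 x \<partial>lborel") auto
  have N_le: "N1 u \<le> ennreal t1" "N2 u \<le> ennreal t2" for u
    unfolding N1_def N2_def t1(1)[symmetric] t2(1)[symmetric]
    by (auto intro!: nn_integral_mono simp: indicator_def)
  \<comment> \<open>The 2 comes from the two summands of the linear bound below,
    \<open>2 ^ DIM('a)\<close> from the volume of balls with the doubled radius.\<close>
  have NN: "(\<integral>\<^sup>+u. ennpow (N1 u) a * ennpow (N2 u) b \<partial>lborel)
      \<le> ennreal (2 * 2 ^ DIM('a) * V) * (ennpow (ennreal t1) a * ennpow (ennreal t2) b)"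
  proof (cases "t1 = 0 \<or> t2 = 0")
    case True
    then have "ennpow (N1 u) a * ennpow (N2 u) b = 0" for u
      using N_le[of u] pos by (auto simp: ennpow_eq_0_iff)
    then have "(\<integral>\<^sup>+u. ennpow (N1 u) a * ennpow (N2 u) b \<partial>lborel) = (\<integral>\<^sup>+(u::'a). 0 \<partial>lborel)"
      by (intro nn_integral_cong) blast
    then show ?thesis
      by simp
  next
    case False
    with t1 t2 have t: "0 < t1" "0 < t2"
      by auto
    define k where "k = t1 powr a * t2 powr b"
    have k: "0 < k"
      using t by (simp add: k_def)
    have "ennpow (N1 u) a * ennpow (N2 u) b \<le> ennreal (k / t1) * N1 u + ennreal (k / t2) * N2 u" for u
    proof -
      obtain n1 where n1: "N1 u = ennreal n1" "0 \<le> n1" "n1 \<le> t1"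
        using N_le(1)[of u] t by (cases "N1 u") (auto simp: top_unique)
      obtain n2 where n2: "N2 u = ennreal n2" "0 \<le> n2" "n2 \<le> t2"
        using N_le(2)[of u] t by (cases "N2 u") (auto simp: top_unique)
      define x where "x = n1 / t1"
      define y where "y = n2 / t2"
      have xy: "0 \<le> x" "x \<le> 1" "0 \<le> y" "y \<le> 1"
        using n1 n2 t by (auto simp: x_def y_def)
      \<comment> \<open>After normalization both numbers are at most 1, so the total exponent
        \<open>a + b\<close> may be lowered to 1. The bound becomes linear in \<open>N1 u\<close>
        and \<open>N2 u\<close>, and linear expressions integrate over \<open>u\<close> to the
        global quantities.\<close>
      have "x powr a * y powr b \<le> max x y powr a * max x y powr b"
        using xy pos by (intro mult_mono powr_mono2) auto
      also have "\<dots> = max x y powr (a + b)"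
        by (simp add: powr_add)
      also have "\<dots> \<le> max x y powr 1"
        using xy pos by (intro powr_mono') auto
      also have "\<dots> \<le> x + y"
        using xy by auto
      finally have "k * (x powr a * y powr b) \<le> k * (x + y)"
        using k by simp
      also have "k * (x powr a * y powr b) = n1 powr a * n2 powr b"
        using n1 n2 t by (simp add: x_def y_def k_def powr_divide)
      also have "k * (x + y) = k / t1 * n1 + k / t2 * n2"
        by (simp add: x_def y_def algebra_simps)
      finally have "ennreal (n1 powr a * n2 powr b) \<le> ennreal (k / t1 * n1 + k / t2 * n2)"
        by (rule ennreal_leI)
      then show ?thesis
        using n1 n2 pos k t by (simp add: ennpow_ennreal flip: ennreal_mult)
    qed
    then have "(\<integral>\<^sup>+u. ennpow (N1 u) a * ennpow (N2 u) b \<partial>lborel)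
        \<le> (\<integral>\<^sup>+u. ennreal (k / t1) * N1 u + ennreal (k / t2) * N2 u \<partial>lborel)"
      by (intro nn_integral_mono)
    also have "\<dots> = ennreal (k / t1) * (ennreal (2 ^ DIM('a) * V) * ennreal t1) + ennreal (k / t2) * (ennreal (2 ^ DIM('a) * V) * ennreal t2)"
      using nn_integral_ball_average[of H1 "2 * R"] nn_integral_ball_average[of H2 "2 * R"]
      by (simp add: nn_integral_add nn_integral_cmult N1_def[symmetric] N2_def[symmetric] t1 t2 V)
    also have "\<dots> = ennreal (2 ^ DIM('a) * V * k) + ennreal (2 ^ DIM('a) * V * k)"
      using k t V(1) by (simp add: mult_ac flip: ennreal_mult)
    also have "\<dots> = ennreal (2 * 2 ^ DIM('a) * V * k)"
      using k V(1) by (simp add: mult.assoc flip: ennreal_plus)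
    also have "ennreal (2 * 2 ^ DIM('a) * V * k) = ennreal (2 * 2 ^ DIM('a) * V) * (ennpow (ennreal t1) a * ennpow (ennreal t2) b)"
      using t pos V by (simp add: ennpow_ennreal k_def flip: ennreal_mult)
    finally show ?thesis .
  qed
  have "ennreal V * (\<integral>\<^sup>+x. ?Q x \<partial>lborel) = (\<integral>\<^sup>+u. (\<integral>\<^sup>+x\<in>ball u R. ?Q x \<partial>lborel) \<partial>lborel)"
    using V by (subst nn_integral_ball_average) auto
  also have "\<dots> \<le> (\<integral>\<^sup>+u. K * (ennpow (N1 u) a * ennpow (N2 u) b) \<partial>lborel)"
  proof (rule nn_integral_mono)
    fix u :: 'a
    let ?J1 = "\<integral>\<^sup>+x\<in>ball u (2 * R). F1 x \<partial>lborel" and ?J2 = "\<integral>\<^sup>+x\<in>ball u (2 * R). F2 x \<partial>lborel"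
    have "(\<integral>\<^sup>+x\<in>ball u R. ?Q x \<partial>lborel) \<le> (\<integral>\<^sup>+x. (W x * indicator (ball u (2 * R)) x) * (ennpow ?J1 q * ennpow ?J2 q) \<partial>lborel)"
    proof (rule nn_integral_mono)
      fix x :: 'a
      show "?Q x * indicator (ball u R) x \<le> (W x * indicator (ball u (2 * R)) x) * (ennpow ?J1 q * ennpow ?J2 q)"
      proof (cases "dist u x < R")
        case True
        \<comment> \<open>This inclusion is the reason for the radius \<open>2 * R\<close>: the
          inner integrals can be replaced by quantities depending on \<open>u\<close> only, to which
          the bound on balls applies.\<close>
        have sub: "ball x R \<subseteq> ball u (2 * R)"
          using True by (intro subsetI) (smt (verit) dist_triangle mem_ball)
        have "x \<in> ball u (2 * R)" "x \<in> ball u R"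
          using True pos by auto
        moreover have "ennpow (\<integral>\<^sup>+y\<in>ball x R. F1 y \<partial>lborel) q * ennpow (\<integral>\<^sup>+y\<in>ball x R. F2 y \<partial>lborel) q
            \<le> ennpow ?J1 q * ennpow ?J2 q"
          using sub pos by (intro mult_mono ennpow_mono nn_integral_mono) (auto simp: indicator_def)
        ultimately show ?thesis
          by (simp add: mult_left_mono)
      qed simp
    qed
    also have "\<dots> = (\<integral>\<^sup>+x\<in>ball u (2 * R). W x \<partial>lborel) * (ennpow ?J1 q * ennpow ?J2 q)"
      by (rule nn_integral_multc) (auto intro!: borel_measurable_times_ennreal borel_measurable_indicator)
    also have "\<dots> \<le> K * (ennpow (N1 u) a * ennpow (N2 u) b)"
      unfolding N1_def N2_def by (rule bound)
    finally show "(\<integral>\<^sup>+x\<in>ball u R. ?Q x \<partial>lborel) \<le> K * (ennpow (N1 u) a * ennpow (N2 u) b)" .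
  qed
  also have "\<dots> = K * (\<integral>\<^sup>+u. ennpow (N1 u) a * ennpow (N2 u) b \<partial>lborel)"
    by (rule nn_integral_cmult) measurable
  also have "\<dots> \<le> K * (ennreal (2 * 2 ^ DIM('a) * V) * (ennpow (ennreal t1) a * ennpow (ennreal t2) b))"
    using NN by (rule mult_left_mono) simp
  also have "\<dots> = ennreal V * (K * ennreal (2 * 2 ^ DIM('a)) * (ennpow (ennreal t1) a * ennpow (ennreal t2) b))"
    using V by (simp add: ennreal_mult mult_ac)
  finally show ?thesis
    using V unfolding t1 t2 by (subst (asm) ennreal_mult_le_mult_iff) auto
qed

subsection \<open>The potential estimate for kernel averages\<close>

text \<open>At time \<open>r powr m\<close> the scaling factors become \<open>r ^ CARD('n)\<close>
  and \<open>r\<close>. The profile \<open>\<gamma>\<close> is traded for an explicit power: its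
  limit gives the decay beyond some \<open>u0\<close>, its boundedness covers the rest.\<close>

lemma kernel_decay:
  fixes K :: "real \<Rightarrow> real ^ 'n \<Rightarrow> real ^ 'n \<Rightarrow> complex"
  assumes "kernel_bounds m \<epsilon> K" "0 < m" "0 < \<epsilon>"
  shows "\<exists>A\<ge>0. \<forall>r>0. \<forall>x y. norm (K (r powr m) x y)
    \<le> A * (1 / r ^ CARD('n)) * (1 + dist x y / r) powr - (2 * real CARD('n) + \<epsilon>)"
proof -
  define N where "N = 2 * real CARD('n) + \<epsilon>"
  have N: "0 < N"
    using assms by (simp add: N_def)
  obtain \<gamma> where \<gamma>: "\<And>r. 0 \<le> r \<Longrightarrow> 0 \<le> \<gamma> r" "bounded (\<gamma> ` {0..})"
      and lim: "((\<lambda>r. r powr N * \<gamma> r) \<longlongrightarrow> 0) at_top"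
      and K: "\<And>t x y. 0 < t \<Longrightarrow> norm (K t x y)
          \<le> t powr (- (real CARD('n) / m)) * \<gamma> (norm (x - y) / t powr (1 / m))"
    using assms(1) unfolding kernel_bounds_def N_def by blast
  obtain b where b: "\<And>u. 0 \<le> u \<Longrightarrow> \<bar>\<gamma> u\<bar> \<le> b"
    using \<gamma>(2) unfolding bounded_iff by auto
  have "\<forall>\<^sub>F u in at_top. u powr N * \<gamma> u < 1"
    using order_tendstoD(2)[OF lim] by simp
  then obtain u1 where u1: "\<And>u. u1 \<le> u \<Longrightarrow> u powr N * \<gamma> u < 1"
    by (auto simp: eventually_at_top_linorder)
  define u0 where "u0 = max 1 u1"
  \<comment> \<open>Beyond \<open>u0 \<ge> 1\<close> the inequality \<open>1 + u \<le> 2 * u\<close>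
    costs \<open>2 powr N\<close>; up to \<open>u0\<close> the bound \<open>b\<close> of
    \<open>\<gamma>\<close> is multiplied by the largest value of
    \<open>(1 + u) powr N\<close>.\<close>
  define A where "A = max (2 powr N) (b * (1 + u0) powr N)"
  have decay: "\<gamma> u \<le> A * (1 + u) powr - N" if "0 \<le> u" for u
  proof (cases "u0 \<le> u")
    case True
    then have u: "1 \<le> u" "u powr N * \<gamma> u < 1"
      using u1 by (auto simp: u0_def)
    have "(1 + u) powr N * \<gamma> u \<le> (2 * u) powr N * \<gamma> u"
      using u that \<gamma>(1) N by (intro mult_right_mono powr_mono2) auto
    also have "\<dots> = 2 powr N * (u powr N * \<gamma> u)"
      using u by (simp add: powr_mult)
    also have "\<dots> \<le> 2 powr N * 1"
      using u by (intro mult_left_mono) auto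
    also have "\<dots> \<le> A"
      by (simp add: A_def)
    finally show ?thesis
      using that by (simp add: powr_minus field_simps)
  next
    case False
    have "(1 + u) powr N * \<gamma> u \<le> (1 + u0) powr N * b"
      using False that b[OF that] \<gamma>(1)[OF that] N by (intro mult_mono powr_mono2) auto
    also have "\<dots> \<le> A"
      by (simp add: A_def mult.commute)
    finally show ?thesis
      using that by (simp add: powr_minus field_simps)
  qed
  have "norm (K (r powr m) x y) \<le> A * (1 / r ^ CARD('n)) * (1 + dist x y / r) powr - N"
    if "0 < r" for r x y
  proof -
    have "norm (K (r powr m) x y) \<le> (r powr m) powr (- (real CARD('n) / m)) * \<gamma> (norm (x - y) / (r powr m) powr (1 / m))"
      using that by (intro K) auto
    also have "\<dots> = (1 / r ^ CARD('n)) * \<gamma> (dist x y / r)"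
      using that assms by (simp add: powr_powr powr_minus powr_realpow dist_norm field_simps)
    also have "\<dots> \<le> (1 / r ^ CARD('n)) * (A * (1 + dist x y / r) powr - N)"
      using that by (intro mult_left_mono decay) auto
    finally show ?thesis
      by (simp add: mult_ac)
  qed
  moreover have "0 \<le> A"
    by (simp add: A_def le_max_iff_disj)
  ultimately show ?thesis
    unfolding N_def by blast
qed

section \<open>Increments of a product along two segments\<close>

lemma frechet_derivative_le_gradient:
  fixes f :: "real ^ 'n \<Rightarrow> complex"
  assumes "f differentiable (at x)"
  shows "norm (frechet_derivative f (at x) v) \<le> real CARD('n) * norm (gradient f x) * norm v"
proof -
  let ?D = "frechet_derivative f (at x)"
  have lin: "linear ?D"
    using assms by (rule linear_frechet_derivative)
  have "?D v = ?D (\<Sum>i\<in>UNIV. (v $ i) *\<^sub>R axis i 1)"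
    using basis_expansion[of v] by (simp add: scalar_mult_eq_scaleR)
  also have "\<dots> = (\<Sum>i\<in>UNIV. (v $ i) *\<^sub>R gradient f x $ i)"
    using lin by (simp add: linear_sum linear_scale gradient_def)
  \<comment> \<open>Estimating every coordinate by the full norms loses a factor
    \<open>CARD('n)\<close>, which ends up in the constant.\<close>
  also have "norm \<dots> \<le> (\<Sum>i\<in>(UNIV :: 'n set). norm (gradient f x) * norm v)"
    using Finite_Cartesian_Product.norm_nth_le[of v] Finite_Cartesian_Product.norm_nth_le[of "gradient f x"]
    by (intro sum_norm_le) (simp add: mult.commute mult_mono)
  finally show ?thesis
    by simp
qed

lemma C1_continuous: "C1 f \<Longrightarrow> continuous_on S f"
  unfolding C1_def by (meson continuous_at_imp_continuous_on differentiable_imp_continuous_within)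

lemma C1_borel:
  assumes "C1 f"
  shows "f \<in> borel_measurable borel" "gradient f \<in> borel_measurable borel"
  using assms C1_continuous[OF assms, of UNIV] by (auto simp: C1_def intro!: borel_measurable_continuous_onI)

text \<open>This is the fundamental theorem of calculus for
  \<open>s \<mapsto> f (Y s) * g (Z s)\<close>. With one parameter for both segments, each term of
  the derivative has one gradient and one undifferentiated factor, and bounding both segment lengths
  by their maximum lets a common factor be taken out.\<close>

lemma product_increment_le:
  fixes f g :: "real ^ 'n \<Rightarrow> complex"
  assumes C1: "C1 f" "C1 g"
  shows "ennreal (norm (f x * g x - f y * g z)) \<le>
    ennreal (real CARD('n) * max (dist x y) (dist x z)) *
    (\<integral>\<^sup>+s\<in>{0..1}. (ennreal (norm (gradient f (x + s *\<^sub>R (y - x)))) * ennreal (norm (g (x + s *\<^sub>R (z - x))))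
       + ennreal (norm (f (x + s *\<^sub>R (y - x)))) * ennreal (norm (gradient g (x + s *\<^sub>R (z - x))))) \<partial>lborel)"
proof -
  define Y where "Y s = x + s *\<^sub>R (y - x)" for s
  define Z where "Z s = x + s *\<^sub>R (z - x)" for s
  define M where "M = max (dist x y) (dist x z)"
  define h' where "h' s = f (Y s) * frechet_derivative g (at (Z s)) (z - x)
      + frechet_derivative f (at (Y s)) (y - x) * g (Z s)" for s
  define B where "B s = norm (gradient f (Y s)) * norm (g (Z s)) + norm (f (Y s)) * norm (gradient g (Z s))" for s
  have M: "0 \<le> M" "norm (y - x) \<le> M" "norm (z - x) \<le> M"
    by (auto simp: M_def dist_norm norm_minus_commute le_max_iff_disj)
  have cont: "continuous_on S (\<lambda>s. f (Y s))" "continuous_on S (\<lambda>s. g (Z s))"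
      "continuous_on S (\<lambda>s. gradient f (Y s))" "continuous_on S (\<lambda>s. gradient g (Z s))" for S
  proof -
    have Y: "continuous_on S Y" "continuous_on S Z"
      unfolding Y_def Z_def by (intro continuous_intros)+
    have "continuous_on UNIV (gradient f)" "continuous_on UNIV (gradient g)"
      using C1 by (auto simp: C1_def)
    with C1_continuous[OF C1(1), of UNIV] C1_continuous[OF C1(2), of UNIV] Y
    show "continuous_on S (\<lambda>s. f (Y s))" "continuous_on S (\<lambda>s. g (Z s))"
        "continuous_on S (\<lambda>s. gradient f (Y s))" "continuous_on S (\<lambda>s. gradient g (Z s))"
      by (auto elim!: continuous_on_compose2)
  qed
  have contB: "continuous_on S B" for S
    unfolding B_def by (intro continuous_intros cont)
  have "((\<lambda>s. f (Y s) * g (Z s)) has_vector_derivative h' s) (at s within {0..1})" for s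
  proof -
    have dY: "(Y has_vector_derivative (y - x)) (at s within {0..1})" and dZ: "(Z has_vector_derivative (z - x)) (at s within {0..1})"
      unfolding Y_def Z_def by (auto intro!: derivative_eq_intros)
    have "(f has_derivative frechet_derivative f (at (Y s))) (at (Y s) within Y ` {0..1})"
         "(g has_derivative frechet_derivative g (at (Z s))) (at (Z s) within Z ` {0..1})"
      using C1 by (simp_all add: C1_def has_derivative_at_withinI frechet_derivative_works[THEN iffD1])
    then have "(f \<circ> Y has_vector_derivative frechet_derivative f (at (Y s)) (y - x)) (at s within {0..1})"
        "(g \<circ> Z has_vector_derivative frechet_derivative g (at (Z s)) (z - x)) (at s within {0..1})"
      using dY dZ by (blast intro: vector_derivative_diff_chain_within)+
    from has_vector_derivative_mult[OF this] show ?thesis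
      by (simp add: o_def h'_def)
  qed
  then have h': "(h' has_integral (f (Y 1) * g (Z 1) - f (Y 0) * g (Z 0))) {0..1}"
    by (intro fundamental_theorem_of_calculus) auto
  have le: "norm (h' s) \<le> real CARD('n) * M * B s" for s
  proof -
    have "norm (h' s) \<le> norm (f (Y s)) * norm (frechet_derivative g (at (Z s)) (z - x))
        + norm (frechet_derivative f (at (Y s)) (y - x)) * norm (g (Z s))"
      unfolding h'_def by (metis norm_mult norm_triangle_ineq)
    also have "\<dots> \<le> norm (f (Y s)) * (real CARD('n) * norm (gradient g (Z s)) * M)
        + (real CARD('n) * norm (gradient f (Y s)) * M) * norm (g (Z s))"
    proof -
      have "norm (frechet_derivative g (at (Z s)) (z - x)) \<le> real CARD('n) * norm (gradient g (Z s)) * M"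
        by (rule order_trans[OF frechet_derivative_le_gradient])
          (use C1 M in \<open>auto simp: C1_def intro!: mult_left_mono\<close>)
      moreover have "norm (frechet_derivative f (at (Y s)) (y - x)) \<le> real CARD('n) * norm (gradient f (Y s)) * M"
        by (rule order_trans[OF frechet_derivative_le_gradient])
          (use C1 M in \<open>auto simp: C1_def intro!: mult_left_mono\<close>)
      ultimately show ?thesis
        by (intro add_mono mult_left_mono mult_right_mono) auto
    qed
    also have "\<dots> = real CARD('n) * M * B s"
      by (simp add: B_def algebra_simps)
    finally show ?thesis .
  qed
  have intB: "B integrable_on {0..1}"
    by (intro integrable_continuous_real contB)
  have "norm (f x * g x - f y * g z) = norm (integral {0..1} h')"
    using integral_unique[OF h'] by (simp add: Y_def Z_def norm_minus_commute)
  also have "\<dots> \<le> integral {0..1} (\<lambda>s. real CARD('n) * M * B s)"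
    using h' le intB by (intro integral_norm_bound_integral) (auto simp: has_integral_integrable intro: integrable_on_mult_right)
  also have "\<dots> = real CARD('n) * M * integral {0..1} B"
    by simp
  finally have "ennreal (norm (f x * g x - f y * g z)) \<le> ennreal (real CARD('n) * M) * ennreal (integral {0..1} B)"
    using M by (metis ennreal_leI ennreal_mult' mult_nonneg_nonneg of_nat_0_le_iff)
  also have "ennreal (integral {0..1} B) = (\<integral>\<^sup>+s. ennreal (B s) * indicator {0..1} s \<partial>lborel)"
    using nn_integral_has_integral_lebesgue[of "{0..1}" B "integral {0..1} B"] intB
    by (auto simp: B_def integrable_integral ennreal_mult' ennreal_indicator mult.commute nn_integral_completion)
  finally show ?thesis
    by (simp add: M_def B_def Y_def Z_def ennreal_mult)
qed

section \<open>Undoing the dilation, and the kernel it produces\<close>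

lemma nn_integral_dilation:
  fixes h :: "'a::euclidean_space \<Rightarrow> ennreal"
  assumes [measurable]: "h \<in> borel_measurable borel" and "0 < s"
  shows "(\<integral>\<^sup>+y. h (x + s *\<^sub>R (y - x)) \<partial>lborel) = ennreal (1 / s ^ DIM('a)) * (\<integral>\<^sup>+y. h y \<partial>lborel)"
proof -
  have "(\<integral>\<^sup>+y. h y \<partial>lborel) = (\<integral>\<^sup>+y. h y \<partial>density (distr lborel borel (\<lambda>y. (x - s *\<^sub>R x) + s *\<^sub>R y)) (\<lambda>_. ennreal (\<bar>s\<bar> ^ DIM('a))))"
    using assms lborel_affine[of s "x - s *\<^sub>R x"] by simp
  also have "\<dots> = ennreal (s ^ DIM('a)) * (\<integral>\<^sup>+y. h ((x - s *\<^sub>R x) + s *\<^sub>R y) \<partial>lborel)"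
    using assms(2) by (simp add: nn_integral_density nn_integral_cmult nn_integral_distr)
  also have "(\<lambda>y. h ((x - s *\<^sub>R x) + s *\<^sub>R y)) = (\<lambda>y. h (x + s *\<^sub>R (y - x)))"
    by (simp add: algebra_simps)
  finally show ?thesis
    using assms(2) by (simp add: mult.assoc[symmetric] flip: ennreal_mult)
qed

text \<open>\<open>N\<close> will be \<open>2n\<close> and \<open>\<delta>\<close> will be
  \<open>\<alpha> / 2\<close>. At \<open>\<rho> = 0\<close> the real power is 0, not infinity; this
  is consistent because the expression to be dominated carries a factor
  \<open>\<rho>\<close>.\<close>

definition potential_kernel :: "real \<Rightarrow> real \<Rightarrow> real \<Rightarrow> real \<Rightarrow> real \<Rightarrow> real" where
  "potential_kernel N \<epsilon> \<delta> r \<rho> =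
    (if \<rho> < r then r powr \<delta> * \<rho> powr (1 - N - \<delta>) else r powr \<epsilon> * \<rho> powr (1 - N - \<epsilon>))"

definition bilinear_potential ::
  "real \<Rightarrow> real \<Rightarrow> real \<Rightarrow> ('a::euclidean_space \<Rightarrow> ennreal) \<Rightarrow> ('a \<Rightarrow> ennreal) \<Rightarrow> 'a \<Rightarrow> ennreal" where
  "bilinear_potential \<epsilon> \<delta> r F1 F2 x = (\<integral>\<^sup>+y. (\<integral>\<^sup>+z.
     ennreal (potential_kernel (2 * real DIM('a)) \<epsilon> \<delta> r (max (dist x y) (dist x z))) * (F1 y * F2 z) \<partial>lborel) \<partial>lborel)"

lemma potential_kernel_nonneg [simp]: "0 \<le> potential_kernel N \<epsilon> \<delta> r \<rho>"
  by (simp add: potential_kernel_def)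

lemma potential_kernel_measurable [measurable]: "potential_kernel N \<epsilon> \<delta> r \<in> borel_measurable borel"
  unfolding potential_kernel_def by measurable

text \<open>For every \<open>\<theta>\<close> between \<open>\<delta>\<close> and
  \<open>\<epsilon>\<close> the decay may be weakened to \<open>N + \<theta>\<close>; dropping the 1
  in \<open>1 + \<rho> / s / r\<close> then leaves the pure power \<open>s powr (\<theta> - 1) * (r
  powr \<theta> * \<rho> powr (1 - N - \<theta>))\<close>. The two branches of the kernel are
  \<open>\<theta> = \<delta>\<close> and \<open>\<theta> = \<epsilon>\<close>, and
  \<open>s \<le> 1\<close> permits the common factor \<open>s powr (\<delta> - 1)\<close>.\<close>

lemma dilated_kernel_le:
  fixes N \<epsilon> \<delta> r s \<rho> :: real
  assumes "0 < N" "0 < \<delta>" "\<delta> \<le> \<epsilon>" "0 < r" "0 < s" "s \<le> 1" "0 \<le> \<rho>"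
  shows "s powr - N * (r powr - N * (1 + \<rho> / s / r) powr - (N + \<epsilon>) * (\<rho> / s))
    \<le> s powr (\<delta> - 1) * potential_kernel N \<epsilon> \<delta> r \<rho>"
proof (cases "\<rho> = 0")
  case True
  then show ?thesis
    by simp
next
  case False
  then have \<rho>: "0 < \<rho>"
    using assms by simp
  have *: "s powr - N * (r powr - N * (1 + \<rho> / s / r) powr - (N + \<epsilon>) * (\<rho> / s))
      \<le> s powr (\<delta> - 1) * (r powr \<theta> * \<rho> powr (1 - N - \<theta>))" if \<theta>: "\<delta> \<le> \<theta>" "\<theta> \<le> \<epsilon>" for \<theta>
  proof -
    have "(1 + \<rho> / s / r) powr - (N + \<epsilon>) \<le> (1 + \<rho> / s / r) powr - (N + \<theta>)"
      using \<theta> assms \<rho> by (intro powr_mono) auto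
    also have "\<dots> \<le> (\<rho> / s / r) powr - (N + \<theta>)"
      using \<theta> assms \<rho> by (intro powr_mono2') auto
    also have "\<dots> = \<rho> powr - (N + \<theta>) * (s powr (N + \<theta>) * r powr (N + \<theta>))"
    proof -
      have "(\<rho> / s / r) powr e = \<rho> powr e / s powr e / r powr e" for e
        using assms \<rho> by (simp add: powr_divide powr_mult)
      then show ?thesis
        by (simp only: powr_minus[of s] powr_minus[of r] divide_inverse[of _ "inverse _"] inverse_inverse_eq mult.assoc)
    qed
    finally have "s powr - N * (r powr - N * (1 + \<rho> / s / r) powr - (N + \<epsilon>) * (\<rho> / s))
        \<le> s powr - N * (r powr - N * (\<rho> powr - (N + \<theta>) * (s powr (N + \<theta>) * r powr (N + \<theta>))) * (\<rho> powr 1 / s powr 1))"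
      using assms \<rho> by (intro mult_mono) auto
    also have "\<dots> = (s powr - N * s powr (N + \<theta>) / s powr 1) * ((r powr - N * r powr (N + \<theta>)) * (\<rho> powr - (N + \<theta>) * \<rho> powr 1))"
      by (simp add: field_simps)
    also have "\<dots> = s powr (\<theta> - 1) * (r powr \<theta> * \<rho> powr (1 - N - \<theta>))"
      by (simp only: powr_add[symmetric] powr_diff[symmetric]) (simp add: algebra_simps)
    also have "\<dots> \<le> s powr (\<delta> - 1) * (r powr \<theta> * \<rho> powr (1 - N - \<theta>))"
      using assms \<theta> by (intro mult_right_mono powr_mono') auto
    finally show ?thesis .
  qed
  show ?thesis
    unfolding potential_kernel_def using *[of \<delta>] *[of \<epsilon>] assms by auto
qed

section \<open>Averages against a kernel of integral 1\<close>

text \<open>The constant \<open>c\<close> is written as its own average, first in \<open>y\<close>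
  with the average \<open>G\<close> of \<open>g\<close> held fixed, then in \<open>z\<close> for
  each fixed \<open>y\<close>. Iterating in this way needs integrability in one variable at a time
  only.\<close>

lemma product_minus_averages_le:
  fixes P f g :: "'a \<Rightarrow> complex"
  assumes P: "integrable M P" "(LINT y|M. P y) = 1"
    and Pf: "integrable M (\<lambda>y. P y * f y)" and Pg: "integrable M (\<lambda>y. P y * g y)"
  shows "ennreal (norm (c - (LINT y|M. P y * f y) * (LINT y|M. P y * g y)))
    \<le> (\<integral>\<^sup>+y. (\<integral>\<^sup>+z. ennreal (norm (P y) * norm (P z) * norm (c - f y * g z)) \<partial>M) \<partial>M)"
proof -
  define G where "G = (LINT y|M. P y * g y)"
  have Pc: "integrable M (\<lambda>y. P y * c)"
    using P by simp
  have PfG: "integrable M (\<lambda>y. P y * f y * G)"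
    using Pf by simp
  have eq1: "c - (LINT y|M. P y * f y) * G = (LINT y|M. P y * (c - f y * G))"
    using Pc PfG P by (simp add: right_diff_distrib mult.assoc[symmetric])
  have eq2: "c - f y * G = (LINT z|M. P z * (c - f y * g z))" for y
  proof -
    have "integrable M (\<lambda>z. f y * (P z * g z))"
      using Pg by simp
    then show ?thesis
      using Pc P by (simp add: right_diff_distrib G_def mult.left_commute[of _ "f y"])
  qed
  have int1: "integrable M (\<lambda>y. P y * (c - f y * G))"
    using Pc PfG by (simp add: right_diff_distrib mult.assoc[symmetric])
  have int2: "integrable M (\<lambda>z. P z * (c - f y * g z))" for y
  proof -
    have "integrable M (\<lambda>z. f y * (P z * g z))"
      using Pg by simp
    then show ?thesis
      using Pc by (simp add: right_diff_distrib mult.left_commute)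
  qed
  have "ennreal (norm (c - (LINT y|M. P y * f y) * G)) \<le> (\<integral>\<^sup>+y. ennreal (norm (P y * (c - f y * G))) \<partial>M)"
    unfolding eq1 by (rule integral_norm_bound_ennreal[OF int1])
  also have "\<dots> \<le> (\<integral>\<^sup>+y. (\<integral>\<^sup>+z. ennreal (norm (P y) * norm (P z) * norm (c - f y * g z)) \<partial>M) \<partial>M)"
  proof (rule nn_integral_mono)
    fix y
    have "ennreal (norm (P y * (c - f y * G))) = ennreal (norm (P y)) * ennreal (norm (c - f y * G))"
      by (simp add: norm_mult ennreal_mult)
    also have "\<dots> \<le> ennreal (norm (P y)) * (\<integral>\<^sup>+z. ennreal (norm (P z * (c - f y * g z))) \<partial>M)"
      unfolding eq2[of y] by (intro mult_left_mono integral_norm_bound_ennreal int2) simp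
    also have "\<dots> = (\<integral>\<^sup>+z. ennreal (norm (P y)) * ennreal (norm (P z * (c - f y * g z))) \<partial>M)"
      using int2[of y] by (intro nn_integral_cmult[symmetric]) auto
    also have "\<dots> = (\<integral>\<^sup>+z. ennreal (norm (P y) * norm (P z) * norm (c - f y * g z)) \<partial>M)"
      by (simp add: norm_mult ennreal_mult mult.assoc)
    finally show "ennreal (norm (P y * (c - f y * G))) \<le> \<dots>" .
  qed
  finally show ?thesis
    by (simp add: G_def)
qed

text \<open>The decay of the kernel is centred at \<open>x\<close> and has scale \<open>r\<close>,
  the growth condition on \<open>f\<close> is centred at 0 and has scale 1; the two weights are
  comparable up to a constant depending on \<open>x\<close> and \<open>r\<close>.\<close>

lemma integrable_decaying_kernel_mult:
  fixes P f :: "real ^ 'n \<Rightarrow> complex"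
  assumes [measurable]: "P \<in> borel_measurable lebesgue" "f \<in> borel_measurable borel"
    and N: "0 < N" and r: "0 < r" and A: "0 \<le> A"
    and P: "\<And>y. norm (P y) \<le> A * (1 + dist x y / r) powr - N"
    and f: "(\<integral>\<^sup>+y. ennreal (norm (f y) * (1 + norm y) powr - N) \<partial>lebesgue) < \<infinity>"
  shows "integrable lebesgue (\<lambda>y. P y * f y)"
proof (rule integrableI_bounded)
  have [measurable]: "f \<in> borel_measurable lebesgue"
    using assms(2) by (simp add: measurable_completion)
  show "(\<lambda>y. P y * f y) \<in> borel_measurable lebesgue"
    by measurable
  \<comment> \<open>Chosen so that \<open>L * (1 + dist x y / r)\<close> contains all terms of
    \<open>1 + norm x + dist x y\<close> when multiplied out: the summand \<open>r\<close> supplies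
    \<open>dist x y\<close>, the others supply \<open>1 + norm x\<close>.\<close>
  define L where "L = 1 + norm x + r"
  have L: "0 < L"
    using r by (simp add: L_def add_pos_nonneg)
  have "norm (P y * f y) \<le> A * L powr N * (norm (f y) * (1 + norm y) powr - N)" for y
  proof -
    have "1 + norm y \<le> 1 + norm x + dist x y"
      using norm_triangle_ineq2[of y x] by (simp add: dist_norm norm_minus_commute)
    also have "\<dots> \<le> L * (1 + dist x y / r)"
    proof -
      have "L * (1 + dist x y / r) = 1 + norm x + dist x y + r + (1 + norm x) * (dist x y / r)"
        using r by (simp add: L_def field_simps)
      also have "\<dots> \<ge> 1 + norm x + dist x y"
        using r by (simp add: add_nonneg_nonneg)
      finally show ?thesis .
    qed
    finally have "(1 + norm y) / L \<le> 1 + dist x y / r"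
      using L by (simp add: field_simps)
    moreover have "0 < (1 + norm y) / L"
      using L by (simp add: add_pos_nonneg)
    ultimately have "(1 + dist x y / r) powr - N \<le> ((1 + norm y) / L) powr - N"
      using N by (intro powr_mono2') auto
    also have "\<dots> = L powr N * (1 + norm y) powr - N"
      using L by (simp add: powr_divide powr_minus divide_simps)
    finally have "A * (1 + dist x y / r) powr - N \<le> A * (L powr N * (1 + norm y) powr - N)"
      using A by (rule mult_left_mono)
    with P[of y] have "norm (P y) \<le> A * (L powr N * (1 + norm y) powr - N)"
      by linarith
    then have "norm (P y) * norm (f y) \<le> A * (L powr N * (1 + norm y) powr - N) * norm (f y)"
      by (rule mult_right_mono) simp
    then show ?thesis
      by (simp add: norm_mult mult_ac)
  qed
  then have "(\<integral>\<^sup>+y. ennreal (norm (P y * f y)) \<partial>lebesgue)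
      \<le> (\<integral>\<^sup>+y. ennreal (A * L powr N) * ennreal (norm (f y) * (1 + norm y) powr - N) \<partial>lebesgue)"
    using A by (intro nn_integral_mono) (simp add: ennreal_mult[symmetric] ennreal_leI)
  also have "\<dots> = ennreal (A * L powr N) * (\<integral>\<^sup>+y. ennreal (norm (f y) * (1 + norm y) powr - N) \<partial>lebesgue)"
    by (intro nn_integral_cmult) (auto intro!: measurable_completion)
  also have "\<dots> < \<infinity>"
    using f by (simp add: ennreal_mult_less_top)
  finally show "(\<integral>\<^sup>+y. ennreal (norm (P y * f y)) \<partial>lebesgue) < \<infinity>" .
qed

text \<open>Substitution in \<open>y\<close> and in \<open>z\<close> costs \<open>s powr - N\<close>
  altogether and divides the distances in the kernel by \<open>s\<close>;
  \<open>dilated_kernel_le\<close> then compares the integrands.\<close>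

lemma dilated_average_le:
  fixes F1 F2 :: "'a::euclidean_space \<Rightarrow> ennreal"
  assumes [measurable]: "F1 \<in> borel_measurable borel" "F2 \<in> borel_measurable borel"
    and "0 < \<delta>" "\<delta> \<le> \<epsilon>" "0 < r" "0 < s" "s \<le> 1"
  defines "N \<equiv> 2 * real DIM('a)"
  shows "(\<integral>\<^sup>+y. (\<integral>\<^sup>+z. ennreal (r powr - N * (1 + max (dist x y) (dist x z) / r) powr - (N + \<epsilon>) * max (dist x y) (dist x z))
        * (F1 (x + s *\<^sub>R (y - x)) * F2 (x + s *\<^sub>R (z - x))) \<partial>lborel) \<partial>lborel)
    \<le> ennreal (s powr (\<delta> - 1)) * bilinear_potential \<epsilon> \<delta> r F1 F2 x"
proof -
  define \<psi> where "\<psi> \<rho> = r powr - N * (1 + \<rho> / s / r) powr - (N + \<epsilon>) * (\<rho> / s)" for \<rho>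
  define H where "H y z = ennreal (\<psi> (max (dist x y) (dist x z))) * (F1 y * F2 z)" for y z
  have [measurable]: "\<psi> \<in> borel_measurable borel"
    unfolding \<psi>_def by measurable
  have H_pair [measurable]: "(\<lambda>w. H (fst w) (snd w)) \<in> borel_measurable (borel \<Otimes>\<^sub>M borel)"
    unfolding H_def by measurable
  have [measurable]: "H y \<in> borel_measurable borel" for y
    unfolding H_def by measurable
  have H_int [measurable]: "(\<lambda>y. \<integral>\<^sup>+z. H y z \<partial>lborel) \<in> borel_measurable borel"
    using lborel.borel_measurable_nn_integral_fst[of "\<lambda>w. H (fst w) (snd w)" borel] by simp
  have dist: "dist x (x + s *\<^sub>R (y - x)) = s * dist x y" for y
    using assms by (simp add: dist_norm norm_minus_commute)
  have max: "max (s * a) (s * b) / s = max a b" for a b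
    using assms by (simp add: max_mult_distrib_left[symmetric] max_def)
  have "(\<integral>\<^sup>+y. (\<integral>\<^sup>+z. ennreal (r powr - N * (1 + max (dist x y) (dist x z) / r) powr - (N + \<epsilon>) * max (dist x y) (dist x z))
        * (F1 (x + s *\<^sub>R (y - x)) * F2 (x + s *\<^sub>R (z - x))) \<partial>lborel) \<partial>lborel)
      = (\<integral>\<^sup>+y. (\<integral>\<^sup>+z. H (x + s *\<^sub>R (y - x)) (x + s *\<^sub>R (z - x)) \<partial>lborel) \<partial>lborel)"
    by (simp only: H_def \<psi>_def dist max)
  also have "\<dots> = (\<integral>\<^sup>+y. ennreal (1 / s ^ DIM('a)) * (\<integral>\<^sup>+z. H (x + s *\<^sub>R (y - x)) z \<partial>lborel) \<partial>lborel)"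
    using assms by (subst nn_integral_dilation) auto
  also have "\<dots> = ennreal (1 / s ^ DIM('a)) * (ennreal (1 / s ^ DIM('a)) * (\<integral>\<^sup>+y. (\<integral>\<^sup>+z. H y z \<partial>lborel) \<partial>lborel))"
    using assms nn_integral_dilation[OF H_int, of s x] by (subst nn_integral_cmult) auto
  also have "\<dots> = ennreal (s powr - N) * (\<integral>\<^sup>+y. (\<integral>\<^sup>+z. H y z \<partial>lborel) \<partial>lborel)"
  proof -
    have "1 / s ^ DIM('a) * (1 / s ^ DIM('a)) = s powr - N"
      using assms by (simp add: N_def powr_minus powr_realpow[symmetric] powr_add[symmetric] field_simps)
    then show ?thesis
      using assms by (simp add: mult.assoc[symmetric] ennreal_mult[symmetric])
  qed
  also have "\<dots> = (\<integral>\<^sup>+y. (\<integral>\<^sup>+z. ennreal (s powr - N) * H y z \<partial>lborel) \<partial>lborel)"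
    by (simp add: nn_integral_cmult)
  also have "\<dots> \<le> (\<integral>\<^sup>+y. (\<integral>\<^sup>+z. ennreal (s powr (\<delta> - 1)) * (ennreal (potential_kernel N \<epsilon> \<delta> r (max (dist x y) (dist x z))) * (F1 y * F2 z)) \<partial>lborel) \<partial>lborel)"
  proof (intro nn_integral_mono)
    fix y z :: 'a
    let ?M = "max (dist x y) (dist x z)"
    have "s powr - N * \<psi> ?M \<le> s powr (\<delta> - 1) * potential_kernel N \<epsilon> \<delta> r ?M"
      unfolding \<psi>_def by (rule dilated_kernel_le) (use assms in \<open>auto simp: N_def le_max_iff_disj\<close>)
    then have "ennreal (s powr - N) * ennreal (\<psi> ?M) \<le> ennreal (s powr (\<delta> - 1)) * ennreal (potential_kernel N \<epsilon> \<delta> r ?M)"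
      by (simp add: ennreal_mult'[symmetric] ennreal_leI)
    then show "ennreal (s powr - N) * H y z
        \<le> ennreal (s powr (\<delta> - 1)) * (ennreal (potential_kernel N \<epsilon> \<delta> r ?M) * (F1 y * F2 z))"
      unfolding H_def by (simp only: mult.assoc[symmetric]) (intro mult_right_mono; simp)
  qed
  also have "\<dots> = ennreal (s powr (\<delta> - 1)) * bilinear_potential \<epsilon> \<delta> r F1 F2 x"
  proof -
    define h where "h y z = ennreal (potential_kernel N \<epsilon> \<delta> r (max (dist x y) (dist x z))) * (F1 y * F2 z)" for y z
    have [measurable]: "(\<lambda>w. h (fst w) (snd w)) \<in> borel_measurable (borel \<Otimes>\<^sub>M borel)"
      unfolding h_def by measurable
    have 1: "h y \<in> borel_measurable borel" for y
      unfolding h_def by measurable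
    have 2: "(\<lambda>y. \<integral>\<^sup>+z. h y z \<partial>lborel) \<in> borel_measurable borel"
      using lborel.borel_measurable_nn_integral_fst[of "\<lambda>w. h (fst w) (snd w)" borel] by simp
    show ?thesis
      unfolding bilinear_potential_def N_def[symmetric] h_def[symmetric]
      using 1 2 by (simp add: nn_integral_cmult)
  qed
  finally show ?thesis .
qed

text \<open>Two exchanges by Tonelli bring the segment parameter to the outside, where the dilation
  can be undone for fixed \<open>s\<close>.\<close>

lemma nn_integral_rotate:
  fixes U :: "'a::euclidean_space \<Rightarrow> 'b::euclidean_space \<Rightarrow> 'c::euclidean_space \<Rightarrow> ennreal"
  assumes U: "(\<lambda>w. U (fst w) (fst (snd w)) (snd (snd w))) \<in> borel_measurable (borel \<Otimes>\<^sub>M (borel \<Otimes>\<^sub>M borel))"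
  shows "(\<integral>\<^sup>+y. (\<integral>\<^sup>+z. (\<integral>\<^sup>+s. U y z s \<partial>lborel) \<partial>lborel) \<partial>lborel)
    = (\<integral>\<^sup>+s. (\<integral>\<^sup>+y. (\<integral>\<^sup>+z. U y z s \<partial>lborel) \<partial>lborel) \<partial>lborel)"
proof -
  have 1: "(\<lambda>w. U y (fst w) (snd w)) \<in> borel_measurable (borel \<Otimes>\<^sub>M borel)" for y
    using measurable_compose[OF _ U, of "\<lambda>w. (y, fst w, snd w)"] by simp
  have 2: "(\<lambda>w. U (fst (fst w)) (snd w) (snd (fst w))) \<in> borel_measurable ((borel \<Otimes>\<^sub>M borel) \<Otimes>\<^sub>M borel)"
    using measurable_compose[OF _ U, of "\<lambda>w. (fst (fst w), snd w, snd (fst w))" "(borel \<Otimes>\<^sub>M borel) \<Otimes>\<^sub>M borel"] by simp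
  have 3: "(\<lambda>v. \<integral>\<^sup>+z. U (fst v) z (snd v) \<partial>lborel) \<in> borel_measurable (borel \<Otimes>\<^sub>M borel)"
    using lborel.borel_measurable_nn_integral_fst[of "\<lambda>w. U (fst (fst w)) (snd w) (snd (fst w))" "borel \<Otimes>\<^sub>M borel"] 2
    by simp
  have "(\<integral>\<^sup>+z. (\<integral>\<^sup>+s. U y z s \<partial>lborel) \<partial>lborel) = (\<integral>\<^sup>+s. (\<integral>\<^sup>+z. U y z s \<partial>lborel) \<partial>lborel)" for y
    by (rule lborel_pair.Fubini'[symmetric]) (use 1[of y] in \<open>simp add: split_beta'\<close>)
  then have "(\<integral>\<^sup>+y. (\<integral>\<^sup>+z. (\<integral>\<^sup>+s. U y z s \<partial>lborel) \<partial>lborel) \<partial>lborel)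
      = (\<integral>\<^sup>+y. (\<integral>\<^sup>+s. (\<integral>\<^sup>+z. U y z s \<partial>lborel) \<partial>lborel) \<partial>lborel)"
    by simp
  also have "\<dots> = (\<integral>\<^sup>+s. (\<integral>\<^sup>+y. (\<integral>\<^sup>+z. U y z s \<partial>lborel) \<partial>lborel) \<partial>lborel)"
    by (rule lborel_pair.Fubini'[symmetric]) (use 3 in \<open>simp add: split_beta'\<close>)
  finally show ?thesis .
qed

lemma nn_integral_powr_unit_interval:
  assumes "0 < \<delta>"
  shows "(\<integral>\<^sup>+s\<in>{0<..1}. ennreal (s powr (\<delta> - 1)) \<partial>lborel) = ennreal (1 / \<delta>)"
proof -
  have "((\<lambda>s. s powr (\<delta> - 1)) has_integral 1 / \<delta>) {0..1}"
    using has_integral_powr_from_0[of "\<delta> - 1" 1] assms by simp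
  then have "((\<lambda>s. s powr (\<delta> - 1)) has_integral 1 / \<delta>) {0<..1}"
    by (rule has_integral_spike_set_eq[THEN iffD1, rotated 2]) (auto intro: negligible_subset[of "{0}"])
  then have "(\<integral>\<^sup>+s. ennreal (indicator {0<..1} s * s powr (\<delta> - 1)) \<partial>lborel) = ennreal (1 / \<delta>)"
    using nn_integral_has_integral_lebesgue[of "{0<..1}" "\<lambda>s. s powr (\<delta> - 1)" "1 / \<delta>"] by simp
  then show ?thesis
    by (simp add: ennreal_mult' ennreal_indicator mult.commute)
qed

text \<open>Interpolating between \<open>x\<close> and the integration variables, then undoing the dilation for each
  parameter \<open>s\<close>, turns the increment of \<open>f y * g z\<close> into a potential of its gradient.\<close>

lemma averaged_product_increment_le:
  fixes f g :: "real ^ 'n \<Rightarrow> complex"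
  assumes C1: "C1 f" "C1 g" and \<delta>: "0 < \<delta>" "\<delta> \<le> \<epsilon>" and r: "0 < r"
  defines "N \<equiv> 2 * real CARD('n)"
  shows "(\<integral>\<^sup>+y. (\<integral>\<^sup>+z. ennreal (r powr - N * (1 + max (dist x y) (dist x z) / r) powr - (N + \<epsilon>))
        * ennreal (norm (f x * g x - f y * g z)) \<partial>lborel) \<partial>lborel)
    \<le> ennreal (real CARD('n) / \<delta>) *
      (bilinear_potential \<epsilon> \<delta> r (\<lambda>y. ennreal (norm (gradient f y))) (\<lambda>y. ennreal (norm (g y))) x
       + bilinear_potential \<epsilon> \<delta> r (\<lambda>y. ennreal (norm (f y))) (\<lambda>y. ennreal (norm (gradient g y))) x)"
    (is "?L \<le> _ * (?P1 + ?P2)")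
proof -
  note [measurable] = C1_borel[OF C1(1)] C1_borel[OF C1(2)]
  define M where "M y z = max (dist x y) (dist x z)" for y z
  define k where "k y z = ennreal (r powr - N * (1 + M y z / r) powr - (N + \<epsilon>) * M y z)" for y z
  define T1 where "T1 s y z = ennreal (norm (gradient f (x + s *\<^sub>R (y - x)))) * ennreal (norm (g (x + s *\<^sub>R (z - x))))" for s y z
  define T2 where "T2 s y z = ennreal (norm (f (x + s *\<^sub>R (y - x)))) * ennreal (norm (gradient g (x + s *\<^sub>R (z - x))))" for s y z
  have D: "2 * real DIM(real ^ 'n) = N"
    by (simp add: N_def)
  have M: "0 \<le> M y z" for y z
    by (simp add: M_def le_max_iff_disj)
  define U where "U y z s = k y z * (T1 s y z + T2 s y z) * indicator {0<..1} s" for y z and s :: real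
  \<comment> \<open>The dilation degenerates at \<open>s = 0\<close>, so this null set is removed
    before changing variables.\<close>
  have open_interval: "(\<integral>\<^sup>+s\<in>{0..1}. h s \<partial>lborel) = (\<integral>\<^sup>+s\<in>{0<..1}. h s \<partial>lborel)" for h :: "real \<Rightarrow> ennreal"
    by (intro nn_integral_cong_AE eventually_mono[OF AE_lborel_singleton[of 0]]) (auto simp: indicator_def)
  have "?L \<le> (\<integral>\<^sup>+y. (\<integral>\<^sup>+z. ennreal (real CARD('n)) * (\<integral>\<^sup>+s. U y z s \<partial>lborel) \<partial>lborel) \<partial>lborel)"
  proof (intro nn_integral_mono)
    fix y z :: "real ^ 'n"
    have "ennreal (r powr - N * (1 + M y z / r) powr - (N + \<epsilon>)) * ennreal (norm (f x * g x - f y * g z))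
      \<le> ennreal (r powr - N * (1 + M y z / r) powr - (N + \<epsilon>)) * (ennreal (real CARD('n) * M y z) * (\<integral>\<^sup>+s\<in>{0..1}. (T1 s y z + T2 s y z) \<partial>lborel))"
      using product_increment_le[OF C1, of x y z] unfolding M_def T1_def T2_def by (rule mult_left_mono) simp
    also have "\<dots> = ennreal (real CARD('n)) * (k y z * (\<integral>\<^sup>+s\<in>{0<..1}. (T1 s y z + T2 s y z) \<partial>lborel))"
      using M[of y z] unfolding k_def open_interval by (simp add: ennreal_mult mult_ac)
    also have "k y z * (\<integral>\<^sup>+s\<in>{0<..1}. (T1 s y z + T2 s y z) \<partial>lborel) = (\<integral>\<^sup>+s. U y z s \<partial>lborel)"
      unfolding U_def T1_def T2_def by (subst nn_integral_cmult[symmetric]) (simp_all add: mult.assoc)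
    finally show "ennreal (r powr - N * (1 + max (dist x y) (dist x z) / r) powr - (N + \<epsilon>)) * ennreal (norm (f x * g x - f y * g z))
      \<le> ennreal (real CARD('n)) * (\<integral>\<^sup>+s. U y z s \<partial>lborel)"
      by (simp only: M_def)
  qed
  also have "\<dots> = ennreal (real CARD('n)) * (\<integral>\<^sup>+y. (\<integral>\<^sup>+z. (\<integral>\<^sup>+s. U y z s \<partial>lborel) \<partial>lborel) \<partial>lborel)"
  proof -
    have m1: "(\<lambda>w. U (fst (fst w)) (snd (fst w)) (snd w)) \<in> borel_measurable ((borel \<Otimes>\<^sub>M borel) \<Otimes>\<^sub>M lborel)"
      unfolding U_def k_def M_def T1_def T2_def by measurable
    have m2: "(\<lambda>v. \<integral>\<^sup>+s. U (fst v) (snd v) s \<partial>lborel) \<in> borel_measurable (borel \<Otimes>\<^sub>M lborel)"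
      using lborel.borel_measurable_nn_integral_fst[OF m1] by simp
    have m3: "(\<lambda>z. \<integral>\<^sup>+s. U y z s \<partial>lborel) \<in> borel_measurable borel" for y
      using measurable_compose[OF _ m2, of "\<lambda>z. (y, z)" borel] by simp
    have m4: "(\<lambda>y. \<integral>\<^sup>+z. (\<integral>\<^sup>+s. U y z s \<partial>lborel) \<partial>lborel) \<in> borel_measurable borel"
      using lborel.borel_measurable_nn_integral_fst[OF m2] by simp
    show ?thesis
      using m3 m4 by (simp add: nn_integral_cmult)
  qed
  also have "(\<integral>\<^sup>+y. (\<integral>\<^sup>+z. (\<integral>\<^sup>+s. U y z s \<partial>lborel) \<partial>lborel) \<partial>lborel)
      = (\<integral>\<^sup>+s. (\<integral>\<^sup>+y. (\<integral>\<^sup>+z. U y z s \<partial>lborel) \<partial>lborel) \<partial>lborel)"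
    by (rule nn_integral_rotate) (unfold U_def k_def M_def T1_def T2_def, measurable)
  \<comment> \<open>After the change of variables the potentials no longer depend on
    \<open>s\<close>; what remains is the integral of \<open>s powr (\<delta> - 1)\<close>, that is
    \<open>1 / \<delta>\<close>.\<close>
  also have "\<dots> \<le> (\<integral>\<^sup>+s. (ennreal (s powr (\<delta> - 1)) * indicator {0<..1} s) * (?P1 + ?P2) \<partial>lborel)"
  proof (rule nn_integral_mono)
    fix s :: real
    show "(\<integral>\<^sup>+y. (\<integral>\<^sup>+z. U y z s \<partial>lborel) \<partial>lborel) \<le> (ennreal (s powr (\<delta> - 1)) * indicator {0<..1} s) * (?P1 + ?P2)"
    proof (cases "s \<in> {0<..1}")
      case True
      have m1: "(\<lambda>w. k (fst w) (snd w) * T1 s (fst w) (snd w)) \<in> borel_measurable (borel \<Otimes>\<^sub>M lborel)"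
        and m2: "(\<lambda>w. k (fst w) (snd w) * T2 s (fst w) (snd w)) \<in> borel_measurable (borel \<Otimes>\<^sub>M lborel)"
        unfolding k_def M_def T1_def T2_def by measurable
      have [measurable]: "(\<lambda>z. k y z * T1 s y z) \<in> borel_measurable borel"
          "(\<lambda>z. k y z * T2 s y z) \<in> borel_measurable borel" for y
        unfolding k_def M_def T1_def T2_def by measurable
      have [measurable]: "(\<lambda>y. \<integral>\<^sup>+z. k y z * T1 s y z \<partial>lborel) \<in> borel_measurable borel"
          "(\<lambda>y. \<integral>\<^sup>+z. k y z * T2 s y z \<partial>lborel) \<in> borel_measurable borel"
        using lborel.borel_measurable_nn_integral_fst[OF m1] lborel.borel_measurable_nn_integral_fst[OF m2] by simp_all
      have "(\<integral>\<^sup>+y. (\<integral>\<^sup>+z. U y z s \<partial>lborel) \<partial>lborel)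
          = (\<integral>\<^sup>+y. (\<integral>\<^sup>+z. k y z * T1 s y z \<partial>lborel) \<partial>lborel) + (\<integral>\<^sup>+y. (\<integral>\<^sup>+z. k y z * T2 s y z \<partial>lborel) \<partial>lborel)"
        using True by (simp add: U_def distrib_left nn_integral_add)
      also have "\<dots> \<le> ennreal (s powr (\<delta> - 1)) * ?P1 + ennreal (s powr (\<delta> - 1)) * ?P2"
        unfolding k_def M_def T1_def T2_def
        by (intro add_mono dilated_average_le[where 'a = "real ^ 'n", unfolded D]) (use True \<delta> r in auto)
      finally show ?thesis
        using True by (simp add: distrib_left)
    qed (simp add: U_def)
  qed
  also have "\<dots> = ennreal (1 / \<delta>) * (?P1 + ?P2)"
    using nn_integral_powr_unit_interval[OF \<delta>(1)] by (subst nn_integral_multc) auto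
  finally have "?L \<le> ennreal (real CARD('n)) * (ennreal (1 / \<delta>) * (?P1 + ?P2))"
    by (simp add: mult_left_mono)
  also have "\<dots> = ennreal (real CARD('n) / \<delta>) * (?P1 + ?P2)"
  proof -
    have "ennreal (real CARD('n) * (1 / \<delta>)) = ennreal (real CARD('n)) * ennreal (1 / \<delta>)"
      by (rule ennreal_mult) (use \<delta> in auto)
    then have "ennreal (real CARD('n)) * ennreal (1 / \<delta>) = ennreal (real CARD('n) / \<delta>)"
      by (simp only: times_divide_eq_right mult_1_right)
    then show ?thesis
      by (simp only: mult.assoc[symmetric])
  qed
  finally show ?thesis .
qed

lemma pointwise_potential_bound:
  fixes p :: "real \<Rightarrow> real ^ 'n \<Rightarrow> real ^ 'n \<Rightarrow> complex"
  assumes "0 < m" and \<epsilon>: "0 < \<epsilon>" and \<delta>: "0 < \<delta>" "\<delta> \<le> \<epsilon>" and p: "approx_identity m \<epsilon> p"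
  shows "\<exists>C\<ge>0. \<forall>r>0. \<forall>x f g. admissible \<epsilon> f g \<longrightarrow>
    ennreal (norm (f x * g x - kernel_op p (r powr m) f x * kernel_op p (r powr m) g x))
    \<le> ennreal C *
      (bilinear_potential \<epsilon> \<delta> r (\<lambda>y. ennreal (norm (gradient f y))) (\<lambda>y. ennreal (norm (g y))) x
       + bilinear_potential \<epsilon> \<delta> r (\<lambda>y. ennreal (norm (f y))) (\<lambda>y. ennreal (norm (gradient g y))) x)"
proof -
  define N where "N = 2 * real CARD('n)"
  have N: "0 < N"
    by (simp add: N_def)
  have "kernel_bounds m \<epsilon> p"
    using p by (simp add: approx_identity_def)
  from kernel_decay[OF this assms(1) \<epsilon>, folded N_def]
  obtain A where A: "0 \<le> A" and decay: "\<And>r x y. 0 < r \<Longrightarrow> norm (p (r powr m) x y)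
      \<le> A * (1 / r ^ CARD('n)) * (1 + dist x y / r) powr - (N + \<epsilon>)"
    by auto
  define C where "C = A * A * (real CARD('n) / \<delta>)"
  show ?thesis
  proof (intro exI[of _ C] conjI allI impI)
    show "0 \<le> C"
      using A \<delta> by (simp add: C_def)
  next
    fix r :: real and x :: "real ^ 'n" and f g :: "real ^ 'n \<Rightarrow> complex"
    assume r: "0 < r" and adm: "admissible \<epsilon> f g"
    have C1: "C1 f" "C1 g"
      using adm by (auto simp: admissible_def)
    note [measurable] = C1_borel[OF C1(1)] C1_borel[OF C1(2)]
    define P where "P = p (r powr m) x"
    have P1: "(LINT y|lebesgue. P y) = 1"
      using p r unfolding approx_identity_def P_def by simp
    then have P: "integrable lebesgue P"
      using not_integrable_integral_eq[of lebesgue P] by fastforce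
    then have [measurable]: "P \<in> borel_measurable lebesgue"
      by auto
    have P_le: "norm (P y) \<le> A * (1 / r ^ CARD('n)) * (1 + dist x y / r) powr - (N + \<epsilon>)" for y
      unfolding P_def using r by (rule decay)
    have fin: "(\<integral>\<^sup>+y. ennreal ((norm (f y) + norm (g y)) * (1 + norm y) powr - (N + \<epsilon>)) \<partial>lebesgue) < \<infinity>"
      using adm by (simp add: admissible_def N_def)
    have Pf: "integrable lebesgue (\<lambda>y. P y * f y)"
    proof (rule integrable_decaying_kernel_mult[OF _ _ _ r _ P_le])
      have "(\<integral>\<^sup>+y. ennreal (norm (f y) * (1 + norm y) powr - (N + \<epsilon>)) \<partial>lebesgue)
          \<le> (\<integral>\<^sup>+y. ennreal ((norm (f y) + norm (g y)) * (1 + norm y) powr - (N + \<epsilon>)) \<partial>lebesgue)"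
        by (intro nn_integral_mono ennreal_leI mult_right_mono) auto
      with fin show "(\<integral>\<^sup>+y. ennreal (norm (f y) * (1 + norm y) powr - (N + \<epsilon>)) \<partial>lebesgue) < \<infinity>"
        by (rule le_less_trans[rotated])
    qed (use N \<epsilon> A r in auto)
    have Pg: "integrable lebesgue (\<lambda>y. P y * g y)"
    proof (rule integrable_decaying_kernel_mult[OF _ _ _ r _ P_le])
      have "(\<integral>\<^sup>+y. ennreal (norm (g y) * (1 + norm y) powr - (N + \<epsilon>)) \<partial>lebesgue)
          \<le> (\<integral>\<^sup>+y. ennreal ((norm (f y) + norm (g y)) * (1 + norm y) powr - (N + \<epsilon>)) \<partial>lebesgue)"
        by (intro nn_integral_mono ennreal_leI mult_right_mono) auto
      with fin show "(\<integral>\<^sup>+y. ennreal (norm (g y) * (1 + norm y) powr - (N + \<epsilon>)) \<partial>lebesgue) < \<infinity>"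
        by (rule le_less_trans[rotated])
    qed (use N \<epsilon> A r in auto)
    define \<psi> where "\<psi> y z = r powr - N * (1 + max (dist x y) (dist x z) / r) powr - (N + \<epsilon>)" for y z
    have \<psi>: "0 \<le> \<psi> y z" for y z
      by (simp add: \<psi>_def)
    \<comment> \<open>The factor with the larger distance is kept and the other decay factor is
      bounded by 1. Thus the product decays in the maximum of both distances, with exponent
      exceeding the dimension \<open>N\<close> of the space of pairs.\<close>
    have PP_le: "norm (P y) * norm (P z) \<le> A * A * \<psi> y z" for y z
    proof -
      define a where "a = dist x y / r"
      define b where "b = dist x z / r"
      have ab: "0 \<le> a" "0 \<le> b" "max (dist x y) (dist x z) / r = max a b"
        using r by (auto simp: a_def b_def max_def divide_right_mono divide_le_cancel)
      have small: "(1 + u) powr - (N + \<epsilon>) \<le> 1" if "0 \<le> u" for u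
        using that N \<epsilon> powr_mono2'[of "- (N + \<epsilon>)" 1 "1 + u"] by simp
      have "norm (P y) * norm (P z) \<le> (A * (1 / r ^ CARD('n)) * (1 + a) powr - (N + \<epsilon>)) * (A * (1 / r ^ CARD('n)) * (1 + b) powr - (N + \<epsilon>))"
        unfolding a_def b_def using A r by (intro mult_mono P_le) auto
      also have "\<dots> = A * A * (1 / r ^ CARD('n) * (1 / r ^ CARD('n))) * ((1 + a) powr - (N + \<epsilon>) * (1 + b) powr - (N + \<epsilon>))"
        by (simp only: mult_ac)
      also have "1 / r ^ CARD('n) * (1 / r ^ CARD('n)) = r powr - N"
        using r by (simp add: N_def powr_minus powr_realpow[symmetric] powr_add[symmetric] field_simps)
      also have "A * A * r powr - N * ((1 + a) powr - (N + \<epsilon>) * (1 + b) powr - (N + \<epsilon>))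
          \<le> A * A * r powr - N * (1 + max a b) powr - (N + \<epsilon>)"
        using small[OF ab(1)] small[OF ab(2)] A
        by (intro mult_left_mono) (auto simp: max_def intro: mult_left_le mult_left_le_one_le)
      finally show ?thesis
        by (simp add: \<psi>_def ab(3) mult.assoc)
    qed
    have "ennreal (norm (f x * g x - kernel_op p (r powr m) f x * kernel_op p (r powr m) g x))
        \<le> (\<integral>\<^sup>+y. (\<integral>\<^sup>+z. ennreal (norm (P y) * norm (P z) * norm (f x * g x - f y * g z)) \<partial>lborel) \<partial>lborel)"
      using product_minus_averages_le[OF P P1 Pf Pg, of "f x * g x"]
      by (simp add: kernel_op_def P_def nn_integral_completion)
    also have "\<dots> \<le> (\<integral>\<^sup>+y. (\<integral>\<^sup>+z. ennreal (A * A) * (ennreal (\<psi> y z) * ennreal (norm (f x * g x - f y * g z))) \<partial>lborel) \<partial>lborel)"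
      using PP_le A \<psi> by (intro nn_integral_mono) (simp add: ennreal_mult[symmetric] ennreal_leI mult_right_mono mult.assoc[symmetric])
    also have "\<dots> = ennreal (A * A) * (\<integral>\<^sup>+y. (\<integral>\<^sup>+z. ennreal (\<psi> y z) * ennreal (norm (f x * g x - f y * g z)) \<partial>lborel) \<partial>lborel)"
    proof -
      have m1: "(\<lambda>w. ennreal (\<psi> (fst w) (snd w)) * ennreal (norm (f x * g x - f (fst w) * g (snd w)))) \<in> borel_measurable (borel \<Otimes>\<^sub>M lborel)"
        unfolding \<psi>_def by measurable
      have m2: "(\<lambda>z. ennreal (\<psi> y z) * ennreal (norm (f x * g x - f y * g z))) \<in> borel_measurable borel" for y
        unfolding \<psi>_def by measurable
      show ?thesis
        using m2 lborel.borel_measurable_nn_integral_fst[OF m1] by (simp add: nn_integral_cmult)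
    qed
    also have "\<dots> \<le> ennreal (A * A) * (ennreal (real CARD('n) / \<delta>) *
      (bilinear_potential \<epsilon> \<delta> r (\<lambda>y. ennreal (norm (gradient f y))) (\<lambda>y. ennreal (norm (g y))) x
       + bilinear_potential \<epsilon> \<delta> r (\<lambda>y. ennreal (norm (f y))) (\<lambda>y. ennreal (norm (gradient g y))) x))"
      unfolding \<psi>_def N_def
      by (intro mult_left_mono averaged_product_increment_le[OF C1 \<delta> r]) simp
    also have "\<dots> = ennreal C *
      (bilinear_potential \<epsilon> \<delta> r (\<lambda>y. ennreal (norm (gradient f y))) (\<lambda>y. ennreal (norm (g y))) x
       + bilinear_potential \<epsilon> \<delta> r (\<lambda>y. ennreal (norm (f y))) (\<lambda>y. ennreal (norm (gradient g y))) x)"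
      using A \<delta> by (simp only: C_def mult.assoc[symmetric]) (simp add: ennreal_mult[symmetric])
    finally show "ennreal (norm (f x * g x - kernel_op p (r powr m) f x * kernel_op p (r powr m) g x)) \<le> \<dots>" .
  qed
qed

subsection \<open>Dyadic decomposition of the potential\<close>

lemma dyadic_below:
  fixes \<rho> r :: real
  assumes "0 < \<rho>" "\<rho> < r"
  obtains j :: nat where "(1 / 2) ^ Suc j * r \<le> \<rho>" "\<rho> < (1 / 2) ^ j * r"
proof -
  obtain k where "(1 / 2) ^ k < \<rho> / r"
    using assms real_arch_pow_inv[of "\<rho> / r" "1 / 2"] by auto
  then have k: "(1 / 2) ^ k * r \<le> \<rho>"
    using assms by (simp add: pos_less_divide_eq less_imp_le)
  define j where "j = (LEAST k. (1 / 2) ^ k * r \<le> \<rho>)"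
  have j: "(1 / 2) ^ j * r \<le> \<rho>"
    unfolding j_def by (rule LeastI[of "\<lambda>k. (1 / 2) ^ k * r \<le> \<rho>", OF k])
  then have "j \<noteq> 0"
    using assms by (intro notI) simp
  then obtain i where i: "j = Suc i"
    using not0_implies_Suc by blast
  then have "\<not> (1 / 2) ^ i * r \<le> \<rho>"
    using not_less_Least[of i "\<lambda>k. (1 / 2) ^ k * r \<le> \<rho>"] by (simp add: j_def)
  with j i show ?thesis
    by (intro that[of i]) auto
qed

lemma dyadic_above:
  fixes \<rho> r :: real
  assumes "0 < r" "r \<le> \<rho>"
  obtains l :: nat where "2 ^ l * r \<le> \<rho>" "\<rho> < 2 ^ Suc l * r"
proof -
  obtain k where "\<rho> / r < 2 ^ k"
    using real_arch_pow[of 2 "\<rho> / r"] by auto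
  then have k: "\<rho> < 2 ^ k * r"
    using assms by (simp add: pos_divide_less_eq)
  define j where "j = (LEAST k. \<rho> < 2 ^ k * r)"
  have j: "\<rho> < 2 ^ j * r"
    unfolding j_def by (rule LeastI[of "\<lambda>k. \<rho> < 2 ^ k * r", OF k])
  then have "j \<noteq> 0"
    using assms by (intro notI) simp
  then obtain i where i: "j = Suc i"
    using not0_implies_Suc by blast
  then have "\<not> \<rho> < 2 ^ i * r"
    using not_less_Least[of i "\<lambda>k. \<rho> < 2 ^ k * r"] by (simp add: j_def)
  with j i show ?thesis
    by (intro that[of i]) auto
qed

text \<open>Here and in \<open>large_coeff\<close>, the value of the respective branch of the kernel
  at the inner radius of a dyadic shell, hence its maximum on that shell.\<close>

definition small_coeff :: "real \<Rightarrow> real \<Rightarrow> real \<Rightarrow> nat \<Rightarrow> real" where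
  "small_coeff N \<delta> r j = r powr \<delta> * ((1 / 2) ^ Suc j * r) powr (1 - N - \<delta>)"

definition large_coeff :: "real \<Rightarrow> real \<Rightarrow> real \<Rightarrow> nat \<Rightarrow> real" where
  "large_coeff N \<epsilon> r l = r powr \<epsilon> * (2 ^ l * r) powr (1 - N - \<epsilon>)"

text \<open>Every \<open>\<rho> > 0\<close> lies in one shell, and the term of that shell already
  dominates. The indicators are those of whole balls instead of shells, because only these factor in
  the two variables once \<open>\<rho>\<close> is a maximum.\<close>

lemma potential_kernel_dyadic_le:
  assumes "1 \<le> N" "0 < \<delta>" "0 < \<epsilon>" "0 < r" "0 \<le> \<rho>"
  shows "ennreal (potential_kernel N \<epsilon> \<delta> r \<rho>)
    \<le> (\<Sum>j. ennreal (small_coeff N \<delta> r j) * indicator {..<(1 / 2) ^ j * r} \<rho>)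
      + (\<Sum>l. ennreal (large_coeff N \<epsilon> r l) * indicator {..<2 ^ Suc l * r} \<rho>)" (is "_ \<le> suminf ?S + suminf ?L")
proof -
  have S: "?S j \<le> suminf ?S" and L: "?L j \<le> suminf ?L" for j
    by (rule ennreal_le_suminf)+
  consider "\<rho> = 0" | "0 < \<rho>" "\<rho> < r" | "r \<le> \<rho>"
    using assms by linarith
  then show ?thesis
  proof cases
    case 1
    then show ?thesis
      by (simp add: potential_kernel_def)
  next
    case 2
    obtain j where j: "(1 / 2) ^ Suc j * r \<le> \<rho>" "\<rho> < (1 / 2) ^ j * r"
      using dyadic_below[OF 2] by blast
    have "\<rho> powr (1 - N - \<delta>) \<le> ((1 / 2) ^ Suc j * r) powr (1 - N - \<delta>)"
      using assms j by (intro powr_mono2') auto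
    then have "ennreal (potential_kernel N \<epsilon> \<delta> r \<rho>) \<le> ?S j"
      using 2 j unfolding potential_kernel_def small_coeff_def by (simp add: ennreal_leI mult_left_mono)
    also have "\<dots> \<le> suminf ?S + suminf ?L"
      using S[of j] by (simp add: add_increasing2)
    finally show ?thesis .
  next
    case 3
    obtain l where l: "2 ^ l * r \<le> \<rho>" "\<rho> < 2 ^ Suc l * r"
      using dyadic_above[OF assms(4) 3] by blast
    have "\<rho> powr (1 - N - \<epsilon>) \<le> (2 ^ l * r) powr (1 - N - \<epsilon>)"
      using assms l by (intro powr_mono2') auto
    then have "ennreal (potential_kernel N \<epsilon> \<delta> r \<rho>) \<le> ?L l"
      using 3 l unfolding potential_kernel_def large_coeff_def by (simp add: ennreal_leI mult_left_mono)
    also have "\<dots> \<le> suminf ?S + suminf ?L"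
      using L[of l] by (simp add: add_increasing)
    finally show ?thesis .
  qed
qed

text \<open>The condition \<open>max (dist x y) (dist x z) < R\<close> is a product of two ball
  indicators, so each dyadic piece separates into a product of two integrals.\<close>

lemma bilinear_potential_dyadic_le:
  fixes F1 F2 :: "'a::euclidean_space \<Rightarrow> ennreal"
  assumes [measurable]: "F1 \<in> borel_measurable borel" "F2 \<in> borel_measurable borel"
    and "0 < \<delta>" "0 < \<epsilon>" "0 < r"
  defines "N \<equiv> 2 * real DIM('a)"
  shows "bilinear_potential \<epsilon> \<delta> r F1 F2 x
    \<le> (\<Sum>j. ennreal (small_coeff N \<delta> r j) *
          ((\<integral>\<^sup>+y\<in>ball x ((1 / 2) ^ j * r). F1 y \<partial>lborel) * (\<integral>\<^sup>+y\<in>ball x ((1 / 2) ^ j * r). F2 y \<partial>lborel)))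
      + (\<Sum>l. ennreal (large_coeff N \<epsilon> r l) *
          ((\<integral>\<^sup>+y\<in>ball x (2 ^ Suc l * r). F1 y \<partial>lborel) * (\<integral>\<^sup>+y\<in>ball x (2 ^ Suc l * r). F2 y \<partial>lborel)))"
proof -
  have sum_eq: "(\<integral>\<^sup>+y. (\<integral>\<^sup>+z. (\<Sum>j. ennreal (u j) * indicator {..<R j} (max (dist x y) (dist x z))) * (F1 y * F2 z) \<partial>lborel) \<partial>lborel)
      = (\<Sum>j. ennreal (u j) * ((\<integral>\<^sup>+y\<in>ball x (R j). F1 y \<partial>lborel) * (\<integral>\<^sup>+y\<in>ball x (R j). F2 y \<partial>lborel)))"
    for u R :: "nat \<Rightarrow> real"
  proof -
    have mF [measurable]: "(\<lambda>y. F1 y * indicator (ball x (R j)) y) \<in> borel_measurable borel"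
      "(\<lambda>y. F2 y * indicator (ball x (R j)) y) \<in> borel_measurable borel" for j
      by (intro borel_measurable_times_ennreal borel_measurable_indicator; simp)+
    have "(\<Sum>j. ennreal (u j) * indicator {..<R j} (max (dist x y) (dist x z))) * (F1 y * F2 z)
        = (\<Sum>j. (ennreal (u j) * (F1 y * indicator (ball x (R j)) y)) * (F2 z * indicator (ball x (R j)) z))" for y z
      unfolding ennreal_suminf_multc[symmetric]
      by (intro arg_cong[of _ _ suminf] ext) (auto simp: indicator_def mult_ac)
    then have "(\<integral>\<^sup>+y. (\<integral>\<^sup>+z. (\<Sum>j. ennreal (u j) * indicator {..<R j} (max (dist x y) (dist x z))) * (F1 y * F2 z) \<partial>lborel) \<partial>lborel)
        = (\<integral>\<^sup>+y. (\<integral>\<^sup>+z. (\<Sum>j. (ennreal (u j) * (F1 y * indicator (ball x (R j)) y)) * (F2 z * indicator (ball x (R j)) z)) \<partial>lborel) \<partial>lborel)"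
      by simp
    also have "\<dots> = (\<integral>\<^sup>+y. (\<Sum>j. (ennreal (u j) * (F1 y * indicator (ball x (R j)) y)) * (\<integral>\<^sup>+y\<in>ball x (R j). F2 y \<partial>lborel)) \<partial>lborel)"
      by (subst nn_integral_suminf) (simp_all add: nn_integral_cmult)
    also have "\<dots> = (\<Sum>j. ennreal (u j) * ((\<integral>\<^sup>+y\<in>ball x (R j). F1 y \<partial>lborel) * (\<integral>\<^sup>+y\<in>ball x (R j). F2 y \<partial>lborel)))"
      by (subst nn_integral_suminf, simp, simp add: nn_integral_cmult nn_integral_multc) (simp add: mult.assoc)
    finally show ?thesis .
  qed
  define KS where "KS \<rho> = (\<Sum>j. ennreal (small_coeff N \<delta> r j) * indicator {..<(1 / 2) ^ j * r} \<rho>)" for \<rho> :: real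
  define KL where "KL \<rho> = (\<Sum>l. ennreal (large_coeff N \<epsilon> r l) * indicator {..<2 ^ Suc l * r} \<rho>)" for \<rho> :: real
  have [measurable]: "KS \<in> borel_measurable borel" "KL \<in> borel_measurable borel"
    unfolding KS_def KL_def by measurable
  have N: "1 \<le> N"
    using DIM_ge_Suc0[where 'a = 'a] unfolding N_def by linarith
  have "bilinear_potential \<epsilon> \<delta> r F1 F2 x
      \<le> (\<integral>\<^sup>+y. (\<integral>\<^sup>+z. KS (max (dist x y) (dist x z)) * (F1 y * F2 z) + KL (max (dist x y) (dist x z)) * (F1 y * F2 z) \<partial>lborel) \<partial>lborel)"
    unfolding bilinear_potential_def N_def[symmetric] distrib_right[symmetric] KS_def KL_def
    using assms N by (intro nn_integral_mono mult_right_mono potential_kernel_dyadic_le) (auto simp: le_max_iff_disj)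
  also have "\<dots> = (\<integral>\<^sup>+y. (\<integral>\<^sup>+z. KS (max (dist x y) (dist x z)) * (F1 y * F2 z) \<partial>lborel) \<partial>lborel)
      + (\<integral>\<^sup>+y. (\<integral>\<^sup>+z. KL (max (dist x y) (dist x z)) * (F1 y * F2 z) \<partial>lborel) \<partial>lborel)"
  proof -
    have m: "(\<lambda>w. KS (max (dist x (fst w)) (dist x (snd w))) * (F1 (fst w) * F2 (snd w))) \<in> borel_measurable (borel \<Otimes>\<^sub>M lborel)"
       "(\<lambda>w. KL (max (dist x (fst w)) (dist x (snd w))) * (F1 (fst w) * F2 (snd w))) \<in> borel_measurable (borel \<Otimes>\<^sub>M lborel)"
      by measurable
    show ?thesis
      using lborel.borel_measurable_nn_integral_fst[OF m(1)] lborel.borel_measurable_nn_integral_fst[OF m(2)]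
      by (simp add: nn_integral_add)
  qed
  finally show ?thesis
    unfolding KS_def KL_def sum_eq .
qed

text \<open>The weights are only Lebesgue measurable, while the arguments with Tonelli use Borel
  functions and \<open>lborel\<close>. The identity is stated for arbitrary \<open>k\<close> so that
  it also covers integrands of unknown measurability.\<close>

lemma ex_borel_density:
  fixes h :: "'a::euclidean_space \<Rightarrow> ennreal"
  assumes "h \<in> borel_measurable lebesgue"
  shows "\<exists>h'\<in>borel_measurable borel. \<forall>k. (\<integral>\<^sup>+x. h x * k x \<partial>lebesgue) = (\<integral>\<^sup>+x. h' x * k x \<partial>lborel)"
proof -
  obtain h' where h': "h' \<in> borel_measurable lborel" "AE x in lborel. h x = h' x"
    using completion_ex_borel_measurable[OF assms] by blast
  have "(\<integral>\<^sup>+x. h x * k x \<partial>lebesgue) = (\<integral>\<^sup>+x. h' x * k x \<partial>lborel)" for k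
    unfolding nn_integral_completion by (rule nn_integral_cong_AE) (use h'(2) in auto)
  with h'(1) show ?thesis
    by auto
qed

subsection \<open>Weighted bounds for the potential\<close>

text \<open>\<open>W\<close>, \<open>V1\<close>, \<open>V2\<close> are Borel versions of the product
  weight and of the two weights. Of the relation between the exponents only two consequences are
  recorded: the inequality \<open>1 \<le> q / p1 + q / p2\<close> and the power of \<open>R\<close>
  in the bound on balls.\<close>

locale bilinear_weights =
  fixes W V1 V2 :: "'a::euclidean_space \<Rightarrow> ennreal" and p1 p2 q \<alpha> \<Theta> :: real
  assumes W_borel [measurable]: "W \<in> borel_measurable borel"
    and V_borel [measurable]: "V1 \<in> borel_measurable borel" "V2 \<in> borel_measurable borel"
    and exponents: "0 < p1" "0 < p2" "0 < q" "1 \<le> q / p1 + q / p2" "0 < \<alpha>" and \<Theta>: "0 \<le> \<Theta>"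
    and ball_bound: "\<And>c R (F1 :: 'a \<Rightarrow> real) (F2 :: 'a \<Rightarrow> real). 0 < R \<Longrightarrow> (\<And>x. 0 \<le> F1 x) \<Longrightarrow> (\<And>x. 0 \<le> F2 x) \<Longrightarrow>
      F1 \<in> borel_measurable borel \<Longrightarrow> F2 \<in> borel_measurable borel \<Longrightarrow>
      (\<integral>\<^sup>+x\<in>ball c R. W x \<partial>lborel)
        * (ennpow (\<integral>\<^sup>+x\<in>ball c R. ennreal (F1 x) \<partial>lborel) q * ennpow (\<integral>\<^sup>+x\<in>ball c R. ennreal (F2 x) \<partial>lborel) q)
      \<le> ennreal (\<Theta> * R powr (q * (2 * real DIM('a) - 1 + \<alpha>)))
        * (ennpow (\<integral>\<^sup>+x\<in>ball c R. ennreal (F1 x powr p1) * V1 x \<partial>lborel) (q / p1)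
          * ennpow (\<integral>\<^sup>+x\<in>ball c R. ennreal (F2 x powr p2) * V2 x \<partial>lborel) (q / p2))"
begin

definition "N = 2 * real DIM('a)"

text \<open>For \<open>x\<close> in \<open>ball c r\<close> and \<open>R \<le> r\<close> the inner
  balls stay in \<open>ball c (2 * r)\<close>, so cutting both functions off there changes nothing
  on the left and localizes the right side of \<open>single_scale_bound\<close>.\<close>

lemma single_scale_on_ball:
  fixes F1 F2 :: "'a \<Rightarrow> real"
  assumes F: "\<And>x. 0 \<le> F1 x" "\<And>x. 0 \<le> F2 x"
    and [measurable]: "F1 \<in> borel_measurable borel" "F2 \<in> borel_measurable borel"
    and R: "0 < R" "R \<le> r"
    and fin: "(\<integral>\<^sup>+x\<in>ball c (2 * r). ennreal (F1 x powr p1) * V1 x \<partial>lborel) < \<infinity>"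
      "(\<integral>\<^sup>+x\<in>ball c (2 * r). ennreal (F2 x powr p2) * V2 x \<partial>lborel) < \<infinity>"
  shows "(\<integral>\<^sup>+x\<in>ball c r. W x * ennpow ((\<integral>\<^sup>+y\<in>ball x R. ennreal (F1 y) \<partial>lborel) * (\<integral>\<^sup>+y\<in>ball x R. ennreal (F2 y) \<partial>lborel)) q \<partial>lborel)
    \<le> ennreal (\<Theta> * (2 * R) powr (q * (N - 1 + \<alpha>)) * (2 * 2 ^ DIM('a)))
      * (ennpow (\<integral>\<^sup>+x\<in>ball c (2 * r). ennreal (F1 x powr p1) * V1 x \<partial>lborel) (q / p1)
        * ennpow (\<integral>\<^sup>+x\<in>ball c (2 * r). ennreal (F2 x powr p2) * V2 x \<partial>lborel) (q / p2))"
proof -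
  define E where "E = ball c (2 * r)"
  define f1 where "f1 x = F1 x * indicator E x" for x
  define f2 where "f2 x = F2 x * indicator E x" for x
  have [measurable]: "E \<in> sets borel"
    by (simp add: E_def)
  have [measurable]: "f1 \<in> borel_measurable borel" "f2 \<in> borel_measurable borel"
    unfolding f1_def f2_def by (intro borel_measurable_times borel_measurable_indicator; simp)+
  have f: "0 \<le> f1 x" "0 \<le> f2 x" for x
    using F by (auto simp: f1_def f2_def)
  have H: "ennreal (f1 x powr p1) * V1 x = ennreal (F1 x powr p1) * V1 x * indicator E x"
      "ennreal (f2 x powr p2) * V2 x = ennreal (F2 x powr p2) * V2 x * indicator E x" for x
    using exponents by (auto simp: f1_def f2_def indicator_def)
  have "(\<integral>\<^sup>+x\<in>ball c r. W x * ennpow ((\<integral>\<^sup>+y\<in>ball x R. ennreal (F1 y) \<partial>lborel) * (\<integral>\<^sup>+y\<in>ball x R. ennreal (F2 y) \<partial>lborel)) q \<partial>lborel)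
      \<le> (\<integral>\<^sup>+x. W x * (ennpow (\<integral>\<^sup>+y\<in>ball x R. ennreal (f1 y) \<partial>lborel) q * ennpow (\<integral>\<^sup>+y\<in>ball x R. ennreal (f2 y) \<partial>lborel) q) \<partial>lborel)"
  proof (rule nn_integral_mono)
    fix x
    show "W x * ennpow ((\<integral>\<^sup>+y\<in>ball x R. ennreal (F1 y) \<partial>lborel) * (\<integral>\<^sup>+y\<in>ball x R. ennreal (F2 y) \<partial>lborel)) q * indicator (ball c r) x
      \<le> W x * (ennpow (\<integral>\<^sup>+y\<in>ball x R. ennreal (f1 y) \<partial>lborel) q * ennpow (\<integral>\<^sup>+y\<in>ball x R. ennreal (f2 y) \<partial>lborel) q)"
    proof (cases "x \<in> ball c r")
      case True
      have "ball x R \<subseteq> E"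
        using True R unfolding E_def by (intro subsetI) (smt (verit) dist_triangle mem_ball)
      then have "ennreal (F1 y) * indicator (ball x R) y = ennreal (f1 y) * indicator (ball x R) y"
          "ennreal (F2 y) * indicator (ball x R) y = ennreal (f2 y) * indicator (ball x R) y" for y
        by (auto simp: f1_def f2_def indicator_def)
      then show ?thesis
        using True exponents by (simp add: ennpow_mult)
    qed simp
  qed
  also have "\<dots> \<le> ennreal (\<Theta> * (2 * R) powr (q * (N - 1 + \<alpha>))) * ennreal (2 * 2 ^ DIM('a))
      * (ennpow (\<integral>\<^sup>+x. ennreal (f1 x powr p1) * V1 x \<partial>lborel) (q / p1)
        * ennpow (\<integral>\<^sup>+x. ennreal (f2 x powr p2) * V2 x \<partial>lborel) (q / p2))"
    by (rule single_scale_bound)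
      (use exponents R fin ball_bound[of "2 * R" f1 f2] f in \<open>auto simp: H E_def[symmetric] N_def\<close>)
  finally show ?thesis
    using \<Theta> by (simp only: H E_def[symmetric]) (simp add: ennreal_mult)
qed

text \<open>At scale \<open>R = (1 / 2) ^ j * r\<close> the kernel coefficient is of size
  \<open>r powr (\<alpha> / 2) * R powr (1 - N - \<alpha> / 2)\<close>. Multiplied by the
  single-scale constant \<open>R powr (N - 1 + \<alpha>)\<close> it leaves
  \<open>r powr \<alpha>\<close> times a power of 2 that decays like
  \<open>- j * \<alpha> / 2\<close>.\<close>

lemma small_scales_bound:
  "\<exists>C\<ge>0. \<forall>c r (F1 :: 'a \<Rightarrow> real) F2. 0 < r \<longrightarrow> (\<forall>x. 0 \<le> F1 x) \<longrightarrow> (\<forall>x. 0 \<le> F2 x) \<longrightarrow>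
    F1 \<in> borel_measurable borel \<longrightarrow> F2 \<in> borel_measurable borel \<longrightarrow>
    (\<integral>\<^sup>+x\<in>ball c (2 * r). ennreal (F1 x powr p1) * V1 x \<partial>lborel) < \<infinity> \<longrightarrow>
    (\<integral>\<^sup>+x\<in>ball c (2 * r). ennreal (F2 x powr p2) * V2 x \<partial>lborel) < \<infinity> \<longrightarrow>
    (\<integral>\<^sup>+x\<in>ball c r. W x * ennpow (\<Sum>j. ennreal (small_coeff N (\<alpha> / 2) r j) *
          ((\<integral>\<^sup>+y\<in>ball x ((1 / 2) ^ j * r). ennreal (F1 y) \<partial>lborel) * (\<integral>\<^sup>+y\<in>ball x ((1 / 2) ^ j * r). ennreal (F2 y) \<partial>lborel))) q \<partial>lborel)
    \<le> ennreal (C * (r powr \<alpha>) powr q)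
      * (ennpow (\<integral>\<^sup>+x\<in>ball c (2 * r). ennreal (F1 x powr p1) * V1 x \<partial>lborel) (q / p1)
        * ennpow (\<integral>\<^sup>+x\<in>ball c (2 * r). ennreal (F2 x powr p2) * V2 x \<partial>lborel) (q / p2))"
proof -
  \<comment> \<open>The available decay is \<open>\<kappa> ^ j * \<kappa> ^ j\<close>. One factor is
    consumed in taking the sum out of the power \<open>q\<close>; the other, raised to
    \<open>q\<close>, is the ratio \<open>k\<close> of the remaining geometric series.\<close>
  define \<kappa> where "\<kappa> = 2 powr (- \<alpha> / 4)"
  have \<kappa>: "0 < \<kappa>" "\<kappa> < 1"
    using exponents powr_less_mono[of "- \<alpha> / 4" 0 2] by (auto simp: \<kappa>_def)
  define k where "k = \<kappa> powr q"
  have k: "0 < k" "k < 1"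
    using \<kappa> exponents powr_less_mono2[of q \<kappa> 1] by (auto simp: k_def)
  define G where "G = (1 / (1 - \<kappa>)) powr q"
  \<comment> \<open>The power of 2 left over when the decay is removed: it stems from the inner
    radius in \<open>small_coeff\<close>, half the scale, and from the radius \<open>2 * R\<close>
    in the single-scale bound.\<close>
  define c0 where "c0 = 2 powr (2 * (N - 1) + 3 * \<alpha> / 2)"
  define B where "B = c0 powr q * (\<Theta> * (2 * 2 ^ DIM('a)))"
  have B: "0 \<le> B"
    using \<Theta> by (simp add: B_def)
  define C where "C = G * (B * (1 / (1 - k)))"
  show ?thesis
  proof (intro exI[of _ C] conjI allI impI)
    show "0 \<le> C"
      using k B by (simp add: C_def G_def)
  next
    fix c :: 'a and r :: real and F1 F2 :: "'a \<Rightarrow> real"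
    assume r: "0 < r" and F: "\<forall>x. 0 \<le> F1 x" "\<forall>x. 0 \<le> F2 x"
      and [measurable]: "F1 \<in> borel_measurable borel" "F2 \<in> borel_measurable borel"
      and fin: "(\<integral>\<^sup>+x\<in>ball c (2 * r). ennreal (F1 x powr p1) * V1 x \<partial>lborel) < \<infinity>"
        "(\<integral>\<^sup>+x\<in>ball c (2 * r). ennreal (F2 x powr p2) * V2 x \<partial>lborel) < \<infinity>"
    let ?T = "ennpow (\<integral>\<^sup>+x\<in>ball c (2 * r). ennreal (F1 x powr p1) * V1 x \<partial>lborel) (q / p1)
        * ennpow (\<integral>\<^sup>+x\<in>ball c (2 * r). ennreal (F2 x powr p2) * V2 x \<partial>lborel) (q / p2)"
    define u where "u = small_coeff N (\<alpha> / 2) r"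
    define v where "v j = u j * 2 powr (real j * (\<alpha> / 2))" for j
    have u: "0 < u j" and v: "0 < v j" for j
      using r by (auto simp: u_def v_def small_coeff_def)
    define J where "J j x = (\<integral>\<^sup>+y\<in>ball x ((1 / 2) ^ j * r). ennreal (F1 y) \<partial>lborel) * (\<integral>\<^sup>+y\<in>ball x ((1 / 2) ^ j * r). ennreal (F2 y) \<partial>lborel)" for j x
    have [measurable]: "J j \<in> borel_measurable borel" for j
      unfolding J_def by measurable
    have uv: "u j = \<kappa> ^ j * (\<kappa> ^ j * v j)" for j
    proof -
      have "\<kappa> ^ j * \<kappa> ^ j = 2 powr (- (real j * (\<alpha> / 2)))"
        by (simp add: \<kappa>_def powr_power powr_add[symmetric] field_simps)
      then show ?thesis
        by (simp add: v_def powr_minus field_simps)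
    qed
    have u_eq: "u j = r powr (1 - N) * 2 powr ((real j + 1) * (N - 1 + \<alpha> / 2))" for j
    proof -
      have "2 powr - real (Suc j) = inverse (2 ^ Suc j)"
        by (simp only: powr_minus) (simp only: powr_realpow[of 2] zero_less_numeral)
      also have "\<dots> = (1 / 2) ^ Suc j"
        by (simp add: power_one_over inverse_eq_divide)
      finally have "(1 / 2) ^ Suc j * r = r * 2 powr - (real j + 1)"
        by (simp add: add.commute)
      then have "u j = r powr (\<alpha> / 2) * (r powr (1 - N - \<alpha> / 2) * 2 powr ((real j + 1) * (N - 1 + \<alpha> / 2)))"
      proof -
        have "(real j + 1) * (N - 1 + \<alpha> / 2) = - (real j + 1) * (1 - N - \<alpha> / 2)"
          by (simp add: field_simps)
        then have "2 powr ((real j + 1) * (N - 1 + \<alpha> / 2)) = (2 powr - (real j + 1)) powr (1 - N - \<alpha> / 2)"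
          by (simp only: powr_powr)
        with \<open>(1 / 2) ^ Suc j * r = r * 2 powr - (real j + 1)\<close> r show ?thesis
          unfolding u_def small_coeff_def by (simp only: powr_mult)
      qed
      also have "\<dots> = r powr (\<alpha> / 2 + (1 - N - \<alpha> / 2)) * 2 powr ((real j + 1) * (N - 1 + \<alpha> / 2))"
        by (simp only: powr_add mult.assoc)
      finally show ?thesis
        by simp
    qed
    \<comment> \<open>The coefficient \<open>v j\<close>, stripped of its decay, cancels the
      single-scale constant for all \<open>j\<close> alike.\<close>
    have scale: "v j powr q * (2 * ((1 / 2) ^ j * r)) powr (q * (N - 1 + \<alpha>)) = c0 powr q * (r powr \<alpha>) powr q" for j
    proof -
      have "2 * ((1 / 2) ^ j * r) = r * 2 powr (1 - real j)"
        by (simp add: powr_diff powr_realpow power_divide divide_simps)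
      then have "(2 * ((1 / 2) ^ j * r)) powr (q * (N - 1 + \<alpha>)) = ((r * 2 powr (1 - real j)) powr (N - 1 + \<alpha>)) powr q"
        by (simp only: powr_powr mult.commute[of q])
      then have "v j powr q * (2 * ((1 / 2) ^ j * r)) powr (q * (N - 1 + \<alpha>))
          = (v j * (r * 2 powr (1 - real j)) powr (N - 1 + \<alpha>)) powr q"
        using v[of j] r by (simp add: powr_mult less_imp_le)
      also have "v j * (r * 2 powr (1 - real j)) powr (N - 1 + \<alpha>)
          = (r powr (1 - N) * r powr (N - 1 + \<alpha>)) * (2 powr ((real j + 1) * (N - 1 + \<alpha> / 2)) * 2 powr (real j * (\<alpha> / 2)) * 2 powr ((1 - real j) * (N - 1 + \<alpha>)))"
        using r by (simp add: v_def u_eq powr_mult powr_powr)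
      also have "\<dots> = r powr \<alpha> * c0"
      proof -
        have "(1 - N) + (N - 1 + \<alpha>) = \<alpha>"
          "(real j + 1) * (N - 1 + \<alpha> / 2) + real j * (\<alpha> / 2) + (1 - real j) * (N - 1 + \<alpha>) = 2 * (N - 1) + 3 * \<alpha> / 2"
          by (simp_all add: field_simps)
        then show ?thesis
          by (simp only: c0_def powr_add[symmetric])
      qed
      finally show ?thesis
        by (simp add: powr_mult c0_def mult.commute)
    qed
    have "(\<integral>\<^sup>+x\<in>ball c r. W x * ennpow (\<Sum>j. ennreal (u j) * J j x) q \<partial>lborel)
        \<le> (\<integral>\<^sup>+x. (\<Sum>j. ennreal (G * k ^ j * v j powr q) * (W x * ennpow (J j x) q * indicator (ball c r) x)) \<partial>lborel)"
    proof (rule nn_integral_mono)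
      fix x
      have "(\<Sum>j. ennreal (u j) * J j x) = (\<Sum>j. ennreal (\<kappa> ^ j) * (ennreal (\<kappa> ^ j) * (ennreal (v j) * J j x)))"
        using \<kappa> v by (simp add: uv ennreal_mult less_imp_le mult.assoc)
      then have "ennpow (\<Sum>j. ennreal (u j) * J j x) q \<le> ennreal G * (\<Sum>j. ennreal (k ^ j) * ennpow (ennreal (v j) * J j x) q)"
        using ennpow_geometric_suminf_le[OF exponents(3) \<kappa>] by (simp add: G_def k_def)
      also have "\<dots> = (\<Sum>j. ennreal (G * k ^ j * v j powr q) * ennpow (J j x) q)"
        using exponents v k unfolding ennreal_suminf_cmult[symmetric]
        by (simp add: ennpow_mult ennpow_ennreal ennreal_mult less_imp_le mult.assoc G_def)
      finally have "W x * ennpow (\<Sum>j. ennreal (u j) * J j x) q * indicator (ball c r) x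
          \<le> (W x * indicator (ball c r) x) * (\<Sum>j. ennreal (G * k ^ j * v j powr q) * ennpow (J j x) q)"
        by (simp add: mult.assoc mult.left_commute mult_left_mono mult.commute[of _ "indicator _ _"])
      also have "\<dots> = (\<Sum>j. ennreal (G * k ^ j * v j powr q) * (W x * ennpow (J j x) q * indicator (ball c r) x))"
        unfolding ennreal_suminf_cmult[symmetric] by (simp add: mult_ac)
      finally show "W x * ennpow (\<Sum>j. ennreal (u j) * J j x) q * indicator (ball c r) x \<le> \<dots>" .
    qed
    also have "\<dots> = (\<Sum>j. ennreal (G * k ^ j * v j powr q) * (\<integral>\<^sup>+x\<in>ball c r. W x * ennpow (J j x) q \<partial>lborel))"
    proof -
      have [measurable]: "(\<lambda>x. W x * ennpow (J j x) q * indicator (ball c r) x) \<in> borel_measurable borel" for j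
        by (intro borel_measurable_times_ennreal borel_measurable_indicator) measurable
      show ?thesis
        by (simp add: nn_integral_suminf nn_integral_cmult)
    qed
    also have "\<dots> \<le> (\<Sum>j. ennreal (G * k ^ j * (B * (r powr \<alpha>) powr q)) * ?T)"
    proof (intro suminf_le summableI)
      fix j :: nat
      have R: "0 < (1 / 2) ^ j * r" "(1 / 2) ^ j * r \<le> r"
        using r by (auto simp: power_le_one mult_left_le_one_le)
      have "(\<integral>\<^sup>+x\<in>ball c r. W x * ennpow (J j x) q \<partial>lborel)
          \<le> ennreal (\<Theta> * (2 * ((1 / 2) ^ j * r)) powr (q * (N - 1 + \<alpha>)) * (2 * 2 ^ DIM('a))) * ?T"
        unfolding J_def by (rule single_scale_on_ball) (use F R fin in auto)
      then have "ennreal (G * k ^ j * v j powr q) * (\<integral>\<^sup>+x\<in>ball c r. W x * ennpow (J j x) q \<partial>lborel)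
          \<le> ennreal (G * k ^ j * v j powr q) * (ennreal (\<Theta> * (2 * ((1 / 2) ^ j * r)) powr (q * (N - 1 + \<alpha>)) * (2 * 2 ^ DIM('a))) * ?T)"
        by (rule mult_left_mono) simp
      also have "\<dots> = ennreal (G * k ^ j * v j powr q * (\<Theta> * (2 * ((1 / 2) ^ j * r)) powr (q * (N - 1 + \<alpha>)) * (2 * 2 ^ DIM('a)))) * ?T"
        using k \<Theta> by (subst ennreal_mult) (auto simp: G_def mult.assoc)
      also have "G * k ^ j * v j powr q * (\<Theta> * (2 * ((1 / 2) ^ j * r)) powr (q * (N - 1 + \<alpha>)) * (2 * 2 ^ DIM('a)))
          = G * k ^ j * (\<Theta> * (2 * 2 ^ DIM('a))) * (v j powr q * (2 * ((1 / 2) ^ j * r)) powr (q * (N - 1 + \<alpha>)))"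
        by (simp only: mult_ac)
      also have "\<dots> = G * k ^ j * (B * (r powr \<alpha>) powr q)"
        unfolding scale B_def by (simp only: mult_ac)
      finally show "ennreal (G * k ^ j * v j powr q) * (\<integral>\<^sup>+x\<in>ball c r. W x * ennpow (J j x) q \<partial>lborel)
          \<le> ennreal (G * k ^ j * (B * (r powr \<alpha>) powr q)) * ?T" .
    qed
    also have "\<dots> = (\<Sum>j. ennreal (k ^ j * (G * (B * (r powr \<alpha>) powr q)))) * ?T"
      by (simp add: mult_ac)
    also have "(\<Sum>j. ennreal (k ^ j * (G * (B * (r powr \<alpha>) powr q)))) = ennreal ((1 / (1 - k)) * (G * (B * (r powr \<alpha>) powr q)))"
    proof (rule suminf_ennreal_eq)
      show "0 \<le> k ^ j * (G * (B * (r powr \<alpha>) powr q))" for j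
        using k B by (simp add: G_def)
      show "(\<lambda>j. k ^ j * (G * (B * (r powr \<alpha>) powr q))) sums (1 / (1 - k) * (G * (B * (r powr \<alpha>) powr q)))"
        using k by (intro sums_mult2 geometric_sums) auto
    qed
    also have "(1 / (1 - k)) * (G * (B * (r powr \<alpha>) powr q)) = C * (r powr \<alpha>) powr q"
      by (simp add: C_def)
    finally show "(\<integral>\<^sup>+x\<in>ball c r. W x * ennpow (\<Sum>j. ennreal (small_coeff N (\<alpha> / 2) r j) *
          ((\<integral>\<^sup>+y\<in>ball x ((1 / 2) ^ j * r). ennreal (F1 y) \<partial>lborel) * (\<integral>\<^sup>+y\<in>ball x ((1 / 2) ^ j * r). ennreal (F2 y) \<partial>lborel))) q \<partial>lborel)
        \<le> ennreal (C * (r powr \<alpha>) powr q) * ?T"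
      by (simp only: u_def J_def)
  qed
qed

end

section \<open>Large scales and the complete potential\<close>

text \<open>Absorbs an index shift: the large-scale pieces match the terms of the sum over dilates
  from index 1 on.\<close>

lemma suminf_Suc_le: "(\<Sum>l. f (Suc l)) \<le> suminf f" for f :: "nat \<Rightarrow> ennreal"
proof -
  have "(\<Sum>l<n. f (Suc l)) \<le> suminf f" for n
  proof -
    have "(\<Sum>l<n. f (Suc l)) \<le> sum f {..<Suc n}"
      unfolding sum.lessThan_Suc_shift by (simp add: add_increasing)
    also have "\<dots> \<le> suminf f"
      by (intro sum_le_suminf summableI) auto
    finally show ?thesis .
  qed
  then show ?thesis
    by (intro suminf_le_const summableI)
qed

lemma bilinear_potential_measurable [measurable]:
  fixes F1 F2 :: "'a::euclidean_space \<Rightarrow> ennreal"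
  assumes [measurable]: "F1 \<in> borel_measurable borel" "F2 \<in> borel_measurable borel"
  shows "bilinear_potential \<epsilon> \<delta> r F1 F2 \<in> borel_measurable borel"
proof -
  have "(\<lambda>w. ennreal (potential_kernel (2 * real DIM('a)) \<epsilon> \<delta> r (max (dist (fst (fst w)) (snd (fst w))) (dist (fst (fst w)) (snd w))))
      * (F1 (snd (fst w)) * F2 (snd w))) \<in> borel_measurable ((borel \<Otimes>\<^sub>M borel) \<Otimes>\<^sub>M lborel)"
    by measurable
  from lborel.borel_measurable_nn_integral_fst[OF this]
  have "(\<lambda>v. \<integral>\<^sup>+z. ennreal (potential_kernel (2 * real DIM('a)) \<epsilon> \<delta> r (max (dist (fst v) (snd v)) (dist (fst v) z)))
      * (F1 (snd v) * F2 z) \<partial>lborel) \<in> borel_measurable (borel \<Otimes>\<^sub>M lborel)"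
    by simp
  from lborel.borel_measurable_nn_integral_fst[OF this] show ?thesis
    unfolding bilinear_potential_def[abs_def] by simp
qed

text \<open>\<open>ennpow_sum_le\<close> is applied pointwise with exponent \<open>q\<close> and to
  the integrals with \<open>1 / q\<close>, hence the constant \<open>2 * 2 powr (1 / q)\<close>,
  valid for every positive \<open>q\<close>. Only monotonicity is applied to
  \<open>h\<close>.\<close>

lemma weighted_quasi_triangle:
  fixes W h h1 h2 :: "'a::euclidean_space \<Rightarrow> ennreal"
  assumes [measurable]: "W \<in> borel_measurable borel" "h1 \<in> borel_measurable borel" "h2 \<in> borel_measurable borel"
      and E: "E \<in> sets borel"
    and q: "0 < q" and a: "0 \<le> a" and le: "\<And>x. x \<in> E \<Longrightarrow> h x \<le> ennreal a * (h1 x + h2 x)"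
  shows "ennpow (\<integral>\<^sup>+x\<in>E. W x * ennpow (h x) q \<partial>lborel) (1 / q)
    \<le> ennreal (a * 2 * 2 powr (1 / q))
      * (ennpow (\<integral>\<^sup>+x\<in>E. W x * ennpow (h1 x) q \<partial>lborel) (1 / q) + ennpow (\<integral>\<^sup>+x\<in>E. W x * ennpow (h2 x) q \<partial>lborel) (1 / q))"
    (is "?L \<le> _ * (ennpow ?X _ + ennpow ?Y _)")
proof -
  have [measurable]: "(\<lambda>x. W x * ennpow (h1 x) q * indicator E x) \<in> borel_measurable borel"
      "(\<lambda>x. W x * ennpow (h2 x) q * indicator E x) \<in> borel_measurable borel"
    using E by (intro borel_measurable_times_ennreal borel_measurable_indicator; simp)+
  have "(\<integral>\<^sup>+x\<in>E. W x * ennpow (h x) q \<partial>lborel)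
      \<le> (\<integral>\<^sup>+x. ennreal ((a * 2) powr q) * (W x * ennpow (h1 x) q * indicator E x + W x * ennpow (h2 x) q * indicator E x) \<partial>lborel)"
  proof (rule nn_integral_mono)
    fix x
    show "W x * ennpow (h x) q * indicator E x
      \<le> ennreal ((a * 2) powr q) * (W x * ennpow (h1 x) q * indicator E x + W x * ennpow (h2 x) q * indicator E x)"
    proof (cases "x \<in> E")
      case True
      have "ennpow (h x) q \<le> ennpow (ennreal a * (h1 x + h2 x)) q"
        using q le[OF True] by (rule ennpow_mono)
      also have "\<dots> \<le> ennreal (a powr q) * (ennreal (2 powr q) * (ennpow (h1 x) q + ennpow (h2 x) q))"
        using q a by (simp add: ennpow_mult ennpow_ennreal mult_left_mono ennpow_sum_le)
      also have "\<dots> = ennreal ((a * 2) powr q) * (ennpow (h1 x) q + ennpow (h2 x) q)"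
        using a by (simp add: powr_mult mult.assoc[symmetric] ennreal_mult)
      finally have "W x * ennpow (h x) q \<le> W x * (ennreal ((a * 2) powr q) * (ennpow (h1 x) q + ennpow (h2 x) q))"
        by (rule mult_left_mono) simp
      also have "\<dots> = ennreal ((a * 2) powr q) * (W x * ennpow (h1 x) q + W x * ennpow (h2 x) q)"
        by (simp only: distrib_left mult.left_commute)
      finally show ?thesis
        using True by simp
    qed simp
  qed
  also have "\<dots> = ennreal ((a * 2) powr q) * (?X + ?Y)"
    by (simp add: nn_integral_cmult nn_integral_add)
  finally have "?L \<le> ennpow (ennreal ((a * 2) powr q) * (?X + ?Y)) (1 / q)"
    using q by (intro ennpow_mono) auto
  also have "\<dots> = ennreal (a * 2) * ennpow (?X + ?Y) (1 / q)"
    using q a by (simp add: ennpow_mult ennpow_ennreal powr_powr)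
  also have "\<dots> \<le> ennreal (a * 2) * (ennreal (2 powr (1 / q)) * (ennpow ?X (1 / q) + ennpow ?Y (1 / q)))"
    using q by (intro mult_left_mono ennpow_sum_le) auto
  also have "\<dots> = ennreal (a * 2 * 2 powr (1 / q)) * (ennpow ?X (1 / q) + ennpow ?Y (1 / q))"
    using a by (simp only: mult.assoc[symmetric] ennreal_mult[of "a * 2"] mult_nonneg_nonneg powr_ge_zero zero_le_numeral)
  finally show ?thesis .
qed

context bilinear_weights
begin

text \<open>One of the two products in the sum of the theorem, without the factor
  \<open>r powr \<alpha>\<close>.\<close>

definition dilates_sum :: "real \<Rightarrow> 'a \<Rightarrow> real \<Rightarrow> ('a \<Rightarrow> real) \<Rightarrow> ('a \<Rightarrow> real) \<Rightarrow> ennreal" where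
  "dilates_sum \<epsilon> c r F1 F2 = (\<Sum>l. ennreal (2 powr (- real l * (\<epsilon> - \<alpha>))) *
     (ennpow (\<integral>\<^sup>+x\<in>ball c (2 ^ (l + 1) * r). ennreal (F1 x powr p1) * V1 x \<partial>lborel) (1 / p1)
      * ennpow (\<integral>\<^sup>+x\<in>ball c (2 ^ (l + 1) * r). ennreal (F2 x powr p2) * V2 x \<partial>lborel) (1 / p2)))"

text \<open>These pieces no longer depend on the point of \<open>ball c r\<close>, so only the mass
  of \<open>W\<close> on this ball enters. Enlarging that mass to the ball of radius
  \<open>R = 2 ^ (l + 2) * r\<close> allows \<open>ball_bound\<close> to be used at radius
  \<open>R\<close>.\<close>

lemma large_scales_bound:
  fixes F1 F2 :: "'a \<Rightarrow> real"
  assumes F: "\<And>x. 0 \<le> F1 x" "\<And>x. 0 \<le> F2 x"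
    and [measurable]: "F1 \<in> borel_measurable borel" "F2 \<in> borel_measurable borel"
    and r: "0 < r"
  shows "ennpow (\<integral>\<^sup>+x\<in>ball c r. W x \<partial>lborel) (1 / q) * (\<Sum>l. ennreal (large_coeff N \<epsilon> r l) *
      ((\<integral>\<^sup>+y\<in>ball c (2 ^ (l + 2) * r). ennreal (F1 y) \<partial>lborel) * (\<integral>\<^sup>+y\<in>ball c (2 ^ (l + 2) * r). ennreal (F2 y) \<partial>lborel)))
    \<le> ennreal (\<Theta> powr (1 / q) * 2 powr (\<epsilon> - \<alpha> + 2 * (N - 1 + \<alpha>)) * r powr \<alpha>) * dilates_sum \<epsilon> c r F1 F2"
proof -
  \<comment> \<open>With \<open>R = 4 * 2 ^ l * r\<close> the power
    \<open>R powr (N - 1 + \<alpha>)\<close> contributes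
    \<open>2 powr (2 * (N - 1 + \<alpha>))\<close>; the shift from \<open>l\<close> to
    \<open>Suc l\<close> in the decay contributes
    \<open>2 powr (\<epsilon> - \<alpha>)\<close>.\<close>
  define C where "C = \<Theta> powr (1 / q) * 2 powr (\<epsilon> - \<alpha> + 2 * (N - 1 + \<alpha>)) * r powr \<alpha>"
  define e where "e = N - 1 + \<alpha>"
  let ?W = "ennpow (\<integral>\<^sup>+x\<in>ball c r. W x \<partial>lborel) (1 / q)"
  let ?I1 = "\<lambda>l. \<integral>\<^sup>+y\<in>ball c (2 ^ (l + 2) * r). ennreal (F1 y) \<partial>lborel"
  let ?I2 = "\<lambda>l. \<integral>\<^sup>+y\<in>ball c (2 ^ (l + 2) * r). ennreal (F2 y) \<partial>lborel"
  define T where "T l = ennpow (\<integral>\<^sup>+x\<in>ball c (2 ^ (l + 1) * r). ennreal (F1 x powr p1) * V1 x \<partial>lborel) (1 / p1)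
      * ennpow (\<integral>\<^sup>+x\<in>ball c (2 ^ (l + 1) * r). ennreal (F2 x powr p2) * V2 x \<partial>lborel) (1 / p2)" for l :: nat
  have term_le: "?W * (ennreal (large_coeff N \<epsilon> r l) * (?I1 l * ?I2 l))
      \<le> ennreal C * (ennreal (2 powr (- real (Suc l) * (\<epsilon> - \<alpha>))) * T (Suc l))" for l
  proof -
    define R where "R = 2 ^ (l + 2) * r"
    have R: "0 < R" "r \<le> R"
      using r mult_right_mono[OF one_le_power[of "2 :: real" "l + 2"], of r] by (simp_all add: R_def)
    have R_eq: "R = 2 powr (real l + 2) * r" "2 ^ l * r = 2 powr real l * r"
      by (simp_all add: R_def powr_add powr_realpow)
    let ?WR = "\<integral>\<^sup>+x\<in>ball c R. W x \<partial>lborel"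
    have "?W * (?I1 l * ?I2 l) \<le> ennpow ?WR (1 / q) * (?I1 l * ?I2 l)"
      using R exponents by (intro mult_right_mono ennpow_mono nn_integral_mono) (auto simp: indicator_def)
    also have "\<dots> = ennpow (?WR * (ennpow (?I1 l) q * ennpow (?I2 l) q)) (1 / q)"
      using exponents by (simp add: ennpow_mult ennpow_ennpow)
    also have "\<dots> \<le> ennpow (ennreal (\<Theta> * R powr (q * (2 * real DIM('a) - 1 + \<alpha>)))
        * (ennpow (\<integral>\<^sup>+x\<in>ball c R. ennreal (F1 x powr p1) * V1 x \<partial>lborel) (q / p1)
          * ennpow (\<integral>\<^sup>+x\<in>ball c R. ennreal (F2 x powr p2) * V2 x \<partial>lborel) (q / p2))) (1 / q)"
      unfolding R_def[symmetric] using exponents R F by (intro ennpow_mono ball_bound) auto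
    also have "\<dots> = ennreal ((\<Theta> * R powr (q * (2 * real DIM('a) - 1 + \<alpha>))) powr (1 / q)) * T (Suc l)"
      using exponents \<Theta> by (simp add: ennpow_mult ennpow_ennpow ennpow_ennreal T_def R_def mult.assoc)
    also have "(\<Theta> * R powr (q * (2 * real DIM('a) - 1 + \<alpha>))) powr (1 / q) = \<Theta> powr (1 / q) * R powr e"
      using exponents by (simp add: powr_mult powr_powr e_def N_def)
    finally have "ennreal (large_coeff N \<epsilon> r l) * (?W * (?I1 l * ?I2 l))
        \<le> ennreal (large_coeff N \<epsilon> r l) * (ennreal (\<Theta> powr (1 / q) * R powr e) * T (Suc l))"
      by (rule mult_left_mono) simp
    also have "\<dots> = ennreal (large_coeff N \<epsilon> r l * (\<Theta> powr (1 / q) * R powr e)) * T (Suc l)"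
      by (subst ennreal_mult) (auto simp: large_coeff_def mult.assoc)
    also have "large_coeff N \<epsilon> r l * (\<Theta> powr (1 / q) * R powr e)
        = \<Theta> powr (1 / q) * ((2 powr (real l * (1 - N - \<epsilon>)) * 2 powr ((real l + 2) * e)) * (r powr \<epsilon> * r powr (1 - N - \<epsilon>) * r powr e))"
      unfolding large_coeff_def R_eq by (simp add: powr_mult powr_powr mult_ac)
    also have "\<dots> = C * 2 powr (- real (Suc l) * (\<epsilon> - \<alpha>))"
    proof -
      have "2 powr (real l * (1 - N - \<epsilon>)) * 2 powr ((real l + 2) * e)
          = 2 powr (\<epsilon> - \<alpha> + 2 * (N - 1 + \<alpha>)) * 2 powr (- real (Suc l) * (\<epsilon> - \<alpha>))"
        unfolding powr_add[symmetric] by (rule arg_cong[of _ _ "\<lambda>s. 2 powr s"]) (simp add: e_def algebra_simps)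
      moreover have "r powr \<epsilon> * r powr (1 - N - \<epsilon>) * r powr e = r powr \<alpha>"
        unfolding powr_add[symmetric] by (simp add: e_def)
      ultimately show ?thesis
        by (simp only: C_def mult_ac)
    qed
    also have "ennreal (C * 2 powr (- real (Suc l) * (\<epsilon> - \<alpha>))) * T (Suc l)
        = ennreal C * (ennreal (2 powr (- real (Suc l) * (\<epsilon> - \<alpha>))) * T (Suc l))"
      by (subst ennreal_mult) (auto simp: C_def mult.assoc)
    finally show ?thesis
      by (simp only: mult.left_commute)
  qed
  have "?W * (\<Sum>l. ennreal (large_coeff N \<epsilon> r l) * (?I1 l * ?I2 l))
      = (\<Sum>l. ?W * (ennreal (large_coeff N \<epsilon> r l) * (?I1 l * ?I2 l)))"
    by (rule ennreal_suminf_cmult[symmetric])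
  also have "\<dots> \<le> (\<Sum>l. ennreal C * (ennreal (2 powr (- real (Suc l) * (\<epsilon> - \<alpha>))) * T (Suc l)))"
    by (intro suminf_le summableI term_le)
  also have "\<dots> = ennreal C * (\<Sum>l. ennreal (2 powr (- real (Suc l) * (\<epsilon> - \<alpha>))) * T (Suc l))"
    by (rule ennreal_suminf_cmult)
  also have "\<dots> \<le> ennreal C * dilates_sum \<epsilon> c r F1 F2"
    unfolding dilates_sum_def T_def[symmetric]
    by (intro mult_left_mono suminf_Suc_le[of "\<lambda>l. ennreal (2 powr (- real l * (\<epsilon> - \<alpha>))) * T l"]) simp
  finally show ?thesis
    by (simp only: C_def)
qed

text \<open>The small scales are charged to the term \<open>l = 0\<close> of
  \<open>dilates_sum\<close>, whose ball has radius \<open>2 * r\<close>, and the large scales to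
  the later terms.\<close>

lemma bilinear_potential_bound:
  assumes \<epsilon>: "0 < \<epsilon>"
  shows "\<exists>C\<ge>0. \<forall>c r (F1 :: 'a \<Rightarrow> real) F2. 0 < r \<longrightarrow> (\<forall>x. 0 \<le> F1 x) \<longrightarrow> (\<forall>x. 0 \<le> F2 x) \<longrightarrow>
    F1 \<in> borel_measurable borel \<longrightarrow> F2 \<in> borel_measurable borel \<longrightarrow>
    (\<integral>\<^sup>+x\<in>ball c (2 * r). ennreal (F1 x powr p1) * V1 x \<partial>lborel) < \<infinity> \<longrightarrow>
    (\<integral>\<^sup>+x\<in>ball c (2 * r). ennreal (F2 x powr p2) * V2 x \<partial>lborel) < \<infinity> \<longrightarrow>
    ennpow (\<integral>\<^sup>+x\<in>ball c r. W x * ennpow (bilinear_potential \<epsilon> (\<alpha> / 2) r (\<lambda>y. ennreal (F1 y)) (\<lambda>y. ennreal (F2 y)) x) q \<partial>lborel) (1 / q)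
    \<le> ennreal (C * r powr \<alpha>) * dilates_sum \<epsilon> c r F1 F2"
proof -
  obtain C1 where C1: "0 \<le> C1" and small: "\<And>c r (F1 :: 'a \<Rightarrow> real) F2. 0 < r \<Longrightarrow> \<forall>x. 0 \<le> F1 x \<Longrightarrow> \<forall>x. 0 \<le> F2 x \<Longrightarrow>
    F1 \<in> borel_measurable borel \<Longrightarrow> F2 \<in> borel_measurable borel \<Longrightarrow>
    (\<integral>\<^sup>+x\<in>ball c (2 * r). ennreal (F1 x powr p1) * V1 x \<partial>lborel) < \<infinity> \<Longrightarrow>
    (\<integral>\<^sup>+x\<in>ball c (2 * r). ennreal (F2 x powr p2) * V2 x \<partial>lborel) < \<infinity> \<Longrightarrow>
    (\<integral>\<^sup>+x\<in>ball c r. W x * ennpow (\<Sum>j. ennreal (small_coeff N (\<alpha> / 2) r j) *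
          ((\<integral>\<^sup>+y\<in>ball x ((1 / 2) ^ j * r). ennreal (F1 y) \<partial>lborel) * (\<integral>\<^sup>+y\<in>ball x ((1 / 2) ^ j * r). ennreal (F2 y) \<partial>lborel))) q \<partial>lborel)
    \<le> ennreal (C1 * (r powr \<alpha>) powr q)
      * (ennpow (\<integral>\<^sup>+x\<in>ball c (2 * r). ennreal (F1 x powr p1) * V1 x \<partial>lborel) (q / p1)
        * ennpow (\<integral>\<^sup>+x\<in>ball c (2 * r). ennreal (F2 x powr p2) * V2 x \<partial>lborel) (q / p2))"
    using small_scales_bound by auto
  define C2 where "C2 = \<Theta> powr (1 / q) * 2 powr (\<epsilon> - \<alpha> + 2 * (N - 1 + \<alpha>))"
  define C where "C = 2 * 2 powr (1 / q) * (C1 powr (1 / q) + C2)"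
  show ?thesis
  proof (intro exI[of _ C] conjI allI impI)
    show "0 \<le> C"
      by (simp add: C_def C2_def)
  next
    fix c :: 'a and r :: real and F1 F2 :: "'a \<Rightarrow> real"
    assume r: "0 < r" and F: "\<forall>x. 0 \<le> F1 x" "\<forall>x. 0 \<le> F2 x"
      and F_borel [measurable]: "F1 \<in> borel_measurable borel" "F2 \<in> borel_measurable borel"
      and fin: "(\<integral>\<^sup>+x\<in>ball c (2 * r). ennreal (F1 x powr p1) * V1 x \<partial>lborel) < \<infinity>"
        "(\<integral>\<^sup>+x\<in>ball c (2 * r). ennreal (F2 x powr p2) * V2 x \<partial>lborel) < \<infinity>"
    let ?D = "dilates_sum \<epsilon> c r F1 F2"
    define U where "U x = (\<Sum>j. ennreal (small_coeff N (\<alpha> / 2) r j) *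
          ((\<integral>\<^sup>+y\<in>ball x ((1 / 2) ^ j * r). ennreal (F1 y) \<partial>lborel) * (\<integral>\<^sup>+y\<in>ball x ((1 / 2) ^ j * r). ennreal (F2 y) \<partial>lborel)))" for x
    define S where "S = (\<Sum>l. ennreal (large_coeff N \<epsilon> r l) *
          ((\<integral>\<^sup>+y\<in>ball c (2 ^ (l + 2) * r). ennreal (F1 y) \<partial>lborel) * (\<integral>\<^sup>+y\<in>ball c (2 ^ (l + 2) * r). ennreal (F2 y) \<partial>lborel)))"
    have [measurable]: "U \<in> borel_measurable borel"
      unfolding U_def by measurable
    have pointwise: "bilinear_potential \<epsilon> (\<alpha> / 2) r (\<lambda>y. ennreal (F1 y)) (\<lambda>y. ennreal (F2 y)) x \<le> ennreal 1 * (U x + S)"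
      if x: "x \<in> ball c r" for x
    proof -
      \<comment> \<open>Recentring from \<open>x\<close> to \<open>c\<close> adds at most
        \<open>r\<close> to the radius; doubling it leaves room even at
        \<open>l = 0\<close>.\<close>
      have sub: "dist c y < 4 * 2 ^ l * r" if "dist x y < 2 * 2 ^ l * r" for l y
      proof -
        have "dist c y < r + 2 * 2 ^ l * r"
          using x that dist_triangle[of c y x] by simp
        also have "\<dots> \<le> 4 * 2 ^ l * r"
        proof -
          have "1 \<le> (2 :: real) ^ l"
            by simp
          then have "1 \<le> 2 * (2 :: real) ^ l"
            by linarith
          then have "r \<le> 2 * 2 ^ l * r"
            using r by simp
          then show ?thesis
            by linarith
        qed
        finally show ?thesis .
      qed
      have "bilinear_potential \<epsilon> (\<alpha> / 2) r (\<lambda>y. ennreal (F1 y)) (\<lambda>y. ennreal (F2 y)) x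
        \<le> U x + (\<Sum>l. ennreal (large_coeff N \<epsilon> r l) *
          ((\<integral>\<^sup>+y\<in>ball x (2 ^ Suc l * r). ennreal (F1 y) \<partial>lborel) * (\<integral>\<^sup>+y\<in>ball x (2 ^ Suc l * r). ennreal (F2 y) \<partial>lborel)))"
        unfolding U_def N_def by (rule bilinear_potential_dyadic_le) (use exponents \<epsilon> r in auto)
      also have "\<dots> \<le> U x + S"
        unfolding S_def
        by (intro add_left_mono suminf_le summableI mult_left_mono mult_mono nn_integral_mono)
          (auto simp: indicator_def sub)
      finally show ?thesis
        by simp
    qed
    have "ennpow (\<integral>\<^sup>+x\<in>ball c r. W x * ennpow (bilinear_potential \<epsilon> (\<alpha> / 2) r (\<lambda>y. ennreal (F1 y)) (\<lambda>y. ennreal (F2 y)) x) q \<partial>lborel) (1 / q)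
      \<le> ennreal (1 * 2 * 2 powr (1 / q)) * (ennpow (\<integral>\<^sup>+x\<in>ball c r. W x * ennpow (U x) q \<partial>lborel) (1 / q)
          + ennpow (\<integral>\<^sup>+x\<in>ball c r. W x * ennpow S q \<partial>lborel) (1 / q))"
      by (rule weighted_quasi_triangle) (use exponents pointwise in auto)
    also have "\<dots> \<le> ennreal (1 * 2 * 2 powr (1 / q)) * (ennreal (C1 powr (1 / q) * r powr \<alpha>) * ?D + ennreal (C2 * r powr \<alpha>) * ?D)"
    proof (intro mult_left_mono add_mono)
      let ?H1 = "\<integral>\<^sup>+x\<in>ball c (2 * r). ennreal (F1 x powr p1) * V1 x \<partial>lborel"
      let ?H2 = "\<integral>\<^sup>+x\<in>ball c (2 * r). ennreal (F2 x powr p2) * V2 x \<partial>lborel"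
      have "ennpow (\<integral>\<^sup>+x\<in>ball c r. W x * ennpow (U x) q \<partial>lborel) (1 / q)
          \<le> ennpow (ennreal (C1 * (r powr \<alpha>) powr q) * (ennpow ?H1 (q / p1) * ennpow ?H2 (q / p2))) (1 / q)"
        unfolding U_def using exponents by (intro ennpow_mono small[OF r F F_borel fin]) auto
      also have "\<dots> = ennreal (C1 powr (1 / q) * r powr \<alpha>) * (ennpow ?H1 (1 / p1) * ennpow ?H2 (1 / p2))"
        using exponents C1 by (simp add: ennpow_mult ennpow_ennpow ennpow_ennreal powr_mult powr_powr)
      also have "\<dots> \<le> ennreal (C1 powr (1 / q) * r powr \<alpha>) * ?D"
      proof (rule mult_left_mono)
        show "ennpow ?H1 (1 / p1) * ennpow ?H2 (1 / p2) \<le> ?D"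
          unfolding dilates_sum_def by (rule order_trans[OF _ ennreal_le_suminf[where j = 0]]) simp
      qed simp
      finally show "ennpow (\<integral>\<^sup>+x\<in>ball c r. W x * ennpow (U x) q \<partial>lborel) (1 / q) \<le> ennreal (C1 powr (1 / q) * r powr \<alpha>) * ?D" .
      have "(\<integral>\<^sup>+x\<in>ball c r. W x * ennpow S q \<partial>lborel) = (\<integral>\<^sup>+x. (W x * indicator (ball c r) x) * ennpow S q \<partial>lborel)"
        by (simp only: mult_ac)
      also have "\<dots> = (\<integral>\<^sup>+x\<in>ball c r. W x \<partial>lborel) * ennpow S q"
        by (rule nn_integral_multc) (auto intro!: borel_measurable_times_ennreal borel_measurable_indicator)
      finally have "ennpow (\<integral>\<^sup>+x\<in>ball c r. W x * ennpow S q \<partial>lborel) (1 / q) = ennpow (\<integral>\<^sup>+x\<in>ball c r. W x \<partial>lborel) (1 / q) * S"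
        using exponents by (simp add: ennpow_mult ennpow_ennpow)
      also have "\<dots> \<le> ennreal (C2 * r powr \<alpha>) * ?D"
        unfolding S_def C2_def using F r by (intro large_scales_bound) auto
      finally show "ennpow (\<integral>\<^sup>+x\<in>ball c r. W x * ennpow S q \<partial>lborel) (1 / q) \<le> ennreal (C2 * r powr \<alpha>) * ?D" .
    qed simp
    also have "\<dots> = ennreal (C * r powr \<alpha>) * ?D"
    proof -
      have "C * r powr \<alpha> = (1 * 2 * 2 powr (1 / q)) * (C1 powr (1 / q) * r powr \<alpha> + C2 * r powr \<alpha>)"
        by (simp add: C_def algebra_simps)
      then have "ennreal (C * r powr \<alpha>) = ennreal (1 * 2 * 2 powr (1 / q)) * (ennreal (C1 powr (1 / q) * r powr \<alpha>) + ennreal (C2 * r powr \<alpha>))"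
        by (simp only:) (subst ennreal_mult; simp add: C2_def)
      then show ?thesis
        by (simp only: distrib_right distrib_left mult.assoc)
    qed
    finally show "ennpow (\<integral>\<^sup>+x\<in>ball c r. W x * ennpow (bilinear_potential \<epsilon> (\<alpha> / 2) r (\<lambda>y. ennreal (F1 y)) (\<lambda>y. ennreal (F2 y)) x) q \<partial>lborel) (1 / q)
      \<le> ennreal (C * r powr \<alpha>) * ?D" .
  qed
qed

end

section \<open>Local integrability of the weights and conclusion\<close>

lemma weight_borel:
  fixes w :: "'a::euclidean_space \<Rightarrow> real"
  assumes "weight w"
  shows "w \<in> borel_measurable lebesgue"
proof (rule borel_measurable_LIMSEQ_metric)
  fix i :: nat
  have "w absolutely_integrable_on cball 0 (real i)"
    using assms by (simp add: weight_def)
  then have "integrable lebesgue (\<lambda>x. indicator (cball 0 (real i)) x *\<^sub>R w x)"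
    by (simp add: set_integrable_def)
  then show "(\<lambda>x. indicator (cball 0 (real i)) x *\<^sub>R w x) \<in> borel_measurable lebesgue"
    by (rule borel_measurable_integrable)
next
  fix x :: 'a
  obtain k :: nat where "norm x \<le> real k"
    using real_arch_simple by blast
  then show "(\<lambda>i. indicator (cball 0 (real i)) x *\<^sub>R w x) \<longlonglongrightarrow> w x"
    by (intro tendsto_eventually eventually_sequentiallyI[of k]) (auto simp: indicator_def)
qed

text \<open>Supplies the finiteness that the small scales require: a continuous function is bounded
  on the closed ball, where the weight is integrable.\<close>

lemma weighted_integral_finite:
  fixes w F :: "'a::euclidean_space \<Rightarrow> real"
  assumes w: "weight w" and F: "continuous_on UNIV F" "\<And>x. 0 \<le> F x" and p: "0 < p"
  shows "(\<integral>\<^sup>+x\<in>ball c R. ennreal (F x powr p * w x) \<partial>lebesgue) < \<infinity>"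
proof -
  have "compact (F ` cball c R)"
    by (intro compact_continuous_image continuous_on_subset[OF F(1)]) auto
  then have "bounded (F ` cball c R)"
    by (rule compact_imp_bounded)
  then obtain b where b: "\<forall>x\<in>cball c R. \<bar>F x\<bar> \<le> b"
    unfolding bounded_iff by auto
  have nonneg: "0 \<le> w x" for x
    using w by (simp add: weight_def)
  have "w absolutely_integrable_on cball c R"
    using w by (simp add: weight_def)
  then have int: "integrable lebesgue (\<lambda>x. indicator (cball c R) x *\<^sub>R w x)"
    by (simp add: set_integrable_def)
  have "(\<integral>\<^sup>+x\<in>ball c R. ennreal (F x powr p * w x) \<partial>lebesgue)
      \<le> (\<integral>\<^sup>+x. ennreal (b powr p) * ennreal (norm (indicator (cball c R) x *\<^sub>R w x)) \<partial>lebesgue)"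
  proof (rule nn_integral_mono)
    fix x
    show "ennreal (F x powr p * w x) * indicator (ball c R) x \<le> ennreal (b powr p) * ennreal (norm (indicator (cball c R) x *\<^sub>R w x))"
    proof (cases "x \<in> ball c R")
      case True
      have "F x powr p * w x \<le> b powr p * w x"
        using True bspec[OF b, of x] F(2)[of x] p nonneg[of x] by (intro mult_right_mono powr_mono2) auto
      then show ?thesis
        using True nonneg[of x] by (simp add: ennreal_mult[symmetric] ennreal_leI)
    qed simp
  qed
  also have "\<dots> = ennreal (b powr p) * (\<integral>\<^sup>+x. ennreal (norm (indicator (cball c R) x *\<^sub>R w x)) \<partial>lebesgue)"
    by (intro nn_integral_cmult measurable_compose[OF borel_measurable_integrable[OF int]]) measurable
  also have "\<dots> < \<infinity>"
    using int unfolding integrable_iff_bounded by (simp add: ennreal_mult_less_top)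
  finally show ?thesis .
qed

theorem theorem4:
  fixes p :: "real \<Rightarrow> real ^ 'n \<Rightarrow> real ^ 'n \<Rightarrow> complex"
    and w1 w2 :: "real ^ 'n \<Rightarrow> real"
    and m \<epsilon> p1 p2 q \<alpha> :: real
  assumes "m > 0" and "\<epsilon> > 0"
    and "approx_identity m \<epsilon> p"
    and "derivative_bounds m \<epsilon> p"
    and "1 < p1" and "1 < p2" and "q > 0"
    and "0 < \<alpha>" and "\<alpha> < min 1 \<epsilon>"
    and "1 / q = 1 / p1 + 1 / p2 - (1 - \<alpha>) / real CARD('n)"
    and "weight w1" and "weight w2"
    and "A_condition p1 p2 q w1 w2"
  shows "\<exists>C::real. 0 \<le> C \<and>
    (\<forall>(c :: real ^ 'n) (r :: real) (f :: real ^ 'n \<Rightarrow> complex) (g :: real ^ 'n \<Rightarrow> complex).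
       0 < r \<longrightarrow> admissible \<epsilon> f g \<longrightarrow>
       wnorm q (product_weight p1 p2 q w1 w2) (ball c r)
         (\<lambda>x. f x * g x - kernel_op p (r powr m) f x * kernel_op p (r powr m) g x)
       \<le> ennreal (C * r powr \<alpha>) *
         (\<Sum>l. ennreal (2 powr (- real l * (\<epsilon> - \<alpha>))) *
            (wnorm p1 w1 (ball c (2 ^ (l + 1) * r)) (gradient f)
               * wnorm p2 w2 (ball c (2 ^ (l + 1) * r)) g
             + wnorm p1 w1 (ball c (2 ^ (l + 1) * r)) f
               * wnorm p2 w2 (ball c (2 ^ (l + 1) * r)) (gradient g))))"
proof -
  note [measurable] = weight_borel[OF \<open>weight w1\<close>] weight_borel[OF \<open>weight w2\<close>]
  have w_nonneg: "0 \<le> w1 x" "0 \<le> w2 x" for x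
    using assms by (auto simp: weight_def)
  define w where "w = product_weight p1 p2 q w1 w2"
  have w: "0 \<le> w x" for x
    by (simp add: w_def product_weight_def)
  have [measurable]: "w \<in> borel_measurable lebesgue"
    unfolding w_def product_weight_def by measurable
  obtain W where [measurable]: "W \<in> borel_measurable borel"
    and W: "\<And>k. (\<integral>\<^sup>+x. ennreal (w x) * k x \<partial>lebesgue) = (\<integral>\<^sup>+x. W x * k x \<partial>lborel)"
    using ex_borel_density[of "\<lambda>x. ennreal (w x)"] by auto
  obtain V1 where [measurable]: "V1 \<in> borel_measurable borel"
    and V1: "\<And>k. (\<integral>\<^sup>+x. ennreal (w1 x) * k x \<partial>lebesgue) = (\<integral>\<^sup>+x. V1 x * k x \<partial>lborel)"
    using ex_borel_density[of "\<lambda>x. ennreal (w1 x)"] by auto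
  obtain V2 where [measurable]: "V2 \<in> borel_measurable borel"
    and V2: "\<And>k. (\<integral>\<^sup>+x. ennreal (w2 x) * k x \<partial>lebesgue) = (\<integral>\<^sup>+x. V2 x * k x \<partial>lborel)"
    using ex_borel_density[of "\<lambda>x. ennreal (w2 x)"] by auto
  have W_ball: "(\<integral>\<^sup>+x\<in>E. ennreal (w x) \<partial>lebesgue) = (\<integral>\<^sup>+x\<in>E. W x \<partial>lborel)" for E
    by (rule W)
  have V1_ball: "(\<integral>\<^sup>+x\<in>E. ennreal (F x powr p1 * w1 x) \<partial>lebesgue) = (\<integral>\<^sup>+x\<in>E. ennreal (F x powr p1) * V1 x \<partial>lborel)" for E F
    using V1[of "\<lambda>x. ennreal (F x powr p1) * indicator E x"] w_nonneg
    by (simp add: ennreal_mult mult_ac)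
  have V2_ball: "(\<integral>\<^sup>+x\<in>E. ennreal (F x powr p2 * w2 x) \<partial>lebesgue) = (\<integral>\<^sup>+x\<in>E. ennreal (F x powr p2) * V2 x \<partial>lborel)" for E F
    using V2[of "\<lambda>x. ennreal (F x powr p2) * indicator E x"] w_nonneg
    by (simp add: ennreal_mult mult_ac)
  \<comment> \<open>By \<open>1 / conj_exp p = 1 - 1 / p\<close> the volume exponent is
    \<open>n * q\<close> times \<open>1 / q + 2 - 1 / p1 - 1 / p2\<close>, which the relation
    between the exponents turns into \<open>2 - (1 - \<alpha>) / n\<close>.\<close>
  have exponent: "real DIM(real ^ 'n) * (1 + q / conj_exp p1 + q / conj_exp p2) = q * (2 * real DIM(real ^ 'n) - 1 + \<alpha>)"
  proof -
    have "1 + q / conj_exp p1 + q / conj_exp p2 = q * (1 / q + 2 - (1 / p1 + 1 / p2))"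
      using assms by (simp add: conj_exp_def field_simps)
    also have "1 / q + 2 - (1 / p1 + 1 / p2) = 2 - (1 - \<alpha>) / real CARD('n)"
      using assms(10) by simp
    finally show ?thesis
      by (simp add: field_simps)
  qed
  obtain \<Theta> where \<Theta>: "0 \<le> \<Theta>" and ball_bound: "\<And>c R F1 F2. 0 < R \<Longrightarrow> (\<And>x. 0 \<le> F1 x) \<Longrightarrow> (\<And>x. 0 \<le> F2 x) \<Longrightarrow>
    F1 \<in> borel_measurable lebesgue \<Longrightarrow> F2 \<in> borel_measurable lebesgue \<Longrightarrow>
    (\<integral>\<^sup>+x\<in>ball c R. ennreal (w x) \<partial>lebesgue)
      * (ennpow (\<integral>\<^sup>+x\<in>ball c R. ennreal (F1 x) \<partial>lebesgue) q
        * ennpow (\<integral>\<^sup>+x\<in>ball c R. ennreal (F2 x) \<partial>lebesgue) q)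
    \<le> ennreal (\<Theta> * R powr (q * (2 * real DIM(real ^ 'n) - 1 + \<alpha>)))
      * (ennpow (\<integral>\<^sup>+x\<in>ball c R. ennreal (F1 x powr p1 * w1 x) \<partial>lebesgue) (q / p1)
        * ennpow (\<integral>\<^sup>+x\<in>ball c R. ennreal (F2 x powr p2 * w2 x) \<partial>lebesgue) (q / p2))"
    using A_condition_ball_bound[of p1 p2 q w1 w2, unfolded exponent, folded w_def] assms w_nonneg
    by (auto simp: weight_borel)
  interpret bilinear_weights W V1 V2 p1 p2 q \<alpha> \<Theta>
  proof
    \<comment> \<open>The condition \<open>\<alpha> < 1\<close> enters here.\<close>
    have "1 / q \<le> 1 / p1 + 1 / p2"
      using assms by (simp add: divide_nonneg_pos)
    then have "q * (1 / q) \<le> q * (1 / p1 + 1 / p2)"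
      using assms by (intro mult_left_mono) auto
    then show "1 \<le> q / p1 + q / p2"
      using \<open>q > 0\<close> by (simp add: distrib_left)
  next
    fix c :: "real ^ 'n" and R :: real and F1 F2 :: "real ^ 'n \<Rightarrow> real"
    assume "0 < R" "\<And>x. 0 \<le> F1 x" "\<And>x. 0 \<le> F2 x" "F1 \<in> borel_measurable borel" "F2 \<in> borel_measurable borel"
    then show "(\<integral>\<^sup>+x\<in>ball c R. W x \<partial>lborel)
        * (ennpow (\<integral>\<^sup>+x\<in>ball c R. ennreal (F1 x) \<partial>lborel) q * ennpow (\<integral>\<^sup>+x\<in>ball c R. ennreal (F2 x) \<partial>lborel) q)
      \<le> ennreal (\<Theta> * R powr (q * (2 * real DIM(real ^ 'n) - 1 + \<alpha>)))
        * (ennpow (\<integral>\<^sup>+x\<in>ball c R. ennreal (F1 x powr p1) * V1 x \<partial>lborel) (q / p1)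
          * ennpow (\<integral>\<^sup>+x\<in>ball c R. ennreal (F2 x powr p2) * V2 x \<partial>lborel) (q / p2))"
      using ball_bound[of R F1 F2 c, unfolded W_ball V1_ball V2_ball, unfolded nn_integral_completion]
      by (simp add: measurable_completion)
  qed (use assms \<Theta> in auto)
  have \<delta>: "0 < \<alpha> / 2" "\<alpha> / 2 \<le> \<epsilon>"
    using assms by auto
  obtain A where A: "0 \<le> A" and pointwise: "\<And>r x f g. 0 < r \<Longrightarrow> admissible \<epsilon> f g \<Longrightarrow>
    ennreal (norm (f x * g x - kernel_op p (r powr m) f x * kernel_op p (r powr m) g x))
    \<le> ennreal A *
      (bilinear_potential \<epsilon> (\<alpha> / 2) r (\<lambda>y. ennreal (norm (gradient f y))) (\<lambda>y. ennreal (norm (g y))) x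
       + bilinear_potential \<epsilon> (\<alpha> / 2) r (\<lambda>y. ennreal (norm (f y))) (\<lambda>y. ennreal (norm (gradient g y))) x)"
    using pointwise_potential_bound[OF assms(1,2) \<delta> assms(3)] by auto
  obtain B where B: "0 \<le> B" and potential: "\<And>c r F1 F2. 0 < r \<Longrightarrow> \<forall>x. 0 \<le> F1 x \<Longrightarrow> \<forall>x. 0 \<le> F2 x \<Longrightarrow>
    F1 \<in> borel_measurable borel \<Longrightarrow> F2 \<in> borel_measurable borel \<Longrightarrow>
    (\<integral>\<^sup>+x\<in>ball c (2 * r). ennreal (F1 x powr p1) * V1 x \<partial>lborel) < \<infinity> \<Longrightarrow>
    (\<integral>\<^sup>+x\<in>ball c (2 * r). ennreal (F2 x powr p2) * V2 x \<partial>lborel) < \<infinity> \<Longrightarrow>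
    ennpow (\<integral>\<^sup>+x\<in>ball c r. W x * ennpow (bilinear_potential \<epsilon> (\<alpha> / 2) r (\<lambda>y. ennreal (F1 y)) (\<lambda>y. ennreal (F2 y)) x) q \<partial>lborel) (1 / q)
    \<le> ennreal (B * r powr \<alpha>) * dilates_sum \<epsilon> c r F1 F2"
    using bilinear_potential_bound[OF assms(2)] by auto
  \<comment> \<open>\<open>A\<close> comes from the pointwise domination,
    \<open>2 * 2 powr (1 / q)\<close> from splitting into the two potentials, \<open>B\<close> from
    the weighted bound for each of them.\<close>
  define C where "C = A * 2 * 2 powr (1 / q) * B"
  show ?thesis
  proof (intro exI[of _ C] conjI allI impI)
    show "0 \<le> C"
      using A B by (simp add: C_def)
  next
    fix c :: "real ^ 'n" and r :: real and f g :: "real ^ 'n \<Rightarrow> complex"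
    assume r: "0 < r" and adm: "admissible \<epsilon> f g"
    have C1: "C1 f" "C1 g"
      using adm by (auto simp: admissible_def)
    note [measurable] = C1_borel[OF C1(1)] C1_borel[OF C1(2)]
    have cont: "continuous_on UNIV (\<lambda>x. norm (f x))" "continuous_on UNIV (\<lambda>x. norm (g x))"
      "continuous_on UNIV (\<lambda>x. norm (gradient f x))" "continuous_on UNIV (\<lambda>x. norm (gradient g x))"
      using C1 C1_continuous[OF C1(1)] C1_continuous[OF C1(2)] by (auto simp: C1_def intro: continuous_on_norm)
    have fin1: "(\<integral>\<^sup>+x\<in>ball c (2 * r). ennreal (F x powr p1) * V1 x \<partial>lborel) < \<infinity>"
      if "continuous_on UNIV F" "\<And>x. 0 \<le> F x" for F
      using weighted_integral_finite[OF \<open>weight w1\<close> that, of p1 c "2 * r"] assms unfolding V1_ball by simp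
    have fin2: "(\<integral>\<^sup>+x\<in>ball c (2 * r). ennreal (F x powr p2) * V2 x \<partial>lborel) < \<infinity>"
      if "continuous_on UNIV F" "\<And>x. 0 \<le> F x" for F
      using weighted_integral_finite[OF \<open>weight w2\<close> that, of p2 c "2 * r"] assms unfolding V2_ball by simp
    define h where "h x = f x * g x - kernel_op p (r powr m) f x * kernel_op p (r powr m) g x" for x
    define P1 where "P1 = bilinear_potential \<epsilon> (\<alpha> / 2) r (\<lambda>y. ennreal (norm (gradient f y))) (\<lambda>y. ennreal (norm (g y)))"
    define P2 where "P2 = bilinear_potential \<epsilon> (\<alpha> / 2) r (\<lambda>y. ennreal (norm (f y))) (\<lambda>y. ennreal (norm (gradient g y)))"
    define D1 where "D1 = dilates_sum \<epsilon> c r (\<lambda>x. norm (gradient f x)) (\<lambda>x. norm (g x))"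
    define D2 where "D2 = dilates_sum \<epsilon> c r (\<lambda>x. norm (f x)) (\<lambda>x. norm (gradient g x))"
    have [measurable]: "P1 \<in> borel_measurable borel" "P2 \<in> borel_measurable borel"
      unfolding P1_def P2_def by measurable
    \<comment> \<open>The density identity may be used for any integrand; measurability of the
      kernel in \<open>x\<close>, and thus of \<open>h\<close>, is not assumed.\<close>
    have "wnorm q w (ball c r) h = ennpow (\<integral>\<^sup>+x\<in>ball c r. W x * ennpow (ennreal (norm (h x))) q \<partial>lborel) (1 / q)"
      using W[of "\<lambda>x. ennpow (ennreal (norm (h x))) q * indicator (ball c r) x"] w \<open>q > 0\<close>
      by (simp add: wnorm_def ennpow_ennreal ennreal_mult mult_ac)
    also have "\<dots> \<le> ennreal (A * 2 * 2 powr (1 / q))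
        * (ennpow (\<integral>\<^sup>+x\<in>ball c r. W x * ennpow (P1 x) q \<partial>lborel) (1 / q)
          + ennpow (\<integral>\<^sup>+x\<in>ball c r. W x * ennpow (P2 x) q \<partial>lborel) (1 / q))"
      using \<open>q > 0\<close> A pointwise[OF r adm] by (intro weighted_quasi_triangle) (auto simp: h_def P1_def P2_def)
    also have "\<dots> \<le> ennreal (A * 2 * 2 powr (1 / q)) * (ennreal (B * r powr \<alpha>) * D1 + ennreal (B * r powr \<alpha>) * D2)"
      unfolding P1_def P2_def D1_def D2_def
      by (intro mult_left_mono add_mono potential[OF r] fin1 fin2 cont) auto
    also have "\<dots> = ennreal (C * r powr \<alpha>) * (D1 + D2)"
    proof -
      have "ennreal (C * r powr \<alpha>) = ennreal (A * 2 * 2 powr (1 / q)) * ennreal (B * r powr \<alpha>)"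
        using A B by (subst ennreal_mult[symmetric]) (auto simp: C_def mult.assoc)
      then show ?thesis
        by (simp only: distrib_left mult.assoc)
    qed
    also have "D1 + D2 = (\<Sum>l. ennreal (2 powr (- real l * (\<epsilon> - \<alpha>))) *
            (wnorm p1 w1 (ball c (2 ^ (l + 1) * r)) (gradient f)
               * wnorm p2 w2 (ball c (2 ^ (l + 1) * r)) g
             + wnorm p1 w1 (ball c (2 ^ (l + 1) * r)) f
               * wnorm p2 w2 (ball c (2 ^ (l + 1) * r)) (gradient g)))"
      unfolding D1_def D2_def dilates_sum_def wnorm_def V1_ball V2_ball distrib_left
      by (rule suminf_add) (rule summableI)+
    finally show "wnorm q (product_weight p1 p2 q w1 w2) (ball c r)
         (\<lambda>x. f x * g x - kernel_op p (r powr m) f x * kernel_op p (r powr m) g x)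
       \<le> ennreal (C * r powr \<alpha>) *
         (\<Sum>l. ennreal (2 powr (- real l * (\<epsilon> - \<alpha>))) *
            (wnorm p1 w1 (ball c (2 ^ (l + 1) * r)) (gradient f)
               * wnorm p2 w2 (ball c (2 ^ (l + 1) * r)) g
             + wnorm p1 w1 (ball c (2 ^ (l + 1) * r)) f
               * wnorm p2 w2 (ball c (2 ^ (l + 1) * r)) (gradient g)))"
      by (simp only: w_def h_def[abs_def])
  qed
qed

end
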